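(* Let $G$ be a finite abelian group of one of the following forms: (a) $G = H_p \oplus C_{q^k}$ with distinct primes $p,q$, a positive integer $k$, and $H_p$ any finite abelian $p$-group; (b) $G = C_p \oplus C_q \oplus C_r$ with distinct primes $p,q,r$. Let $p_1,\dots,p_s$ be the distinct prime divisors of $\exp(G)$ and, for each $i$, let $G_{p_i}$ be the $p_i$-primary component of $G$. Then: (1) every minimal zero-sum sequence $U$ over $G$ with $\mathsf{k}(U)=\mathsf{K}(G)$ has the form $U = g\,U_1U_2\cdots U_s$ for some $g\in G$, where each $U_i$ is a zero-sum free sequence over $G_{p_i}$; (2) $\mathsf{K}(G)=\mathsf{K}^\star(G)=\mathsf{k}^\star(G)+\frac{1}{\exp(G)}$, and every zero-sum free sequence $S$ over $G$ with $\mathsf{k}(S)=\mathsf{k}^\star(G)$ has the form $S=S_1S_2\cdots S_s$, where each $S_i$ is a zero-sum free sequence over $G_{p_i}$.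
   Context: All groups are finite abelian, written additively; $C_n$ is cyclic of order $n$; $\exp(G)$ is the least common multiple of element orders. A sequence over $G$ is a finite unordered sequence of elements of $G$ with repetition allowed; $v_g(S)$ denotes the multiplicity of $g$ in $S$; juxtaposition denotes concatenation; a subsequence $T\mid S$ has $v_g(T)\le v_g(S)$ for all $g$. The sum is $\sigma(S)=\sum_g v_g(S)g$. $S$ is zero-sum if $\sigma(S)=0$; zero-sum free if no nonempty subsequence has sum $0$; minimal zero-sum if it is nonempty, zero-sum, and has no nonempty proper zero-sum subsequence. The cross number is $\mathsf{k}(S)=\sum_g v_g(S)/\operatorname{ord}(g)$. $\mathsf{k}(G)$ is the maximum of $\mathsf{k}(S)$ over zero-sum free $S$ over $G$; $\mathsf{K}(G)$ is the maximum of $\mathsf{k}(S)$ over minimal zero-sum $S$ over $G$. If $G\cong\bigoplus_{i=1}^r C_{q_i^{\alpha_i}}$ with prime powers $q_i^{\alpha_i}$, then $\mathsf{k}^\star(G)=\sum_{i=1}^r(1-1/q_i^{\alpha_i})$ and $\mathsf{K}^\star(G)=\mathsf{k}^\star(G)+1/\exp(G)$. *)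

theory Defs
  imports
    "HOL-Library.Multiset"
    "HOL-Number_Theory.Prime_Powers"
    "HOL-Algebra.Multiplicative_Group"
    "HOL-Algebra.Product_Groups"
begin

text \<open>
  Finite abelian groups are \<^locale>\<open>comm_group\<close>s of HOL-Algebra and hence written multiplicatively:
  the additive zero is \<open>\<one>\<close> and a multiple \<open>n g\<close> is \<open>g [^] n\<close>. A sequence over \<open>G\<close> is a
  multiset of elements of \<open>carrier G\<close>; \<open>v\<^sub>g(S)\<close> is \<open>count S g\<close>, subsequences are submultisets
  and concatenation is addition of multisets.
\<close>

definition seq_sum :: "('a, 'b) monoid_scheme \<Rightarrow> 'a multiset \<Rightarrow> 'a" where
  "seq_sum G S = (\<Otimes>\<^bsub>G\<^esub>g\<in>set_mset S. g [^]\<^bsub>G\<^esub> count S g)"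

definition zero_sum :: "('a, 'b) monoid_scheme \<Rightarrow> 'a multiset \<Rightarrow> bool" where
  "zero_sum G S \<longleftrightarrow> set_mset S \<subseteq> carrier G \<and> seq_sum G S = \<one>\<^bsub>G\<^esub>"

definition zero_sum_free :: "('a, 'b) monoid_scheme \<Rightarrow> 'a multiset \<Rightarrow> bool" where
  "zero_sum_free G S \<longleftrightarrow>
     set_mset S \<subseteq> carrier G \<and> (\<forall>T. T \<subseteq># S \<and> T \<noteq> {#} \<longrightarrow> \<not> zero_sum G T)"

definition minimal_zero_sum :: "('a, 'b) monoid_scheme \<Rightarrow> 'a multiset \<Rightarrow> bool" where
  "minimal_zero_sum G S \<longleftrightarrow>
     S \<noteq> {#} \<and> zero_sum G S \<and> (\<forall>T. T \<subset># S \<and> T \<noteq> {#} \<longrightarrow> \<not> zero_sum G T)"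

definition cross_number :: "('a, 'b) monoid_scheme \<Rightarrow> 'a multiset \<Rightarrow> real" where
  "cross_number G S = (\<Sum>g\<in>set_mset S. real (count S g) / real (group.ord G g))"

text \<open>
  For finite \<open>G\<close> the set below is finite and nonempty (the length of a minimal zero-sum
  sequence is at most \<open>|G|\<close>), so \<^const>\<open>Max\<close> is the genuine maximum.
\<close>
definition group_cross_number :: "('a, 'b) monoid_scheme \<Rightarrow> real" where
  "group_cross_number G = Max {cross_number G S | S. minimal_zero_sum G S}"

definition group_exp :: "('a, 'b) monoid_scheme \<Rightarrow> nat" where
  "group_exp G = Lcm (group.ord G ` carrier G)"

definition primary_component :: "('a, 'b) monoid_scheme \<Rightarrow> nat \<Rightarrow> 'a set" where
  "primary_component G p = {g \<in> carrier G. \<exists>n. group.ord G g = p ^ n}"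

definition prime_power_decomposition :: "('a, 'b) monoid_scheme \<Rightarrow> nat list \<Rightarrow> bool" where
  "prime_power_decomposition G ns \<longleftrightarrow>
     (\<forall>n\<in>set ns. primepow n) \<and>
     G \<cong> product_group {..<length ns} (\<lambda>i. integer_mod_group (ns ! i))"

text \<open>
  Every finite abelian group has such a decomposition, and it is unique up to the order of
  the factors, so the value of the sum does not depend on the choice.
\<close>
definition k_star :: "('a, 'b) monoid_scheme \<Rightarrow> real" where
  "k_star G = (\<Sum>n\<leftarrow>(SOME ns. prime_power_decomposition G ns). 1 - 1 / real n)"

definition K_star :: "('a, 'b) monoid_scheme \<Rightarrow> real" where
  "K_star G = k_star G + 1 / real (group_exp G)"

end

theory Submission
  imports "HOL-Library.Poly_Mapping" "HOL-Number_Theory.Cong" "Jordan_Normal_Form.Char_Poly" Defs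
begin

text \<open>
  Call an element mixed if its order is not a prime power. If a minimal zero-sum sequence \<open>U\<close>
  has at most one mixed term \<open>g\<close>, then for each prime \<open>p\<close> the terms of \<open>p\<close>-power order together
  with the \<open>p\<close>-component of \<open>g\<close> form a minimal zero-sum sequence over \<open>G\<^sub>p\<close>, and Olson's group
  algebra argument with weighted variables gives \<open>k(U) \<le> K\<^sup>*(G)\<close>.

  If \<open>U\<close> has at least two mixed terms, write \<open>G = H \<oplus> C\<^sub>n\<close> with a \<open>p\<close>-group \<open>H\<close> and \<open>p\<close> not
  dividing \<open>n\<close>. For roots of unity \<open>\<omega>\<^sub>i\<close> the product of the \<open>\<omega>\<^sub>i - X^(g\<^sub>i)\<close> over a zero-sum free
  sequence is nonzero modulo \<open>p\<close>, so some character \<open>\<chi>\<close> of \<open>C\<^sub>n\<close> does not kill it, and the terms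
  with \<open>\<chi>(g\<^sub>i) = \<omega>\<^sub>i\<close> have total \<open>H\<close>-weight at most \<open>k\<^sup>*(H)\<close>. The characters with
  \<open>\<chi>(g\<^sub>i) = \<omega>\<^sub>i\<close> form a residue class modulo the order of the \<open>C\<^sub>n\<close>-part of \<open>g\<^sub>i\<close>, which can be
  placed freely. Hence a weighted covering of all residues modulo \<open>n\<close> that leaves out one term of
  \<open>U\<close> is impossible, whereas \<open>k(U) \<ge> K\<^sup>*(G)\<close> and two mixed terms make such a covering exist when
  \<open>n\<close> is a prime power, and when \<open>n\<close> is a product of two primes and \<open>H\<close> has prime order.
\<close>

section \<open>Zero-sums over p-groups\<close>

text \<open>The area of a residue class does not depend on where it is placed, so k(U) >= K^*(G),
  multiplied by exp(G), is a statement about the total height over the n residues. A covering by all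
  of U would prove nothing, because U itself is zero-sum: one term has to be spared, and the waste
  caused by overlapping classes must be paid for. Two mixed terms supply the room. When n is a prime
  power, each of them weighs at most half of the largest weight and they can be kept on disjoint
  classes. A single mixed term gives no such saving, and indeed K^*(G) is attained there. The
  comparison of coefficients takes place in Z[zeta]; it returns to the integers because pZ[zeta]
  meets Z in pZ and p does not divide n. Since the bound for two mixed terms is strict, an extremal
  U has at most one. That term is g, and the others sort by the prime of their order. For (2), S is
  completed by the inverse of its sum, whose order is forced to be exp(G).\<close>

lemma power_prime_add_mod:
  fixes a b :: "'r::comm_ring_1"
  assumes "prime p"
  shows "\<exists>z. (a + b) ^ p = a ^ p + b ^ p + of_nat p * z"
proof -
  have p: "p \<ge> 2" using assms prime_ge_2_nat by blast
  have split: "{..p} = {0, p} \<union> {1..<p}" using p by auto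
  have "(a + b) ^ p = (\<Sum>k\<le>p. of_nat (p choose k) * a ^ k * b ^ (p - k))"
    by (rule binomial_ring)
  also have "\<dots> = (\<Sum>k\<in>{0,p}. of_nat (p choose k) * a ^ k * b ^ (p - k))
      + (\<Sum>k\<in>{1..<p}. of_nat (p choose k) * a ^ k * b ^ (p - k))"
    unfolding split using p by (subst sum.union_disjoint) auto
  also have "(\<Sum>k\<in>{0,p}. of_nat (p choose k) * a ^ k * b ^ (p - k)) = a ^ p + b ^ p"
    using p by (simp add: add.commute)
  also have "(\<Sum>k\<in>{1..<p}. of_nat (p choose k) * a ^ k * b ^ (p - k))
      = of_nat p * (\<Sum>k\<in>{1..<p}. of_nat ((p choose k) div p) * a ^ k * b ^ (p - k))"
  proof -
    have "of_nat (p choose k) = (of_nat p * of_nat ((p choose k) div p) :: 'r)" if "k \<in> {1..<p}" for k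
    proof -
      have "p dvd (p choose k)" using that assms by (intro dvd_choose_prime) auto
      then have "p choose k = p * ((p choose k) div p)" by simp
      then show ?thesis by (metis of_nat_mult)
    qed
    then show ?thesis by (simp add: sum_distrib_left mult.assoc)
  qed
  finally show ?thesis by blast
qed

lemma power_prime_power_add_mod:
  fixes a b :: "'r::comm_ring_1"
  assumes "prime p"
  shows "\<exists>z. (a + b) ^ (p ^ s) = a ^ (p ^ s) + b ^ (p ^ s) + of_nat p * z"
proof (induction s)
  case 0
  show ?case by (intro exI[of _ 0]) simp
next
  case (Suc s)
  then obtain z where z: "(a + b) ^ (p ^ s) = a ^ (p ^ s) + b ^ (p ^ s) + of_nat p * z" by blast
  obtain z1 where z1: "(a ^ (p ^ s) + b ^ (p ^ s) + of_nat p * z) ^ p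
      = (a ^ (p ^ s) + b ^ (p ^ s)) ^ p + (of_nat p * z) ^ p + of_nat p * z1"
    using power_prime_add_mod[OF assms] by blast
  obtain z2 where z2: "(a ^ (p ^ s) + b ^ (p ^ s)) ^ p
      = (a ^ (p ^ s)) ^ p + (b ^ (p ^ s)) ^ p + of_nat p * z2"
    using power_prime_add_mod[OF assms] by blast
  obtain u where u: "(of_nat p * z) ^ p = of_nat p * u"
    using assms prime_gt_0_nat[OF assms] by (metis dvd_def dvd_mult2 dvd_power power_mult_distrib)
  have "(a + b) ^ (p ^ Suc s) = ((a + b) ^ (p ^ s)) ^ p"
    by (simp add: power_mult[symmetric] mult.commute)
  also have "\<dots> = a ^ (p ^ Suc s) + b ^ (p ^ Suc s) + of_nat p * (z2 + u + z1)"
    unfolding z z1 z2 u by (simp add: power_mult[symmetric] mult.commute algebra_simps)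
  finally show ?case by blast
qed

lemma one_minus_power_prime_power_mod:
  fixes x :: "'r::comm_ring_1"
  assumes "prime p"
  shows "\<exists>z. 1 - x ^ (p ^ s) = (1 - x) ^ (p ^ s) + of_nat p * z"
  \<comment> \<open>Splitting 1 as \<open>(1 - x) + x\<close> avoids the sign of
    \<open>(-1) ^ (p ^ s)\<close>, so \<open>p = 2\<close> needs no case of its own.\<close>
  using power_prime_power_add_mod[OF assms, of "1 - x" x s] by (auto simp: algebra_simps)

section \<open>Weighted filtrations modulo p\<close>

text \<open>Level \<open>t\<close> consists of the elements that are, modulo \<open>P\<close>,
  combinations of monomials in the \<open>Y j\<close> of weight at least \<open>t\<close>. The
  inductive form spares writing such combinations down. Multiples of \<open>P\<close> lie in every
  level because the target ideal will contain \<open>P\<close>.\<close>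

inductive wfilt :: "'r::comm_ring_1 \<Rightarrow> 'j set \<Rightarrow> ('j \<Rightarrow> 'r) \<Rightarrow> ('j \<Rightarrow> nat) \<Rightarrow> nat \<Rightarrow> 'r \<Rightarrow> bool"
  for P J Y w where
  base: "wfilt P J Y w 0 x"
| add: "wfilt P J Y w t x \<Longrightarrow> wfilt P J Y w t y \<Longrightarrow> wfilt P J Y w t (x + y)"
| scale: "wfilt P J Y w t x \<Longrightarrow> wfilt P J Y w t (a * x)"
| step: "j \<in> J \<Longrightarrow> wfilt P J Y w t x \<Longrightarrow> wfilt P J Y w (t + w j) (Y j * x)"
| modulus: "wfilt P J Y w t (P * x)"
| mono: "wfilt P J Y w t x \<Longrightarrow> s \<le> t \<Longrightarrow> wfilt P J Y w s x"

lemma wfilt_0: "wfilt P J Y w t 0"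
  using wfilt.modulus[of P J Y w t 0] by simp

lemma wfilt_mult:
  assumes "wfilt P J Y w s x" "wfilt P J Y w t y"
  shows "wfilt P J Y w (s + t) (x * y)"
  using assms(1)
proof induction
  case (base x)
  then show ?case using assms(2) by (simp add: wfilt.scale)
next
  case (add s x y)
  then show ?case by (simp add: algebra_simps wfilt.add)
next
  case (scale s x a)
  then show ?case using wfilt.scale by (simp add: mult.assoc) blast
next
  case (step j s x)
  then show ?case using wfilt.step[of j J P Y w "s + t" "x * y"] by (simp add: mult.assoc add_ac)
next
  case (modulus s x)
  then show ?case by (simp add: mult.assoc wfilt.modulus)
next
  case (mono s x s')
  then show ?case using wfilt.mono[of P J Y w "s + t" "x * y" "s' + t"] by simp
qed

lemma wfilt_prod:
  assumes "finite I" "\<And>i. i \<in> I \<Longrightarrow> wfilt P J Y w (t i) (f i)"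
  shows "wfilt P J Y w (\<Sum>i\<in>I. t i) (\<Prod>i\<in>I. f i)"
  using assms by (induction I rule: finite_induct) (auto intro: wfilt.base wfilt_mult)

lemma wfilt_power:
  assumes "wfilt P J Y w t f" shows "wfilt P J Y w (n * t) (f ^ n)"
  by (induction n) (auto intro: wfilt.base wfilt_mult assms)

lemma wfilt_one_minus_prod:
  assumes "finite K" "\<And>j. j \<in> K \<Longrightarrow> wfilt P J Y w t (1 - g j)"
  shows "wfilt P J Y w t (1 - (\<Prod>j\<in>K. g j))"
  using assms
proof (induction K rule: finite_induct)
  case empty
  show ?case by (simp add: wfilt_0)
next
  case (insert k K)
  have eq: "1 - (\<Prod>j\<in>insert k K. g j) = (1 - g k) + g k * (1 - (\<Prod>j\<in>K. g j))"
    using insert by (simp add: algebra_simps)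
  show ?case unfolding eq using insert by (intro wfilt.add wfilt.scale) auto
qed

text \<open>Pigeonhole on monomials: once the weight exceeds the sum of the
  \<open>(n j - 1) * w j\<close>, some exponent reaches \<open>n j\<close>. The prefactor with
  exponents \<open>al\<close> carries the induction: in case \<open>step\<close> the factor
  \<open>Y j\<close> moves into it, and the total weight stays the same.\<close>

lemma wfilt_in_ideal:
  fixes Y :: "'j \<Rightarrow> 'r::comm_ring_1"
  assumes J: "finite J"
    and a_add: "\<And>x y. x \<in> A \<Longrightarrow> y \<in> A \<Longrightarrow> x + y \<in> A"
    and a_mult: "\<And>x y. x \<in> A \<Longrightarrow> y * x \<in> A"
    and P: "P \<in> A" and Y: "\<And>j. j \<in> J \<Longrightarrow> Y j ^ n j \<in> A"
    and W: "wfilt P J Y w t x"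
    and big: "(\<Sum>j\<in>J. (n j - 1) * w j) < (\<Sum>j\<in>J. al j * w j) + t"
  shows "(\<Prod>j\<in>J. Y j ^ al j) * x \<in> A"
  using W big
proof (induction arbitrary: al)
  case (base x)
  have "\<exists>j\<in>J. n j \<le> al j"
  proof (rule ccontr)
    assume "\<not> ?thesis"
    then have "(\<Sum>j\<in>J. al j * w j) \<le> (\<Sum>j\<in>J. (n j - 1) * w j)"
      by (intro sum_mono mult_right_mono) (auto simp: not_le)
    with base show False by simp
  qed
  then obtain j where j: "j \<in> J" "n j \<le> al j" by blast
  have "Y j ^ al j = Y j ^ (al j - n j) * Y j ^ n j"
    using j by (simp flip: power_add)
  then have "Y j ^ al j \<in> A" using a_mult Y j by simp
  moreover have "(\<Prod>j\<in>J. Y j ^ al j) * x = ((\<Prod>j\<in>J - {j}. Y j ^ al j) * x) * Y j ^ al j"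
    using J j by (simp add: prod.remove[of J j] mult_ac)
  ultimately show ?case using a_mult by metis
next
  case (add t x y)
  then show ?case by (simp add: distrib_left a_add)
next
  case (scale t x a)
  then show ?case using a_mult by (metis mult.left_commute)
next
  case (step j t x)
  define al' where "al' = al(j := Suc (al j))"
  have *: "(\<Sum>i\<in>J. al' i * w i) = (\<Sum>i\<in>J. al i * w i) + w j"
    using J step(1) unfolding al'_def by (subst (1 2) sum.remove[of J j]) (auto intro!: sum.cong)
  have **: "(\<Prod>i\<in>J. Y i ^ al' i) = (\<Prod>i\<in>J. Y i ^ al i) * Y j"
    using J step(1) unfolding al'_def
    by (subst (1 2) prod.remove[of J j]) (auto simp: mult_ac intro!: prod.cong)
  have "(\<Prod>i\<in>J. Y i ^ al' i) * x \<in> A"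
    by (rule step.IH) (use step.prems * in simp)
  then show ?case unfolding ** by (simp add: mult.assoc)
next
  case (modulus t x)
  then show ?case using a_mult[OF P] by (metis mult.commute mult.left_commute)
next
  case (mono t x s)
  then show ?case by simp
qed

text \<open>The variable \<open>1 - X j\<close> weighs \<open>p ^ e\<close> divided by
  \<open>p ^ a j\<close>. A term of order dividing \<open>p ^ m\<close> has \<open>j\<close>-th
  coordinate divisible by \<open>p ^ (a j - m)\<close>, and modulo \<open>p\<close> the element
  \<open>1 - X j ^ (p ^ s)\<close> is the \<open>p ^ s\<close>-th power of the variable. So the
  weight reaches \<open>p ^ e\<close> divided by \<open>p ^ m\<close>, the scaled reciprocal of the
  order.\<close>

lemma wfilt_one_minus_power:
  fixes X :: "'j \<Rightarrow> 'r::comm_ring_1"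
  assumes p: "prime p" and j: "j \<in> J" and a: "a j \<le> e" and m: "m \<le> e"
    and dv: "p ^ a j dvd p ^ m * c"
  shows "wfilt (of_nat p) J (\<lambda>j. 1 - X j) (\<lambda>j. p ^ (e - a j)) (p ^ (e - m)) (1 - X j ^ c)"
proof -
  let ?W = "wfilt (of_nat p :: 'r) J (\<lambda>j. 1 - X j) (\<lambda>j. p ^ (e - a j))"
  have p0: "p > 0" using p prime_gt_0_nat by blast
  have Y: "?W (p ^ (e - a j)) (1 - X j)"
    using wfilt.step[OF j wfilt.base, of "of_nat p" "\<lambda>j. 1 - X j" "\<lambda>j. p ^ (e - a j)" 1] by simp
  \<comment> \<open>The subtraction is truncated: \<open>s = 0\<close> when
    \<open>a j \<le> m\<close>.\<close>
  define s where "s = a j - m"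
  have sdvd: "p ^ s dvd c"
  proof (cases "a j \<le> m")
    case True then show ?thesis by (simp add: s_def)
  next
    case False
    then have "p ^ a j = p ^ m * p ^ s" by (simp add: s_def flip: power_add)
    with dv p0 show ?thesis by simp
  qed
  then obtain c' where c': "c = p ^ s * c'" by blast
  obtain z where z: "1 - X j ^ (p ^ s) = (1 - X j) ^ (p ^ s) + of_nat p * z"
    using one_minus_power_prime_power_mod[OF p] by blast
  have "?W (p ^ s * p ^ (e - a j)) (1 - X j ^ (p ^ s))"
    unfolding z by (intro wfilt.add wfilt_power Y wfilt.modulus)
  moreover have "p ^ (e - m) \<le> p ^ s * p ^ (e - a j)"
    using a m p0 unfolding s_def by (subst power_add[symmetric]) (auto intro!: power_increasing)
  ultimately have W1: "?W (p ^ (e - m)) (1 - X j ^ (p ^ s))" by (rule wfilt.mono)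
  have "1 - X j ^ c = (\<Sum>i<c'. (X j ^ p ^ s) ^ i) * (1 - X j ^ (p ^ s))"
    unfolding c' power_mult by (subst one_diff_power_eq) (simp add: mult.commute)
  then show ?thesis using wfilt.scale[OF W1] by simp
qed

text \<open>The factors have total weight on the right of \<open>big\<close>, whereas a monomial
  with all exponents below \<open>p ^ a j\<close> weighs at most the left side. Modulo
  \<open>p\<close>, \<open>(1 - X j) ^ (p ^ a j)\<close> agrees with the element of \<open>A\<close>
  assumed in \<open>X\<close>.\<close>

lemma prod_one_minus_in_ideal:
  fixes X :: "'j \<Rightarrow> 'r::comm_ring_1"
  assumes p: "prime p" and J: "finite J" and I: "finite I"
    and a: "\<And>j. j \<in> J \<Longrightarrow> a j \<le> e" and m: "\<And>i. i \<in> I \<Longrightarrow> m i \<le> e"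
    and dv: "\<And>i j. i \<in> I \<Longrightarrow> j \<in> J \<Longrightarrow> p ^ a j dvd p ^ m i * x i j"
    and big: "(\<Sum>j\<in>J. p ^ e - p ^ (e - a j)) < (\<Sum>i\<in>I. p ^ (e - m i))"
    and a_add: "\<And>x y. x \<in> A \<Longrightarrow> y \<in> A \<Longrightarrow> x + y \<in> A"
    and a_mult: "\<And>x y. x \<in> A \<Longrightarrow> y * x \<in> A"
    and P: "of_nat p \<in> A" and X: "\<And>j. j \<in> J \<Longrightarrow> 1 - X j ^ (p ^ a j) \<in> A"
  shows "(\<Prod>i\<in>I. 1 - (\<Prod>j\<in>J. X j ^ x i j)) \<in> A"
proof -
  let ?W = "wfilt (of_nat p :: 'r) J (\<lambda>j. 1 - X j) (\<lambda>j. p ^ (e - a j))"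
  have W: "?W (\<Sum>i\<in>I. p ^ (e - m i)) (\<Prod>i\<in>I. 1 - (\<Prod>j\<in>J. X j ^ x i j))"
    by (intro wfilt_prod I wfilt_one_minus_prod J wfilt_one_minus_power p) (use a m dv in auto)
  have Y: "(1 - X j) ^ (p ^ a j) \<in> A" if j: "j \<in> J" for j
  proof -
    obtain z where "1 - X j ^ (p ^ a j) = (1 - X j) ^ (p ^ a j) + of_nat p * z"
      using one_minus_power_prime_power_mod[OF p] by blast
    then have "(1 - X j) ^ (p ^ a j) = (1 - X j ^ (p ^ a j)) + (- z) * of_nat p"
      by (simp add: algebra_simps)
    then show ?thesis using a_add a_mult P X j by metis
  qed
  have "(p ^ a j - 1) * p ^ (e - a j) = p ^ e - p ^ (e - a j)" if "j \<in> J" for j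
    using a[OF that] by (simp add: diff_mult_distrib flip: power_add)
  then have "(\<Sum>j\<in>J. (p ^ a j - 1) * p ^ (e - a j)) < (\<Sum>j\<in>J. 0 * p ^ (e - a j)) + (\<Sum>i\<in>I. p ^ (e - m i))"
    using big by simp
  then have "(\<Prod>j\<in>J. (1 - X j) ^ (\<lambda>_. 0) j) * (\<Prod>i\<in>I. 1 - (\<Prod>j\<in>J. X j ^ x i j)) \<in> A"
    by (intro wfilt_in_ideal[where n = "\<lambda>j. p ^ a j", OF J a_add a_mult P Y W]) auto
  then show ?thesis by simp
qed

section \<open>Coefficient sums over residue classes of exponent vectors\<close>

text \<open>With \<open>C\<close> a congruence condition on exponent vectors, this is one
  coefficient of the image of \<open>f\<close> in the integral group ring of a finite p-group. The
  group enters only through \<open>C\<close>, which avoids forming the quotient ring.\<close>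

definition class_coeff :: "((nat \<Rightarrow>\<^sub>0 nat) \<Rightarrow> bool) \<Rightarrow> ((nat \<Rightarrow>\<^sub>0 nat) \<Rightarrow>\<^sub>0 int) \<Rightarrow> int" where
  "class_coeff C f = (\<Sum>c\<in>Poly_Mapping.keys f. Poly_Mapping.lookup f c * of_bool (C c))"

lemma class_coeff_superset:
  assumes "finite K" "Poly_Mapping.keys f \<subseteq> K"
  shows "class_coeff C f = (\<Sum>c\<in>K. Poly_Mapping.lookup f c * of_bool (C c))"
  unfolding class_coeff_def by (rule sum.mono_neutral_left) (use assms in_keys_iff in fastforce)+

lemma class_coeff_add: "class_coeff C (f + g) = class_coeff C f + class_coeff C g"
proof -
  let ?K = "Poly_Mapping.keys f \<union> Poly_Mapping.keys g"
  have "Poly_Mapping.keys (f + g) \<subseteq> ?K" by (rule Poly_Mapping.keys_add)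
  then show ?thesis
    by (subst (1 2 3) class_coeff_superset[of ?K]) (auto simp: lookup_add distrib_right sum.distrib)
qed

lemma class_coeff_0: "class_coeff C 0 = 0"
  by (simp add: class_coeff_def)

lemma class_coeff_sum: "class_coeff C (sum f A) = (\<Sum>x\<in>A. class_coeff C (f x))"
  by (induction A rule: infinite_finite_induct) (auto simp: class_coeff_0 class_coeff_add)

lemma class_coeff_single: "class_coeff C (Poly_Mapping.single c v) = v * of_bool (C c)"
  by (subst class_coeff_superset[of "{c}"]) auto

lemma poly_mapping_sum_singles: "(\<Sum>c\<in>Poly_Mapping.keys f. Poly_Mapping.single c (Poly_Mapping.lookup f c)) = f"
  by (rule poly_mapping_eqI)
     (auto simp: lookup_sum lookup_single when_def in_keys_iff sum.delta)

lemma class_coeff_single_mult: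
  "class_coeff C (Poly_Mapping.single d v * f) = v * class_coeff (\<lambda>c. C (d + c)) f"
proof -
  have "class_coeff C (Poly_Mapping.single d v * f)
      = class_coeff C (\<Sum>c\<in>Poly_Mapping.keys f. Poly_Mapping.single (d + c) (v * Poly_Mapping.lookup f c))"
    by (subst (1) poly_mapping_sum_singles[of f, symmetric]) (simp add: sum_distrib_left mult_single)
  then show ?thesis
    by (simp only: class_coeff_sum class_coeff_single class_coeff_def[of _ f] sum_distrib_left mult.assoc)
qed

lemma single_power: "Poly_Mapping.single c (1::int) ^ k = Poly_Mapping.single (\<Sum>i<k. c) 1"
  for c :: "nat \<Rightarrow>\<^sub>0 nat"
  by (induction k) (auto simp: mult_single algebra_simps simp del: sum_constant)

lemma single_prod: "(\<Prod>i\<in>A. Poly_Mapping.single (c i) (1::int)) = Poly_Mapping.single (\<Sum>i\<in>A. c i) 1"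
  for c :: "_ \<Rightarrow> (nat \<Rightarrow>\<^sub>0 nat)"
  by (induction A rule: infinite_finite_induct) (auto simp: mult_single)

text \<open>Olson's group algebra argument, with the variable belonging to \<open>C\<^bsub>p^a\<^esub>\<close> given weight \<open>1/p^a\<close>.\<close>

theorem signed_subsum_count_dvd:
  fixes x :: "'i \<Rightarrow> nat \<Rightarrow> nat"
  assumes p: "prime p" and J: "finite J" and I: "finite I"
    and a: "\<And>j. j \<in> J \<Longrightarrow> a j \<le> e" and m: "\<And>i. i \<in> I \<Longrightarrow> m i \<le> e"
    and dv: "\<And>i j. i \<in> I \<Longrightarrow> j \<in> J \<Longrightarrow> p ^ a j dvd p ^ m i * x i j"
    and big: "(\<Sum>j\<in>J. p ^ e - p ^ (e - a j)) < (\<Sum>i\<in>I. p ^ (e - m i))"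
  shows "int p dvd (\<Sum>T | T \<subseteq> I \<and> (\<forall>j\<in>J. [(\<Sum>i\<in>T. x i j) = h j] (mod p ^ a j)). (-1) ^ card T)"
proof -
  define C where "C = (\<lambda>h (c :: nat \<Rightarrow>\<^sub>0 nat). \<forall>j\<in>J. [Poly_Mapping.lookup c j = h j] (mod p ^ a j))"
  \<comment> \<open>\<open>A\<close> consists of the elements whose image in the group ring of the
    p-group is zero modulo \<open>p\<close>.\<close>
  define A where "A = {f. \<forall>h. int p dvd class_coeff (C h) f}"
  define X where "X = (\<lambda>j::nat. Poly_Mapping.single (Poly_Mapping.single j (1::nat)) (1::int))"
  have a_add: "f + g \<in> A" if "f \<in> A" "g \<in> A" for f g
    using that by (simp add: A_def class_coeff_add)
  \<comment> \<open>The factor \<open>p ^ a j - 1\<close> is the natural-number stand-in for -1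
    modulo \<open>p ^ a j\<close>.\<close>
  have shift: "C h (d + c) \<longleftrightarrow> C (\<lambda>j. h j + (p ^ a j - 1) * Poly_Mapping.lookup d j) c" for h d c
  proof -
    have "[Poly_Mapping.lookup d j + Poly_Mapping.lookup c j = h j] (mod p ^ a j)
       \<longleftrightarrow> [Poly_Mapping.lookup c j = h j + (p ^ a j - 1) * Poly_Mapping.lookup d j] (mod p ^ a j)" for j
    proof -
      have "[Poly_Mapping.lookup d j + Poly_Mapping.lookup c j = h j] (mod p ^ a j)
        \<longleftrightarrow> [(Poly_Mapping.lookup d j + Poly_Mapping.lookup c j) + (p ^ a j - 1) * Poly_Mapping.lookup d j = h j + (p ^ a j - 1) * Poly_Mapping.lookup d j] (mod p ^ a j)"
        by (simp add: cong_add_rcancel_nat)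
      also have "(Poly_Mapping.lookup d j + Poly_Mapping.lookup c j) + (p ^ a j - 1) * Poly_Mapping.lookup d j = Poly_Mapping.lookup c j + p ^ a j * Poly_Mapping.lookup d j"
        using prime_gt_0_nat[OF p] by (cases "p ^ a j") auto
      also have "[Poly_Mapping.lookup c j + p ^ a j * Poly_Mapping.lookup d j = h j + (p ^ a j - 1) * Poly_Mapping.lookup d j] (mod p ^ a j)
        \<longleftrightarrow> [Poly_Mapping.lookup c j = h j + (p ^ a j - 1) * Poly_Mapping.lookup d j] (mod p ^ a j)"
        by (simp add: cong_def)
      finally show ?thesis .
    qed
    then show ?thesis by (simp add: C_def lookup_add)
  qed
  have a_single: "Poly_Mapping.single d v * f \<in> A" if "f \<in> A" for f d v
    using that by (auto simp: A_def class_coeff_single_mult shift)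
  have a_mult: "g * f \<in> A" if "f \<in> A" for f g
  proof -
    have "(\<Sum>c\<in>K. Poly_Mapping.single c (Poly_Mapping.lookup g c)) * f \<in> A" for K
      by (induction K rule: infinite_finite_induct)
         (auto simp: distrib_right that intro!: a_add a_single, auto simp: A_def class_coeff_0)
    then show ?thesis using poly_mapping_sum_singles[of g] by metis
  qed
  have sP: "of_nat p = Poly_Mapping.single (0 :: nat \<Rightarrow>\<^sub>0 nat) (int p)"
    by (rule single_of_nat[symmetric])
  have "class_coeff (C h) (of_nat p) = int p * of_bool (C h 0)" for h
    by (simp only: sP class_coeff_single)
  then have P: "of_nat p \<in> A" by (simp add: A_def)
  have Xpow: "X j ^ k = Poly_Mapping.single (Poly_Mapping.single j k) 1" for j k
  proof -
    have "(\<Sum>i<k. Poly_Mapping.single j (1::nat)) = Poly_Mapping.single j k"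
      by (rule poly_mapping_eqI) (simp add: lookup_sum lookup_single when_def del: sum_constant, simp)
    then show ?thesis by (simp only: X_def single_power)
  qed
  have X: "1 - X j ^ (p ^ a j) \<in> A" if "j \<in> J" for j
  proof -
    have "class_coeff (C h) 1 = class_coeff (C h) (X j ^ (p ^ a j) + (1 - X j ^ (p ^ a j)))" for h
      by simp
    then have "class_coeff (C h) (1 - X j ^ (p ^ a j)) = class_coeff (C h) 1 - class_coeff (C h) (X j ^ (p ^ a j))" for h
      unfolding class_coeff_add by simp
    moreover have "C h (Poly_Mapping.single j (p ^ a j)) \<longleftrightarrow> C h 0" for h
      unfolding C_def by (rule ball_cong) (auto simp: lookup_single when_def cong_def)
    moreover have "class_coeff (C h) 1 = of_bool (C h 0)" for h
      using class_coeff_single[of "C h" 0 1] by simp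
    ultimately have "class_coeff (C h) (1 - X j ^ (p ^ a j)) = 0" for h
      by (simp add: Xpow class_coeff_single)
    then show ?thesis by (simp add: A_def)
  qed
  have "(\<Prod>i\<in>I. 1 - (\<Prod>j\<in>J. X j ^ x i j)) \<in> A"
    by (rule prod_one_minus_in_ideal[OF p J I a m dv big a_add a_mult P X])
  then have d: "int p dvd class_coeff (C h) (\<Prod>i\<in>I. 1 - (\<Prod>j\<in>J. X j ^ x i j))"
    by (simp add: A_def)
  define v where "v = (\<lambda>i. \<Sum>j\<in>J. Poly_Mapping.single j (x i j))"
  have lv: "Poly_Mapping.lookup (\<Sum>i\<in>T. v i) j = (\<Sum>i\<in>T. x i j)" if "j \<in> J" for T j
    using that J by (simp add: v_def lookup_sum lookup_single when_def sum.delta)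
  \<comment> \<open>Expansion over subsets: \<open>T\<close> contributes its sign at the exponent
    vector of its sum, so the class coefficient is the signed count.\<close>
  have "(\<Prod>i\<in>I. 1 - (\<Prod>j\<in>J. X j ^ x i j)) = (\<Prod>i\<in>I. - Poly_Mapping.single (v i) 1 + 1)"
    by (simp add: Xpow single_prod v_def)
  also have "\<dots> = (\<Sum>T\<in>Pow I. (\<Prod>i\<in>T. - Poly_Mapping.single (v i) 1))"
    using I by (subst prod_add) auto
  also have "\<dots> = (\<Sum>T\<in>Pow I. Poly_Mapping.single (\<Sum>i\<in>T. v i) ((-1) ^ card T))"
  proof (rule sum.cong[OF refl])
    fix T assume "T \<in> Pow I"
    have "(\<Prod>i\<in>T. - Poly_Mapping.single (v i) (1::int)) = (-1) ^ card T * Poly_Mapping.single (\<Sum>i\<in>T. v i) 1"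
      by (simp add: prod_uminus single_prod)
    also have "(-1 :: (nat \<Rightarrow>\<^sub>0 nat) \<Rightarrow>\<^sub>0 int) ^ k = Poly_Mapping.single 0 ((-1) ^ k)" for k
      by (induction k) (simp_all add: mult_single single_uminus)
    finally show "(\<Prod>i\<in>T. - Poly_Mapping.single (v i) 1) = Poly_Mapping.single (\<Sum>i\<in>T. v i) ((-1::int) ^ card T)"
      by (simp add: mult_single)
  qed
  finally have "class_coeff (C h) (\<Prod>i\<in>I. 1 - (\<Prod>j\<in>J. X j ^ x i j))
      = (\<Sum>T\<in>Pow I. (-1) ^ card T * of_bool (C h (\<Sum>i\<in>T. v i)))"
    by (simp add: class_coeff_sum class_coeff_single)
  also have "\<dots> = (\<Sum>T\<in>Pow I. if \<forall>j\<in>J. [(\<Sum>i\<in>T. x i j) = h j] (mod p ^ a j) then (-1) ^ card T else 0)"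
    by (rule sum.cong[OF refl]) (auto simp: C_def lv)
  also have "\<dots> = (\<Sum>T | T \<subseteq> I \<and> (\<forall>j\<in>J. [(\<Sum>i\<in>T. x i j) = h j] (mod p ^ a j)). (-1) ^ card T)"
    using I by (subst sum.inter_filter[symmetric]) (auto intro!: sum.cong)
  finally show ?thesis using d by simp
qed

section \<open>Characters of a cyclic complement\<close>

lemma cis_power_eq_1_iff:
  assumes "n > 0"
  shows "cis (2 * pi / real n) ^ s = 1 \<longleftrightarrow> n dvd s"
proof -
  let ?z = "cis (2 * pi / real n)"
  have zn: "?z ^ n = 1" using assms by (simp add: DeMoivre)
  have "?z ^ s = ?z ^ (n * (s div n) + s mod n)" by simp
  also have "\<dots> = ?z ^ (s mod n)" unfolding power_add power_mult zn by simp
  finally have "?z ^ s = ?z ^ (s mod n)" .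
  also have "\<dots> = cis (2 * pi * real (s mod n) / real n)"
    by (simp add: DeMoivre mult_ac)
  finally have eq: "?z ^ s = cis (2 * pi * real (s mod n) / real n)" .
  have inj: "inj_on (\<lambda>k. cis (2 * pi * real k / real n)) {..<n}"
    using bij_betw_roots_unity[OF assms] by (simp add: bij_betw_def)
  have "?z ^ s = 1 \<longleftrightarrow> cis (2 * pi * real (s mod n) / real n) = cis (2 * pi * real 0 / real n)"
    unfolding eq by simp
  also have "\<dots> \<longleftrightarrow> s mod n = 0"
    using inj_on_eq_iff[OF inj, of "s mod n" 0] assms by simp
  finally show ?thesis by (simp add: dvd_eq_mod_eq_0)
qed

lemma sum_roots_unity:
  assumes "n > 0"
  shows "(\<Sum>c<n. cis (2 * pi / real n) ^ (c * s)) = (if n dvd s then of_nat n else 0)"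
proof -
  let ?x = "cis (2 * pi / real n) ^ s"
  have eq: "(\<Sum>c<n. cis (2 * pi / real n) ^ (c * s)) = (\<Sum>c<n. ?x ^ c)"
    by (simp add: power_mult[symmetric] mult.commute)
  show ?thesis
  proof (cases "n dvd s")
    case True
    then have "?x = 1" using cis_power_eq_1_iff assms by blast
    then show ?thesis using True eq by simp
  next
    case False
    then have "?x \<noteq> 1" using cis_power_eq_1_iff assms by blast
    moreover have "?x ^ n = 1"
      using cis_power_eq_1_iff[OF assms, of "s * n"] by (simp add: power_mult)
    ultimately show ?thesis using False eq geometric_sum[of ?x n] by simp
  qed
qed

text \<open>Multiplication by the combination acts on the vector of powers of \<open>z\<close>
  through a circulant integer matrix. The combination is thus an eigenvalue of that matrix and an
  algebraic integer, and a rational algebraic integer is an integer.\<close>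

lemma rational_combination_roots_unity_int:
  fixes z :: complex
  assumes n: "n > 0" and zn: "z ^ n = 1" and rat: "(\<Sum>l<n. of_int (f l) * z ^ l) \<in> \<rat>"
  shows "(\<Sum>l<n. of_int (f l) * z ^ l) \<in> \<int>"
proof -
  define x where "x = (\<Sum>l<n. of_int (f l) * z ^ l)"
  define A where "A = mat n n (\<lambda>(i, j). f ((j + (n - i)) mod n))"
  have A: "A \<in> carrier_mat n n" by (simp add: A_def)
  let ?A = "map_mat complex_of_int A"
  define v where "v = vec n (\<lambda>j. z ^ j)"
  have zmod: "z ^ (k mod n) = z ^ k" for k
  proof -
    have "z ^ k = z ^ (n * (k div n) + k mod n)" by simp
    also have "\<dots> = z ^ (k mod n)" unfolding power_add power_mult zn by simp
    finally show ?thesis by simp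
  qed
  have "?A *\<^sub>v v = x \<cdot>\<^sub>v v"
  proof (rule eq_vecI)
    fix i assume "i < dim_vec (x \<cdot>\<^sub>v v)"
    then have i: "i < n" by (simp add: v_def)
    have "(?A *\<^sub>v v) $ i = (\<Sum>j<n. of_int (f ((j + (n - i)) mod n)) * z ^ j)"
      using i by (simp add: A_def v_def scalar_prod_def atLeast0LessThan)
    also have "\<dots> = (\<Sum>l<n. of_int (f l) * z ^ ((l + i) mod n))"
    proof (rule sum.reindex_bij_witness[where i = "\<lambda>l. (l + i) mod n" and j = "\<lambda>j. (j + (n - i)) mod n"])
      fix j assume "j \<in> {..<n}"
      then have j: "j < n" by simp
      have "((j + (n - i)) mod n + i) mod n = (j + (n - i) + i) mod n" by (simp add: mod_simps)
      also have "\<dots> = j" using i j by simp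
      finally show *: "((j + (n - i)) mod n + i) mod n = j" .
      show "(j + (n - i)) mod n \<in> {..<n}" using n by simp
      show "of_int (f ((j + (n - i)) mod n)) * z ^ (((j + (n - i)) mod n + i) mod n) =
         of_int (f ((j + (n - i)) mod n)) * z ^ j" unfolding * ..
    next
      fix l assume "l \<in> {..<n}"
      then have l: "l < n" by simp
      have "((l + i) mod n + (n - i)) mod n = (l + i + (n - i)) mod n" by (simp add: mod_simps)
      also have "\<dots> = l" using i l by simp
      finally show "((l + i) mod n + (n - i)) mod n = l" .
      show "(l + i) mod n \<in> {..<n}" using n by simp
    qed
    also have "\<dots> = x * z ^ i"
      by (simp add: x_def zmod power_add sum_distrib_right mult.assoc)
    finally show "(?A *\<^sub>v v) $ i = (x \<cdot>\<^sub>v v) $ i" using i by (simp add: v_def)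
  qed (simp add: A_def v_def)
  moreover have "v \<noteq> 0\<^sub>v n"
  proof
    assume "v = 0\<^sub>v n"
    then have "v $ 0 = 0\<^sub>v n $ 0" by simp
    then show False using n by (simp add: v_def)
  qed
  moreover have "v \<in> carrier_vec n" by (simp add: v_def)
  ultimately have "eigenvalue ?A x"
    unfolding eigenvalue_def eigenvector_def using A by auto
  then have "poly (char_poly ?A) x = 0"
    using eigenvalue_root_char_poly[of ?A n] A by simp
  moreover have "monic (char_poly ?A)"
    using degree_monic_char_poly[of ?A n] A by simp
  moreover have "Polynomial.coeff (char_poly ?A) i \<in> \<int>" for i
    using of_int_hom.char_poly_hom[OF A, where 'a = complex] by simp
  ultimately have "algebraic_int x"
    by (intro algebraic_int.intros) auto
  then show ?thesis using rational_algebraic_int_is_int rat unfolding x_def by blast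
qed

text \<open>The ideal generated by \<open>p\<close> in Z[z] meets Z in the multiples of
  \<open>p\<close> only. This carries divisibility from character values back to integers.\<close>

lemma prime_dvd_of_roots_unity_combination:
  fixes z :: complex
  assumes n: "n > 0" and zn: "z ^ n = 1" and p: "prime p"
    and eq: "of_nat m = of_nat p * (\<Sum>l<n. of_int (f l) * z ^ l)"
  shows "p dvd m"
proof -
  have p0: "(of_nat p :: complex) \<noteq> 0" using p prime_gt_0_nat[OF p] by simp
  have "(\<Sum>l<n. of_int (f l) * z ^ l) = of_nat m / of_nat p" using eq p0 by simp
  moreover have "of_nat m / of_nat p \<in> (\<rat> :: complex set)" by simp
  ultimately have "(\<Sum>l<n. of_int (f l) * z ^ l) \<in> \<int>"
    using rational_combination_roots_unity_int[OF n zn] by metis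
  then obtain k where "(\<Sum>l<n. of_int (f l) * z ^ l) = of_int k" by (auto elim: Ints_cases)
  then have "(of_int (int m) :: complex) = of_int (int p * k)" using eq by simp
  then have "int m = int p * k" by (simp only: of_int_eq_iff)
  then show ?thesis by (metis dvd_triv_left int_dvd_int_iff)
qed

text \<open>
  The characters of \<open>C\<^sub>n\<close> are indexed by \<open>c < n\<close>. If \<open>S\<close> were zero-sum free, the coefficient at
  \<open>0\<close> of the product of the factors \<open>\<zeta>^(t\<^sub>i y\<^sub>i) - X^(g\<^sub>i)\<close> would be a root of unity;
  but its image under the character \<open>c\<close> vanishes modulo \<open>p\<close> as soon as the terms with
  \<open>c y\<^sub>i = t\<^sub>i y\<^sub>i\<close> are too heavy for the \<open>p\<close>-part.
\<close>

theorem zero_subsum_of_character_cover: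
  fixes x :: "'i \<Rightarrow> nat \<Rightarrow> nat"
  assumes p: "prime p" and J: "finite J" and I: "finite I"
    and a: "\<And>j. j \<in> J \<Longrightarrow> a j \<le> e" and m: "\<And>i. i \<in> I \<Longrightarrow> m i \<le> e"
    and dv: "\<And>i j. i \<in> I \<Longrightarrow> j \<in> J \<Longrightarrow> p ^ a j dvd p ^ m i * x i j"
    and n: "n > 0" and pn: "\<not> p dvd n"
    and big: "\<And>c. c < n \<Longrightarrow> (\<Sum>j\<in>J. p ^ e - p ^ (e - a j))
        < (\<Sum>i | i \<in> I \<and> [c * y i = t i * y i] (mod n). p ^ (e - m i))"
  shows "\<exists>T. T \<subseteq> I \<and> T \<noteq> {} \<and> (\<forall>j\<in>J. p ^ a j dvd (\<Sum>i\<in>T. x i j)) \<and> n dvd (\<Sum>i\<in>T. y i)"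
proof (rule ccontr)
  assume "\<not> ?thesis"
  then have free: "T = {}" if "T \<subseteq> I" "\<forall>j\<in>J. p ^ a j dvd (\<Sum>i\<in>T. x i j)" "n dvd (\<Sum>i\<in>T. y i)" for T
    using that by blast
  define z where "z = cis (2 * pi / real n)"
  have zn: "z ^ n = 1" using cis_power_eq_1_iff[OF n, of n] by (simp add: z_def)
  have zcong: "z ^ k = z ^ l" if "[k = l] (mod n)" for k l
  proof -
    have "z ^ k = z ^ (k mod n)" for k
    proof -
      have "z ^ k = z ^ (n * (k div n) + k mod n)" by simp
      also have "\<dots> = z ^ (k mod n)" unfolding power_add power_mult zn by simp
      finally show ?thesis .
    qed
    then show ?thesis using that unfolding cong_def by metis
  qed
  \<comment> \<open>\<open>R\<close> is pZ[z], where the image under every single character will be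
    shown to lie.\<close>
  define R where "R = {s. \<exists>f. s = of_nat p * (\<Sum>l<n. of_int (f l) * z ^ l)}"
  have R_add: "s + s' \<in> R" if "s \<in> R" "s' \<in> R" for s s'
  proof -
    from that obtain f g where "s = of_nat p * (\<Sum>l<n. of_int (f l) * z ^ l)"
      "s' = of_nat p * (\<Sum>l<n. of_int (g l) * z ^ l)" unfolding R_def by blast
    then have "s + s' = of_nat p * (\<Sum>l<n. of_int (f l + g l) * z ^ l)"
      by (simp add: algebra_simps sum.distrib)
    then show ?thesis unfolding R_def by (auto intro!: exI[of _ "\<lambda>l. f l + g l"])
  qed
  have R_0: "0 \<in> R" unfolding R_def by (auto intro!: exI[of _ "\<lambda>_. 0"])

  have R_sum_nat: "(\<Sum>i\<in>B. g i) \<in> R" if "\<And>i. i \<in> B \<Longrightarrow> g i \<in> R" for B :: "nat set" and g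
    using that by (induction B rule: infinite_finite_induct) (auto intro: R_0 R_add)
  have R_sum_sets: "(\<Sum>i\<in>B. g i) \<in> R" if "\<And>i. i \<in> B \<Longrightarrow> g i \<in> R" for B :: "'i set set" and g
    using that by (induction B rule: infinite_finite_induct) (auto intro: R_0 R_add)
  have R_monom: "of_int k * z ^ l \<in> R" if "int p dvd k" for k l
  proof -
    from that obtain k' where k: "k = int p * k'" by blast
    have "(\<Sum>i<n. of_int (if i = l mod n then k' else 0) * z ^ i) = of_int k' * z ^ (l mod n)"
      using n by (subst sum.remove[of _ "l mod n"]) auto
    also have "z ^ (l mod n) = z ^ l" by (rule zcong) (simp add: cong_def)
    finally have "of_int k * z ^ l = of_nat p * (\<Sum>i<n. of_int (if i = l mod n then k' else 0) * z ^ i)"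
      by (simp add: k)
    then show ?thesis unfolding R_def by (auto intro!: exI[of _ "\<lambda>i. if i = l mod n then k' else 0"])
  qed
  define H0 where "H0 = (\<lambda>T. \<forall>j\<in>J. p ^ a j dvd (\<Sum>i\<in>T. x i j))"
  define E where "E = (\<Sum>i\<in>I. t i * y i)"
  \<comment> \<open>Contribution of the subset \<open>T\<close>, under the character
    \<open>c\<close>, to the coefficient at the zero of the p-part. \<open>H0\<close> selects the
    subsets whose p-part sums to zero; the factors outside \<open>T\<close> contribute their roots
    of unity.\<close>
  define tm where "tm = (\<lambda>c T. if H0 T then (-1) ^ card T * z ^ (c * (\<Sum>i\<in>T. y i) + (\<Sum>i\<in>I - T. t i * y i)) else (0::complex))"
  \<comment> \<open>Summing over the characters first: orthogonality keeps the subsets with zero sum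
    in both parts, and by \<open>free\<close> only the empty one remains.\<close>
  have "(\<Sum>c<n. \<Sum>T\<in>Pow I. tm c T) = (\<Sum>T\<in>Pow I. \<Sum>c<n. tm c T)"
    by (rule sum.swap)
  also have "\<dots> = (\<Sum>T\<in>Pow I. if T = {} then of_nat n * z ^ E else 0)"
  proof (rule sum.cong[OF refl])
    fix T assume "T \<in> Pow I"
    then have T: "T \<subseteq> I" by simp
    show "(\<Sum>c<n. tm c T) = (if T = {} then of_nat n * z ^ E else 0)"
    proof (cases "H0 T")
      case True
      then have "(\<Sum>c<n. tm c T) = (\<Sum>c<n. z ^ (c * (\<Sum>i\<in>T. y i))) * ((-1) ^ card T * z ^ (\<Sum>i\<in>I - T. t i * y i))"
        by (simp add: tm_def power_add sum_distrib_left sum_distrib_right mult_ac)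
      also have "\<dots> = (if n dvd (\<Sum>i\<in>T. y i) then of_nat n else 0) * ((-1) ^ card T * z ^ (\<Sum>i\<in>I - T. t i * y i))"
        using sum_roots_unity[OF n] by (simp add: z_def)
      also have "\<dots> = (if T = {} then of_nat n * z ^ E else 0)"
        using free[OF T] True by (auto simp: H0_def E_def)
      finally show ?thesis .
    next
      case False
      then have "T \<noteq> {}" by (auto simp: H0_def)
      with False show ?thesis by (simp add: tm_def)
    qed
  qed
  also have "\<dots> = of_nat n * z ^ E" using I by (simp add: sum.delta')
  finally have S1: "(\<Sum>c<n. \<Sum>T\<in>Pow I. tm c T) = of_nat n * z ^ E" .
  have "(\<Sum>T\<in>Pow I. tm c T) \<in> R" if c: "c < n" for c
  proof -
    \<comment> \<open>For \<open>i\<close> in \<open>K\<close> the character turns the factor into a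
      root of unity times 1 minus a monomial of the p-part. Hence the choice within \<open>K\<close>
      no longer affects the power of \<open>z\<close>, and its signed count is divisible by
      \<open>p\<close>.\<close>
    define K where "K = {i \<in> I. [c * y i = t i * y i] (mod n)}"
    have K: "K \<subseteq> I" "finite K" using I by (auto simp: K_def)
    define ex where "ex = (\<lambda>T. c * (\<Sum>i\<in>T. y i) + (\<Sum>i\<in>(I - K) - T. t i * y i) + (\<Sum>i\<in>K. t i * y i))"
    have z_split: "z ^ (c * (\<Sum>i\<in>T1 \<union> T2. y i) + (\<Sum>i\<in>I - (T1 \<union> T2). t i * y i)) = z ^ ex T2"
      if T: "T1 \<subseteq> K" "T2 \<subseteq> I - K" for T1 T2
    proof (rule zcong)
      have fin: "finite T1" "finite T2" using T I K finite_subset by blast+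
      have e1: "(\<Sum>i\<in>T1 \<union> T2. y i) = (\<Sum>i\<in>T1. y i) + (\<Sum>i\<in>T2. y i)"
        using T fin by (intro sum.union_disjoint) auto
      have "I - (T1 \<union> T2) = (K - T1) \<union> ((I - K) - T2)" using T K by auto
      then have e2: "(\<Sum>i\<in>I - (T1 \<union> T2). t i * y i) = (\<Sum>i\<in>K - T1. t i * y i) + (\<Sum>i\<in>(I - K) - T2. t i * y i)"
        using I K by (simp only:) (intro sum.union_disjoint, auto)
      have e3: "(\<Sum>i\<in>K. t i * y i) = (\<Sum>i\<in>K - T1. t i * y i) + (\<Sum>i\<in>T1. t i * y i)"
        using T K by (metis sum.subset_diff)
      have "[(\<Sum>i\<in>T1. c * y i) = (\<Sum>i\<in>T1. t i * y i)] (mod n)"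
        by (rule cong_sum) (use T K_def in auto)
      then have "[(\<Sum>i\<in>T1. c * y i) + (c * (\<Sum>i\<in>T2. y i) + (\<Sum>i\<in>K - T1. t i * y i) + (\<Sum>i\<in>(I - K) - T2. t i * y i))
          = (\<Sum>i\<in>T1. t i * y i) + (c * (\<Sum>i\<in>T2. y i) + (\<Sum>i\<in>K - T1. t i * y i) + (\<Sum>i\<in>(I - K) - T2. t i * y i))] (mod n)"
        by (rule cong_add) simp
      then show "[c * (\<Sum>i\<in>T1 \<union> T2. y i) + (\<Sum>i\<in>I - (T1 \<union> T2). t i * y i) = ex T2] (mod n)"
        unfolding e1 e2 ex_def e3 by (simp add: algebra_simps sum_distrib_left)
    qed
    have "(\<Sum>T\<in>Pow I. tm c T) = (\<Sum>(T2, T1)\<in>Pow (I - K) \<times> Pow K. tm c (T1 \<union> T2))"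
      by (rule sum.reindex_bij_witness[where i = "\<lambda>(T2, T1). T1 \<union> T2" and j = "\<lambda>T. (T - K, T \<inter> K)"])
         (use K in \<open>auto simp: Int_Un_distrib Un_Diff intro!: arg_cong[where f = "tm c"]\<close>)
    also have "\<dots> = (\<Sum>T2\<in>Pow (I - K). \<Sum>T1\<in>Pow K. tm c (T1 \<union> T2))"
      by (rule sum.cartesian_product[symmetric])
    also have "\<dots> \<in> R"
    proof (rule R_sum_sets)
      fix T2 assume "T2 \<in> Pow (I - K)"
      then have T2: "T2 \<subseteq> I - K" by simp
      define h where "h = (\<lambda>j. (p ^ a j - 1) * (\<Sum>i\<in>T2. x i j))"
      have H0iff: "H0 (T1 \<union> T2) \<longleftrightarrow> (\<forall>j\<in>J. [(\<Sum>i\<in>T1. x i j) = h j] (mod p ^ a j))" if T1: "T1 \<subseteq> K" for T1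
      proof -
        have fin: "finite T1" "finite T2" using T1 T2 I K finite_subset by blast+
        have e1: "(\<Sum>i\<in>T1 \<union> T2. x i j) = (\<Sum>i\<in>T1. x i j) + (\<Sum>i\<in>T2. x i j)" for j
          using T1 T2 fin by (intro sum.union_disjoint) auto
        have "p ^ a j dvd u + w \<longleftrightarrow> [u = (p ^ a j - 1) * w] (mod p ^ a j)" for u w j
        proof -
          have "[u = (p ^ a j - 1) * w] (mod p ^ a j) \<longleftrightarrow> [u + w = (p ^ a j - 1) * w + w] (mod p ^ a j)"
            by (simp add: cong_add_rcancel_nat)
          also have "(p ^ a j - 1) * w + w = p ^ a j * w"
            using prime_gt_0_nat[OF p] by (cases "p ^ a j") auto
          finally show ?thesis by (simp add: cong_def dvd_eq_mod_eq_0)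
        qed
        then show ?thesis by (simp add: H0_def e1 h_def)
      qed
      have "(\<Sum>T1\<in>Pow K. tm c (T1 \<union> T2)) = (\<Sum>T1\<in>Pow K. (if \<forall>j\<in>J. [(\<Sum>i\<in>T1. x i j) = h j] (mod p ^ a j) then (-1) ^ card T1 else 0)) * ((-1) ^ card T2 * z ^ ex T2)"
        unfolding sum_distrib_right
      proof (rule sum.cong[OF refl])
        fix T1 assume "T1 \<in> Pow K"
        then have T1: "T1 \<subseteq> K" by simp
        have fin: "finite T1" "finite T2" using T1 T2 I K finite_subset by blast+
        have "card (T1 \<union> T2) = card T1 + card T2" using T1 T2 fin by (intro card_Un_disjoint) auto
        then show "tm c (T1 \<union> T2) = (if \<forall>j\<in>J. [(\<Sum>i\<in>T1. x i j) = h j] (mod p ^ a j) then (-1) ^ card T1 else 0) * ((-1) ^ card T2 * z ^ ex T2)"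
          unfolding tm_def H0iff[OF T1] z_split[OF T1 T2] by (simp add: power_add)
      qed
      also have "(\<Sum>T1\<in>Pow K. (if \<forall>j\<in>J. [(\<Sum>i\<in>T1. x i j) = h j] (mod p ^ a j) then (-1) ^ card T1 else 0))
        = (of_int (\<Sum>T | T \<subseteq> K \<and> (\<forall>j\<in>J. [(\<Sum>i\<in>T. x i j) = h j] (mod p ^ a j)). (-1) ^ card T) :: complex)"
        using K(2) by (subst sum.inter_filter[symmetric]) (auto intro!: sum.cong)
      finally have "(\<Sum>T1\<in>Pow K. tm c (T1 \<union> T2))
        = of_int ((-1) ^ card T2 * (\<Sum>T | T \<subseteq> K \<and> (\<forall>j\<in>J. [(\<Sum>i\<in>T. x i j) = h j] (mod p ^ a j)). (-1) ^ card T)) * z ^ ex T2"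
        by (simp add: mult_ac)
      moreover have "int p dvd (\<Sum>T | T \<subseteq> K \<and> (\<forall>j\<in>J. [(\<Sum>i\<in>T. x i j) = h j] (mod p ^ a j)). (-1) ^ card T)"
        by (rule signed_subsum_count_dvd[OF p J K(2) a]) (use K m dv big[OF c] K_def in auto)
      ultimately show "(\<Sum>T1\<in>Pow K. tm c (T1 \<union> T2)) \<in> R" by (simp only: R_monom dvd_mult)
    qed
    finally show ?thesis .
  qed
  then have "of_nat n * z ^ E \<in> R" unfolding S1[symmetric] by (intro R_sum_nat) auto
  then obtain f where f: "of_nat n * z ^ E = of_nat p * (\<Sum>l<n. of_int (f l) * z ^ l)"
    unfolding R_def by blast
  \<comment> \<open>\<open>z ^ (E * (n - 1))\<close> is the inverse of \<open>z ^ E\<close>;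
    multiplying by it puts \<open>n\<close> itself into pZ[z].\<close>
  have "z ^ E * z ^ (E * (n - 1)) = z ^ (n * E)"
    using n by (cases n) (auto simp: mult.commute simp flip: power_add)
  then have zE: "z ^ E * z ^ (E * (n - 1)) = 1" by (simp add: power_mult zn)
  have "of_nat n = of_nat n * z ^ E * z ^ (E * (n - 1))" using zE by (simp add: mult.assoc)
  also have "\<dots> = (\<Sum>l<n. of_int (int p * f l) * z ^ (l + E * (n - 1)))"
    unfolding f by (simp add: sum_distrib_left sum_distrib_right power_add mult_ac)
  also have "\<dots> \<in> R" by (intro R_sum_nat R_monom) simp
  finally obtain g where "of_nat n = of_nat p * (\<Sum>l<n. of_int (g l) * z ^ l)"
    unfolding R_def by blast
  then have "p dvd n" by (rule prime_dvd_of_roots_unity_combination[OF n zn p])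
  with pn show False by simp
qed

section \<open>Coverings by residue classes\<close>

definition cover_height :: "('i \<Rightarrow> nat) \<Rightarrow> ('i \<Rightarrow> nat) \<Rightarrow> ('i \<Rightarrow> nat) \<Rightarrow> 'i set \<Rightarrow> nat \<Rightarrow> nat" where
  "cover_height w d t I c = (\<Sum>i\<in>I. if [c = t i] (mod d i) then w i else 0)"

lemma cover_height_cong:
  assumes "\<And>i. i \<in> I \<Longrightarrow> t i = t' i"
  shows "cover_height w d t I c = cover_height w d t' I c"
  unfolding cover_height_def using assms by (auto intro!: sum.cong)

lemma cover_height_insert:
  assumes "finite I" "i \<notin> I"
  shows "cover_height w d t (insert i I) c = cover_height w d t I c + (if [c = t i] (mod d i) then w i else 0)"
  unfolding cover_height_def using assms by simp

lemma cover_height_mono: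
  assumes "finite I" "K \<subseteq> I"
  shows "cover_height w d t K c \<le> cover_height w d t I c"
  unfolding cover_height_def by (rule sum_mono2) (use assms in auto)

lemma cover_height_periodic:
  assumes "\<And>i. i \<in> I \<Longrightarrow> d i dvd D" "[c = c'] (mod D)"
  shows "cover_height w d t I c = cover_height w d t I c'"
proof -
  have "[c = t i] (mod d i) \<longleftrightarrow> [c' = t i] (mod d i)" if "i \<in> I" for i
    using cong_dvd_modulus_nat[OF assms(2) assms(1)[OF that]] by (meson cong_sym cong_trans)
  then show ?thesis unfolding cover_height_def by (auto intro!: sum.cong)
qed

lemma card_residue_class:
  assumes "d dvd n" "n > 0"
  shows "card {c. c < n \<and> [c = t] (mod d)} = (n div d :: nat)"
proof -
  from assms obtain k where k: "n = d * k" by blast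
  with assms have d: "d > 0" by auto
  have "bij_betw (\<lambda>l. t mod d + d * l) {..<k} {c. c < n \<and> [c = t] (mod d)}"
  proof (rule bij_betw_byWitness[where f' = "\<lambda>c. c div d"])
    show "\<forall>l\<in>{..<k}. (t mod d + d * l) div d = l" using d by simp
    show "\<forall>c\<in>{c. c < n \<and> [c = t] (mod d)}. t mod d + d * (c div d) = c"
      by (auto simp: cong_def) (metis mod_mult_div_eq)
    show "(\<lambda>l. t mod d + d * l) ` {..<k} \<subseteq> {c. c < n \<and> [c = t] (mod d)}"
    proof (clarsimp simp: cong_def)
      fix l assume "l < k"
      then have "Suc l \<le> k" by simp
      then have "d * Suc l \<le> n" unfolding k by (rule mult_le_mono2)
      moreover have "t mod d < d" using d by simp
      ultimately show "t mod d + d * l < n" by simp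
    qed
    show "(\<lambda>c. c div d) ` {c. c < n \<and> [c = t] (mod d)} \<subseteq> {..<k}"
      using d by (auto simp: k div_less_iff_less_mult mult.commute)
  qed
  then have "card {c. c < n \<and> [c = t] (mod d)} = card {..<k}"
    by (metis bij_betw_same_card)
  then show ?thesis using k d by simp
qed

text \<open>Double counting: the class of \<open>i\<close> holds \<open>n div d i\<close> residues
  wherever it is placed, so the area is independent of \<open>t\<close>.\<close>

lemma sum_cover_height:
  assumes "n > 0" "\<And>i. i \<in> I \<Longrightarrow> d i dvd n"
  shows "(\<Sum>c<n. cover_height w d t I c) = (\<Sum>i\<in>I. w i * (n div d i))"
proof -
  have "(\<Sum>c<n. cover_height w d t I c) = (\<Sum>i\<in>I. \<Sum>c<n. if [c = t i] (mod d i) then w i else 0)"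
    unfolding cover_height_def by (rule sum.swap)
  also have "\<dots> = (\<Sum>i\<in>I. w i * (n div d i))"
  proof (rule sum.cong[OF refl])
    fix i assume i: "i \<in> I"
    have "(\<Sum>c<n. if [c = t i] (mod d i) then w i else 0) = (\<Sum>c\<in>{c. c < n \<and> [c = t i] (mod d i)}. w i)"
      by (rule sum.mono_neutral_cong_right) auto
    then show "(\<Sum>c<n. if [c = t i] (mod d i) then w i else 0) = w i * (n div d i)"
      using card_residue_class[OF assms(2)[OF i] assms(1), of "t i"] by simp
  qed
  finally show ?thesis .
qed

text \<open>
  The terms are placed in order of increasing modulus \<open>q^(b\<^sub>i)\<close>, each on a residue class that is
  not yet covered; since the classes are nested, the height is constant on that class, so no
  height ever exceeds \<open>M + N - 1\<close>. The class of \<open>0\<close> is kept uncovered as long as possible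
  in order to separate \<open>i1\<close> from \<open>i2\<close>.
\<close>

lemma greedy_cover:
  fixes w b :: "'i \<Rightarrow> nat"
  assumes q: "q \<ge> 2" and "finite I"
    and w: "\<And>i. i \<in> I \<Longrightarrow> w i \<le> N"
    and i12: "i1 \<noteq> i2" "1 \<le> b i1" "b i1 \<le> b i2"
  shows "(\<exists>i\<in>I. \<exists>t. \<forall>c. M \<le> cover_height w (\<lambda>i. q ^ b i) t (I - {i}) c) \<or>
    (\<exists>t. (\<forall>c. cover_height w (\<lambda>i. q ^ b i) t I c < M + N) \<and>
       (i1 \<in> I \<longrightarrow> t i1 = q ^ (b i1 - 1)) \<and> (i2 \<in> I \<longrightarrow> t i2 = 0) \<and>
       (i2 \<notin> I \<longrightarrow> cover_height w (\<lambda>i. q ^ b i) t I 0 < M \<or>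
          (\<forall>c. M \<le> cover_height w (\<lambda>i. q ^ b i) t I c))) \<or> N = 0 \<or> M = 0"
    (is "?A I \<or> ?B I \<or> _")
  using assms(2) w
proof (induction "card I" arbitrary: I)
  case 0
  then have "I = {}" by simp
  then show ?case by (auto simp: cover_height_def intro!: exI[of _ "\<lambda>_. 0"])
next
  case (Suc k)
  let ?h = "cover_height w (\<lambda>i. q ^ b i)"
  \<comment> \<open>The term of largest key is the last to be placed, so moduli increase; the
    tie-break puts \<open>i1\<close> before all other terms of its modulus.\<close>
  define key where "key = (\<lambda>i. 2 * b i + (if i = i1 then 0 else 1))"
  have ne: "I \<noteq> {}" using Suc.hyps(2) by auto
  have fin: "finite I" by fact
  have "Max (key ` I) \<in> key ` I" using fin ne by (intro Max_in) auto
  then obtain i where i: "i \<in> I" and ki: "key i = Max (key ` I)" by auto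
  have imax: "key i' \<le> key i" if "i' \<in> I" for i'
    unfolding ki using fin that by (intro Max_ge) auto
  define I' where "I' = I - {i}"
  have I: "I = insert i I'" "i \<notin> I'" "finite I'" using i fin by (auto simp: I'_def)
  have bmax: "b i' \<le> b i" if "i' \<in> I'" for i'
    using imax[of i'] that by (auto simp: I'_def key_def split: if_splits)
  have IH: "?A I' \<or> ?B I' \<or> N = 0 \<or> M = 0"
    by (rule Suc.hyps(1)) (use Suc.hyps(2) Suc.prems i fin in \<open>auto simp: I'_def\<close>)
  show ?case
  proof (cases "N = 0 \<or> M = 0 \<or> ?A I'")
    case True
    then consider "N = 0 \<or> M = 0" | "?A I'" by blast
    then show ?thesis
    proof cases
      case 2
      then obtain i' t where i': "i' \<in> I'" and t: "\<And>c. M \<le> ?h t (I' - {i'}) c" by blast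
      have "M \<le> ?h t (I - {i'}) c" for c
        using t[of c] cover_height_mono[of "I - {i'}" "I' - {i'}" w "\<lambda>i. q ^ b i" t c] fin I'_def
        by (meson Diff_mono Diff_subset finite_Diff le_trans order_refl)
      then show ?thesis using i' I'_def by blast
    qed auto
  next
    case False
    with IH obtain t where tM: "\<And>c. ?h t I' c < M + N"
      and t1: "i1 \<in> I' \<Longrightarrow> t i1 = q ^ (b i1 - 1)" and t2: "i2 \<in> I' \<Longrightarrow> t i2 = 0"
      and t0: "i2 \<notin> I' \<Longrightarrow> ?h t I' 0 < M \<or> (\<forall>c. M \<le> ?h t I' c)" by blast
    show ?thesis
    proof (cases "\<forall>c. M \<le> ?h t I' c")
      case True
      then show ?thesis using i I'_def by blast
    next
      case not_covered: False
      have per: "?h t I' c = ?h t I' c'" if "[c = c'] (mod q ^ b i)" for c c'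
        by (rule cover_height_periodic[OF _ that]) (use bmax in \<open>auto intro: le_imp_power_dvd\<close>)
      have upd: "?h (t(i := v)) I c = ?h t I' c + (if [c = v] (mod q ^ b i) then w i else 0)" for v c
      proof -
        have "?h (t(i := v)) I' c = ?h t I' c"
          by (rule cover_height_cong) (use I in auto)
        then show ?thesis unfolding I(1) using I by (subst cover_height_insert) auto
      qed
      have wi: "w i \<le> N" using Suc.prems i by blast
      have bound: "?h (t(i := v)) I c < M + N" if v: "?h t I' v < M" for v c
      proof (cases "[c = v] (mod q ^ b i)")
        case True
        then have "?h t I' c < M" using v per by metis
        then show ?thesis using True wi unfolding upd by simp
      next
        case False
        then show ?thesis using tM[of c] unfolding upd by simp
      qed
      consider "i = i1" | "i = i2" | "i \<noteq> i1" "i \<noteq> i2" "i2 \<in> I'" | "i \<noteq> i1" "i \<noteq> i2" "i2 \<notin> I'"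
        by blast
      then show ?thesis
      proof cases
        case 1
        have lt: "b i' < b i1" if "i' \<in> I'" for i'
          using imax[of i'] that 1 by (auto simp: I'_def key_def split: if_splits)
        then have i2: "i2 \<notin> I" using i12 1 I by fastforce
        then have h0: "?h t I' 0 < M" using t0 not_covered I by auto
        \<comment> \<open>All moduli placed so far divide \<open>q ^ (b i1 - 1)\<close>, so this
          residue has the same height as 0, yet it lies in another class modulo
          \<open>q ^ b i1\<close>.\<close>
        have "?h t I' (q ^ (b i1 - 1)) = ?h t I' 0"
          by (rule cover_height_periodic[where D = "q ^ (b i1 - 1)"])
             (use lt in \<open>fastforce intro: le_imp_power_dvd simp: cong_def\<close>)+
        then have v: "?h t I' (q ^ (b i1 - 1)) < M" using h0 by simp
        have "\<not> [0 = q ^ (b i1 - 1)] (mod q ^ b i)"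
        proof -
          have "q ^ (b i1 - 1) < q ^ b i1" using q i12 by (intro power_strict_increasing) auto
          moreover have "0 < q ^ (b i1 - 1)" using q by simp
          ultimately show ?thesis using 1 by (auto simp: cong_def)
        qed
        then have *: "?h (t(i := q ^ (b i1 - 1))) I 0 < M" unfolding upd using h0 by simp
        define t' where "t' = t(i := q ^ (b i1 - 1))"
        have "t' i1 = q ^ (b i1 - 1)" using 1 by (simp add: t'_def)
        moreover have "\<And>c. ?h t' I c < M + N" "?h t' I 0 < M"
          using bound[OF v] * unfolding t'_def by auto
        ultimately have "?B I" using i2 by blast
        then show ?thesis by blast
      next
        case 2
        then have "?h t I' 0 < M" using t0 not_covered I by auto
        from bound[OF this] have "\<And>c. ?h (t(i := 0)) I c < M + N" .
        moreover have "(t(i := 0)) i2 = 0" "i1 \<in> I \<Longrightarrow> (t(i := 0)) i1 = q ^ (b i1 - 1)" "i2 \<in> I"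
          using 2 i t1 I i12 by auto
        ultimately have "?B I" by blast
        then show ?thesis by blast
      next
        case 3
        obtain v where "?h t I' v < M" using not_covered by (meson not_le)
        from bound[OF this] have "\<And>c. ?h (t(i := v)) I c < M + N" .
        moreover have "(t(i := v)) i2 = 0" "i1 \<in> I \<Longrightarrow> (t(i := v)) i1 = q ^ (b i1 - 1)" "i2 \<in> I"
          using 3 t1 t2 I by auto
        ultimately have "?B I" by blast
        then show ?thesis by blast
      next
        case 4
        then have h0: "?h t I' 0 < M" using t0 not_covered by auto
        show ?thesis
        \<comment> \<open>An uncovered class other than that of 0 is preferred. If there is none,
          placing the term on the class of 0 either leaves 0 uncovered or completes the covering,
          and the invariant allows both.\<close>
        proof (cases "\<exists>v. ?h t I' v < M \<and> \<not> [0 = v] (mod q ^ b i)")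
          case True
          then obtain v where v: "?h t I' v < M" "\<not> [0 = v] (mod q ^ b i)" by blast
          then have "?h (t(i := v)) I 0 < M" unfolding upd using h0 by simp
          moreover have "i1 \<in> I \<Longrightarrow> (t(i := v)) i1 = q ^ (b i1 - 1)" "i2 \<notin> I"
            using 4 t1 I by auto
          ultimately have "?B I" using bound[OF v(1)] by blast
          then show ?thesis by blast
        next
          case False
          have "?h (t(i := 0)) I 0 < M \<or> (\<forall>c. M \<le> ?h (t(i := 0)) I c)"
          proof (rule disjCI)
            assume n: "\<not> (\<forall>c. M \<le> ?h (t(i := 0)) I c)"
            then obtain c where c: "?h (t(i := 0)) I c < M" by (meson not_le)
            then have "?h t I' c < M" unfolding upd by simp
            with False have c0: "[0 = c] (mod q ^ b i)" by blast
            have "?h t I' 0 = ?h t I' c" using c0 by (rule per)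
            moreover have "[c = 0] (mod q ^ b i)" using c0 by (rule cong_sym)
            ultimately show "?h (t(i := 0)) I 0 < M" using c unfolding upd by simp
          qed
          moreover have "i1 \<in> I \<Longrightarrow> (t(i := 0)) i1 = q ^ (b i1 - 1)" "i2 \<notin> I"
            using 4 t1 I by auto
          ultimately have "?B I" using bound[OF h0] by blast
          then show ?thesis by blast
        qed
      qed
    qed
  qed
qed

text \<open>By \<open>area\<close>, at most \<open>N - 1\<close> is missing in total from the
  constant height \<open>M + N - 1\<close>. So nothing is uncovered; and if no term could be spared,
  the class of each term \<open>i\<close> would contain a residue missing at least
  \<open>N - w i\<close>. For \<open>i1\<close> and \<open>i2\<close>, placed on disjoint classes
  and of weight at most half of \<open>N\<close>, these losses add up to at least
  \<open>N\<close>.\<close>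

theorem prime_power_cover:
  fixes w b :: "'i \<Rightarrow> nat"
  assumes q: "q \<ge> 2" and I: "finite I"
    and w: "\<And>i. i \<in> I \<Longrightarrow> w i \<le> N" and b: "\<And>i. i \<in> I \<Longrightarrow> b i \<le> k"
    and i12: "i1 \<in> I" "i2 \<in> I" "i1 \<noteq> i2" "1 \<le> b i1" "1 \<le> b i2" "2 * w i1 \<le> N" "2 * w i2 \<le> N"
    and N: "N > 0" and M: "M > 0"
    and area: "M * q ^ k + (N - 1) * (q ^ k - 1) \<le> (\<Sum>i\<in>I. w i * q ^ (k - b i))"
  shows "\<exists>i\<in>I. \<exists>t. \<forall>c. M \<le> cover_height w (\<lambda>i. q ^ b i) t (I - {i}) c"
proof -
  let ?h = "cover_height w (\<lambda>i. q ^ b i)"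
  have main: ?thesis if i12: "i1 \<in> I" "i2 \<in> I" "i1 \<noteq> i2" "1 \<le> b i1" "b i1 \<le> b i2"
      "2 * w i1 \<le> N" "2 * w i2 \<le> N" for i1 i2
  proof (rule ccontr)
    assume neg: "\<not> ?thesis"
    with greedy_cover[where w = w and b = b and N = N and M = M, OF q I w i12(3) i12(4) i12(5)] N M i12(1,2)
    obtain t where t: "\<And>c. ?h t I c < M + N" "t i1 = q ^ (b i1 - 1)" "t i2 = 0" by blast
    define n where "n = q ^ k"
    have n: "n > 0" using q by (simp add: n_def)
    have total: "(\<Sum>c<n. ?h t I c) = (\<Sum>i\<in>I. w i * q ^ (k - b i))"
    proof -
      have "(\<Sum>c<n. ?h t I c) = (\<Sum>i\<in>I. w i * (n div q ^ b i))"
        by (rule sum_cover_height[OF n]) (use b in \<open>auto simp: n_def intro: le_imp_power_dvd\<close>)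
      also have "\<dots> = (\<Sum>i\<in>I. w i * q ^ (k - b i))"
        using b q by (intro sum.cong) (auto simp: n_def power_diff)
      finally show ?thesis .
    qed
    define D where "D = (\<lambda>c. M + N - 1 - ?h t I c)"
    have "(\<Sum>c<n. D c) + (\<Sum>c<n. ?h t I c) = (\<Sum>c<n. M + N - 1)"
      unfolding sum.distrib[symmetric]
    proof (rule sum.cong[OF refl])
      fix c show "D c + ?h t I c = M + N - 1" using t(1)[of c] by (simp add: D_def)
    qed
    also have "\<dots> = n * (M + N - 1)" by simp
    also have "\<dots> = (M * n + (N - 1) * (n - 1)) + (N - 1)"
      using n N by (cases n; cases N) (auto simp: algebra_simps)
    finally have SD: "(\<Sum>c<n. D c) \<le> N - 1"
      using area unfolding total unfolding n_def by linarith
    have covered: "M \<le> ?h t I c" if "c < n" for c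
    proof (rule ccontr)
      assume "\<not> ?thesis"
      then have "N \<le> D c" by (simp add: D_def)
      also have "D c \<le> (\<Sum>c<n. D c)" using that by (intro member_le_sum) auto
      finally show False using SD N by simp
    qed
    \<comment> \<open>Leaving out \<open>i\<close> uncovers some residue, which lies in the class of
      \<open>i\<close> because with \<open>i\<close> everything is covered.\<close>
    have low: "\<exists>c<n. [c = t i] (mod q ^ b i) \<and> N - w i \<le> D c" if i: "i \<in> I" for i
    proof -
      from neg i obtain c where c: "?h t (I - {i}) c < M" by (meson not_le)
      have per: "?h t (I - {i}) (c mod n) = ?h t (I - {i}) c"
        by (rule cover_height_periodic[where D = n]) (use b in \<open>auto simp: n_def cong_def intro: le_imp_power_dvd\<close>)
      have eq: "?h t I (c mod n) = ?h t (I - {i}) c + (if [c mod n = t i] (mod q ^ b i) then w i else 0)"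
        using cover_height_insert[of "I - {i}" i w "\<lambda>i. q ^ b i" t "c mod n"] i I per by (simp add: insert_absorb)
      have "c mod n < n" using n by simp
      moreover from covered[OF this] have "[c mod n = t i] (mod q ^ b i)" using eq c by (auto split: if_splits)
      moreover have "N - w i \<le> D (c mod n)" using eq c by (auto simp: D_def split: if_splits)
      ultimately show ?thesis by blast
    qed
    from low[OF i12(1)] obtain c1 where c1: "c1 < n" "[c1 = q ^ (b i1 - 1)] (mod q ^ b i1)" "N - w i1 \<le> D c1"
      using t by auto
    from low[OF i12(2)] obtain c2 where c2: "c2 < n" "[c2 = 0] (mod q ^ b i2)" "N - w i2 \<le> D c2"
      using t by auto
    have "c1 \<noteq> c2"
    proof
      assume "c1 = c2"
      then have "[c1 = 0] (mod q ^ b i1)"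
        using c2(2) i12(5) by (metis cong_dvd_modulus_nat le_imp_power_dvd)
      with c1(2) have "[0 = q ^ (b i1 - 1)] (mod q ^ b i1)" by (meson cong_sym cong_trans)
      moreover have "q ^ (b i1 - 1) < q ^ b i1" using q i12 by (intro power_strict_increasing) auto
      moreover have "0 < q ^ (b i1 - 1)" using q by simp
      ultimately show False by (auto simp: cong_def)
    qed
    then have "D c1 + D c2 = (\<Sum>c\<in>{c1, c2}. D c)" by simp
    also have "\<dots> \<le> (\<Sum>c<n. D c)" using c1 c2 by (intro sum_mono2) auto
    finally show False using SD N c1 c2 i12(6,7) by linarith
  qed
  show ?thesis
  proof (cases "b i1 \<le> b i2")
    case True then show ?thesis using main[of i1 i2] i12 by blast
  next
    case False then show ?thesis using main[of i2 i1] i12 by (metis nat_le_linear)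
  qed
qed

section \<open>Coverings of a grid\<close>

lemma distribute_evenly:
  assumes "finite H" "finite X" "k * card X \<le> card H"
  shows "\<exists>f. \<forall>x\<in>X. k \<le> card {i \<in> H. f i = x}"
  using assms(2,1,3)
proof (induction X arbitrary: H rule: finite_induct)
  case (insert x X)
  then have "k \<le> card H" by simp
  then obtain H0 where H0: "H0 \<subseteq> H" "card H0 = k" "finite H0" by (meson obtain_subset_with_card_n)
  have "k * card X \<le> card (H - H0)" using insert H0 by (simp add: card_Diff_subset)
  from insert.IH[OF _ this] insert.prems obtain f
    where f: "\<And>x. x \<in> X \<Longrightarrow> k \<le> card {i \<in> H - H0. f i = x}" by auto
  define g where "g = (\<lambda>i. if i \<in> H0 then x else f i)"
  have "k \<le> card {i \<in> H. g i = y}" if "y \<in> insert x X" for y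
  proof (cases "y = x")
    case True
    have "H0 \<subseteq> {i \<in> H. g i = y}" using H0 True by (auto simp: g_def)
    then show ?thesis using card_mono[of "{i \<in> H. g i = y}" H0] H0 insert.prems by simp
  next
    case False
    then have "k \<le> card {i \<in> H - H0. f i = y}" using f that by auto
    also have "\<dots> \<le> card {i \<in> H. g i = y}"
      using insert.prems by (intro card_mono) (auto simp: g_def)
    finally show ?thesis .
  qed
  then show ?case by blast
qed simp

text \<open>Last case of the grid argument: neither \<open>D\<close> nor \<open>E\<close> reaches
  the missing height \<open>A + 1\<close>, so both are given up, and \<open>H\<close> alone must
  fill the cells not taken by \<open>F\<close>. The loss is affordable since
  \<open>q + r \<le> q * r\<close> absorbs \<open>D * r + E * q\<close> into
  \<open>A * q * r\<close>. Here \<open>s\<close> is the area of the omitted term.\<close>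

lemma grid_cover_arith:
  fixes p q r :: nat
  assumes p: "2 \<le> p" and q: "2 \<le> q" and r: "2 \<le> r"
    and Bq: "B < q" and Cr: "C < r" and BC: "B \<noteq> 0 \<or> C \<noteq> 0" and D: "D \<le> A" and E: "E \<le> A"
    and F: "F < (B + 1) * (C + 1)"
    and s: "D > 0 \<Longrightarrow> s \<le> r" "E > 0 \<Longrightarrow> s \<le> q" "F > 0 \<Longrightarrow> s \<le> p" "H > 0 \<Longrightarrow> s \<le> 1"
    and ne: "D > 0 \<or> E > 0 \<or> F > 0 \<or> H > 0"
    and sup: "A * q * r + B * p * r + C * p * q < D * r + E * q + F * p + H + s"
  shows "p * ((B + 1) * (C + 1) - F) \<le> H"
proof -
  define W where "W = B * r + C * q"
  have cells: "(B + 1) * (C + 1) \<le> W"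
  proof -
    have "B * (C + 1) \<le> B * r" "C * (B + 1) \<le> C * q" using Bq Cr by (simp_all add: mult_le_mono2 del: mult_Suc_right)
    then have 1: "2 * (B * C) + B + C \<le> W" by (simp add: W_def algebra_simps)
    have "B * 2 \<le> B * r" "C * 2 \<le> C * q" using q r by (simp_all add: mult_le_mono2)
    then have 2: "2 * B + 2 * C \<le> W" unfolding W_def by linarith
    show ?thesis
    proof (cases "B * C = 0")
      case True then show ?thesis using 2 BC by (auto simp: algebra_simps)
    next
      case False
      then have "1 \<le> B * C" by simp
      moreover have "(B + 1) * (C + 1) = B * C + B + C + 1" by simp
      ultimately show ?thesis using 1 by linarith
    qed
  qed
  have qr: "q + r \<le> q * r"
  proof -
    obtain q' r' where "q = q' + 2" "r = r' + 2" using q r by (metis le_add_diff_inverse2)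
    then show ?thesis by (simp add: algebra_simps)
  qed
  have "A * (q + r) \<le> A * (q * r)" using qr by simp
  then have "A * q + A * r \<le> A * q * r" by (simp only: distrib_left mult.assoc)
  moreover have "D * r \<le> A * r" "E * q \<le> A * q" using D E by simp_all
  moreover have pW: "B * p * r + C * p * q = p * W" by (simp add: W_def algebra_simps)
  ultimately have main: "p * W < F * p + H + s" using sup by linarith
  show ?thesis
  proof (cases "H > 0")
    case True
    then have "p * W \<le> F * p + H" using main s(4) by linarith
    moreover have "p * ((B + 1) * (C + 1)) \<le> p * W" using cells by (rule mult_le_mono2)
    ultimately have "p * ((B + 1) * (C + 1)) \<le> p * F + H" by (simp add: mult.commute)
    then show ?thesis by (simp add: diff_mult_distrib2)
  next
    case False
    \<comment> \<open>With \<open>H = 0\<close> the supply would force \<open>p < s\<close> and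
      hence \<open>F = 0\<close>. Then \<open>s\<close> is at most \<open>r\<close> or at most
      \<open>q\<close>, too small to meet the demand.\<close>
    have FW: "F + 1 \<le> W" using F cells by simp
    then have "p * (F + 1) \<le> p * W" by (rule mult_le_mono2)
    then have ps: "p < s" using main False by (simp add: algebra_simps)
    then have F0: "F = 0" using s(3) by (cases F) auto
    have A: "A \<ge> 1" using ne F0 False D E by auto
    have sup': "A * (q * r) + p * W < D * r + E * q + s" using sup pW F0 False by (simp add: mult.assoc)
    have pW2: "B * (2 * r) + C * (2 * q) \<le> p * W"
    proof -
      have "2 * W \<le> p * W" using p by simp
      then show ?thesis by (simp add: W_def algebra_simps)
    qed
    have Br: "r \<le> B * r" if "B > 0" using that by simp
    have Cq: "q \<le> C * q" if "C > 0" using that by simp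
    have slack: "q * r + A * (q + r) \<le> A * (q * r) + (q + r)"
    proof -
      obtain A' where A': "A = Suc A'" using A by (cases A) auto
      have "A' * (q + r) \<le> A' * (q * r)" using qr by simp
      then show ?thesis unfolding A' by (simp add: algebra_simps)
    qed
    have DE: "D * r + E * q \<le> A * (q + r)" using mult_le_mono1[OF D, of r] mult_le_mono1[OF E, of q] unfolding distrib_left by linarith
    have q2: "2 * r \<le> q * r" "2 * q \<le> q * r" using q r by simp_all
    have "s \<le> r \<or> s \<le> q" using ne F0 False s by auto
    then have False
    proof
      assume "s \<le> r"
      then show False using sup' slack DE q2 pW2 Br Cq BC by (cases "B > 0"; cases "C > 0") linarith+
    next
      assume "s \<le> q"
      then show False using sup' slack DE q2 pW2 Br Cq BC by (cases "B > 0"; cases "C > 0") linarith+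
    qed
    then show ?thesis ..
  qed
qed

text \<open>
  \<open>D\<close>, \<open>E\<close>, \<open>F\<close>, \<open>H\<close> are the terms of order \<open>p q\<close>, \<open>p r\<close>, \<open>q r\<close>, \<open>p q r\<close>: they
  add height \<open>1\<close> to a column, \<open>1\<close> to a row, \<open>p\<close> to a cell and \<open>1\<close> to a cell of the grid of
  characters of \<open>C\<^sub>q \<oplus> C\<^sub>r\<close>. \<open>Q\<close> and \<open>R\<close> are the columns and rows
  left uncovered by the terms of prime order, \<open>\<alpha>\<close> is the missing height.
\<close>

lemma grid_cover:
  fixes D E F H :: "'i set" and Q R :: "nat set"
  assumes p: "2 \<le> p" and q: "2 \<le> q" and r: "2 \<le> r" and al: "1 \<le> \<alpha>" "\<alpha> \<le> p"
    and fin: "finite D" "finite E" "finite F" "finite H" "finite Q" "finite R"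
    and Q: "Q \<noteq> {}" "card Q \<le> q" and R: "R \<noteq> {}" "card R \<le> r"
    and ne: "D \<noteq> {} \<or> E \<noteq> {} \<or> F \<noteq> {} \<or> H \<noteq> {}"
    and s: "D \<noteq> {} \<Longrightarrow> s \<le> r" "E \<noteq> {} \<Longrightarrow> s \<le> q" "F \<noteq> {} \<Longrightarrow> s \<le> p" "H \<noteq> {} \<Longrightarrow> s \<le> 1"
    and sup: "(\<alpha> - 1) * q * r + (card Q - 1) * p * r + (card R - 1) * p * q
       < card D * r + card E * q + card F * p + card H + s"
  shows "\<exists>\<kappa> \<rho> \<phi> \<eta>. \<forall>y\<in>Q. \<forall>z\<in>R. (\<exists>i\<in>F. \<phi> i = (y, z)) \<or>
     \<alpha> \<le> card {i \<in> D. \<kappa> i = y} + card {i \<in> E. \<rho> i = z} + card {i \<in> H. \<eta> i = (y, z)}"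
  using fin Q R ne s sup
proof (induction "card Q + card R" arbitrary: D E Q R rule: less_induct)
  case less
  note fin = less.prems(1-6) and Q = less.prems(7,8) and R = less.prems(9,10) and ne = less.prems(11)
    and s = less.prems(12-15) and sup = less.prems(16)
  define A where "A = \<alpha> - 1"
  have A: "\<alpha> = A + 1" using al by (simp add: A_def)
  define B where "B = card Q - 1"
  define C where "C = card R - 1"
  have cQ: "card Q = B + 1" using Q fin by (simp add: B_def card_gt_0_iff Suc_leI)
  have cR: "card R = C + 1" using R fin by (simp add: C_def card_gt_0_iff Suc_leI)
  have sup': "A * q * r + B * p * r + C * p * q < card D * r + card E * q + card F * p + card H + s"
    using sup by (simp add: A_def B_def C_def)
  have Aq: "A * 2 \<le> A * q" "A * 2 \<le> A * r" using q r by simp_all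
  show ?case
  \<comment> \<open>With enough terms for a whole column, they are spent on one. The demand drops by
    \<open>p * r\<close> at a cost of \<open>\<alpha> * r\<close>, which is no more, so the
    inequality survives.\<close>
  proof (cases "\<alpha> \<le> card D")
    case True
    then obtain D0 where D0: "D0 \<subseteq> D" "card D0 = \<alpha>" by (meson obtain_subset_with_card_n)
    have D0f: "finite D0" using D0 fin finite_subset by blast
    obtain y0 where y0: "y0 \<in> Q" using Q by blast
    show ?thesis
    proof (cases "B = 0")
      case True
      then have "Q = {y0}" using cQ y0 by (metis One_nat_def add_0 card_1_singletonE singletonD)
      then show ?thesis using \<open>\<alpha> \<le> card D\<close> by (intro exI[of _ "\<lambda>_. y0"]) (auto simp: trans_le_add1)
    next
      case False
      then obtain B' where B': "B = Suc B'" by (cases B) auto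
      have cQ': "card (Q - {y0}) = B" using cQ y0 fin by simp
      have cD: "card D = card (D - D0) + \<alpha>"
        using D0 D0f fin True by (simp add: card_Diff_subset)
      have ar: "\<alpha> * r \<le> p * r" using al by simp
      have "\<exists>\<kappa> \<rho> \<phi> \<eta>. \<forall>y\<in>Q - {y0}. \<forall>z\<in>R. (\<exists>i\<in>F. \<phi> i = (y, z)) \<or>
         \<alpha> \<le> card {i \<in> D - D0. \<kappa> i = y} + card {i \<in> E. \<rho> i = z} + card {i \<in> H. \<eta> i = (y, z)}"
      proof (rule less.hyps)
        show "card (Q - {y0}) + card R < card Q + card R" using cQ cQ' by simp
        show "Q - {y0} \<noteq> {}" using cQ' False by (metis card.empty)
        \<comment> \<open>The induction needs a remaining term. If there were none,
          \<open>s \<le> r\<close> would leave too little supply for the other columns.\<close>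
        show "D - D0 \<noteq> {} \<or> E \<noteq> {} \<or> F \<noteq> {} \<or> H \<noteq> {}"
        proof (rule ccontr)
          assume "\<not> ?thesis"
          then have e: "D - D0 = {}" "E = {}" "F = {}" "H = {}" by auto
          then have "card D = \<alpha>" using cD by (simp only: e card.empty add_0)
          moreover have "D \<noteq> {}" using ne e by simp
          ultimately have "A * q * r + B * p * r < \<alpha> * r + r" using sup' s(1) e by simp
          moreover have "2 * (A * r) \<le> A * q * r" using Aq q by (simp add: mult_ac)
          moreover have "2 * r \<le> B * p * r"
          proof -
            have "1 * 2 \<le> B * p" using B' p by (intro mult_le_mono) auto
            then show ?thesis by simp
          qed
          moreover have "\<alpha> * r = A * r + r" by (simp add: A)
          ultimately show False by linarith
        qed
        show "(\<alpha> - 1) * q * r + (card (Q - {y0}) - 1) * p * r + (card R - 1) * p * q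
            < card (D - D0) * r + card E * q + card F * p + card H + s"
          using sup' cD ar unfolding cQ' cR A B' by (simp add: algebra_simps)
      qed (use fin Q R s cQ cQ' in auto)
      then obtain \<kappa> \<rho> \<phi> \<eta> where IH: "\<And>y z. y \<in> Q - {y0} \<Longrightarrow> z \<in> R \<Longrightarrow> (\<exists>i\<in>F. \<phi> i = (y, z)) \<or>
         \<alpha> \<le> card {i \<in> D - D0. \<kappa> i = y} + card {i \<in> E. \<rho> i = z} + card {i \<in> H. \<eta> i = (y, z)}" by blast
      define \<kappa>' where "\<kappa>' = (\<lambda>i. if i \<in> D0 then y0 else \<kappa> i)"
      have "(\<exists>i\<in>F. \<phi> i = (y, z)) \<or>
         \<alpha> \<le> card {i \<in> D. \<kappa>' i = y} + card {i \<in> E. \<rho> i = z} + card {i \<in> H. \<eta> i = (y, z)}"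
        if y: "y \<in> Q" and z: "z \<in> R" for y z
      proof (cases "y = y0")
        case True
        have "card D0 \<le> card {i \<in> D. \<kappa>' i = y}"
          using fin D0 True by (intro card_mono) (auto simp: \<kappa>'_def)
        then show ?thesis using D0 by simp
      next
        case False
        have "card {i \<in> D - D0. \<kappa> i = y} \<le> card {i \<in> D. \<kappa>' i = y}"
          using fin by (intro card_mono) (auto simp: \<kappa>'_def)
        then show ?thesis using IH[of y z] y z False by fastforce
      qed
      then show ?thesis by blast
    qed
  next
    case Dsmall: False
    show ?thesis
    proof (cases "\<alpha> \<le> card E")
      case True
      then obtain E0 where E0: "E0 \<subseteq> E" "card E0 = \<alpha>" by (meson obtain_subset_with_card_n)
      have E0f: "finite E0" using E0 fin finite_subset by blast
      obtain z0 where z0: "z0 \<in> R" using R by blast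
      show ?thesis
      proof (cases "C = 0")
        case True
        then have "R = {z0}" using cR z0 by (metis One_nat_def add_0 card_1_singletonE singletonD)
        then have "\<forall>y\<in>Q. \<forall>z\<in>R. \<alpha> \<le> card {i \<in> D. (\<lambda>_. 0) i = y} + card {i \<in> E. (\<lambda>_. z0) i = z} + card {i \<in> H. (\<lambda>_. (0,0)) i = (y, z)}"
          using \<open>\<alpha> \<le> card E\<close> by auto
        then show ?thesis
          by (intro exI[of _ "\<lambda>_. 0"] exI[of _ "\<lambda>_. z0"] exI[of _ "\<lambda>_. (0, 0)"]) blast
      next
        case False
        then obtain C' where C': "C = Suc C'" by (cases C) auto
        have cR': "card (R - {z0}) = C" using cR z0 fin by simp
        have cE: "card E = card (E - E0) + \<alpha>"
          using E0 E0f fin True by (simp add: card_Diff_subset)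
        have ar: "\<alpha> * q \<le> p * q" using al by simp
        have "\<exists>\<kappa> \<rho> \<phi> \<eta>. \<forall>y\<in>Q. \<forall>z\<in>R - {z0}. (\<exists>i\<in>F. \<phi> i = (y, z)) \<or>
           \<alpha> \<le> card {i \<in> D. \<kappa> i = y} + card {i \<in> E - E0. \<rho> i = z} + card {i \<in> H. \<eta> i = (y, z)}"
        proof (rule less.hyps)
          show "card Q + card (R - {z0}) < card Q + card R" using cR cR' by simp
          show "R - {z0} \<noteq> {}" using cR' False by (metis card.empty)
          show "D \<noteq> {} \<or> E - E0 \<noteq> {} \<or> F \<noteq> {} \<or> H \<noteq> {}"
          proof (rule ccontr)
            assume "\<not> ?thesis"
            then have e: "E - E0 = {}" "D = {}" "F = {}" "H = {}" by auto
            then have "card E = \<alpha>" using cE by (simp only: e card.empty add_0)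
            moreover have "E \<noteq> {}" using ne e by simp
            ultimately have "A * q * r + C * p * q < \<alpha> * q + q" using sup' s(2) e by simp
            moreover have "2 * (A * q) \<le> A * q * r" using Aq r by (simp add: mult_ac)
            moreover have "2 * q \<le> C * p * q"
            proof -
              have "1 * 2 \<le> C * p" using C' p by (intro mult_le_mono) auto
              then show ?thesis by simp
            qed
            moreover have "\<alpha> * q = A * q + q" by (simp add: A)
            ultimately show False by linarith
          qed
          show "(\<alpha> - 1) * q * r + (card Q - 1) * p * r + (card (R - {z0}) - 1) * p * q
              < card D * r + card (E - E0) * q + card F * p + card H + s"
            using sup' cE ar unfolding cR' cQ A C' by (simp add: algebra_simps)
        qed (use fin Q R s cR cR' in auto)
        then obtain \<kappa> \<rho> \<phi> \<eta> where IH: "\<And>y z. y \<in> Q \<Longrightarrow> z \<in> R - {z0} \<Longrightarrow> (\<exists>i\<in>F. \<phi> i = (y, z)) \<or>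
           \<alpha> \<le> card {i \<in> D. \<kappa> i = y} + card {i \<in> E - E0. \<rho> i = z} + card {i \<in> H. \<eta> i = (y, z)}" by blast
        define \<rho>' where "\<rho>' = (\<lambda>i. if i \<in> E0 then z0 else \<rho> i)"
        have "(\<exists>i\<in>F. \<phi> i = (y, z)) \<or>
           \<alpha> \<le> card {i \<in> D. \<kappa> i = y} + card {i \<in> E. \<rho>' i = z} + card {i \<in> H. \<eta> i = (y, z)}"
          if y: "y \<in> Q" and z: "z \<in> R" for y z
        proof (cases "z = z0")
          case True
          have "card E0 \<le> card {i \<in> E. \<rho>' i = z}"
            using fin E0 True by (intro card_mono) (auto simp: \<rho>'_def)
          then show ?thesis using E0 by simp
        next
          case False
          have "card {i \<in> E - E0. \<rho> i = z} \<le> card {i \<in> E. \<rho>' i = z}"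
            using fin by (intro card_mono) (auto simp: \<rho>'_def)
          then show ?thesis using IH[of y z] y z False by fastforce
        qed
        then show ?thesis by blast
      qed
    next
      case Esmall: False
      have DE: "card D \<le> A" "card E \<le> A" using Dsmall Esmall A by auto
      have pos: "D \<noteq> {} \<longleftrightarrow> card D > 0" "E \<noteq> {} \<longleftrightarrow> card E > 0" "F \<noteq> {} \<longleftrightarrow> card F > 0" "H \<noteq> {} \<longleftrightarrow> card H > 0"
        using fin by (auto simp: card_gt_0_iff)
      show ?thesis
      \<comment> \<open>A single cell is treated apart: all column and row terms meet in it and must
        be counted, whereas in a larger grid they are discarded from here on.\<close>
      proof (cases "B = 0 \<and> C = 0")
        case True
        obtain y0 where y0: "Q = {y0}" using cQ True by (metis One_nat_def add_0 card_1_singletonE)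
        obtain z0 where z0: "R = {z0}" using cR True by (metis One_nat_def add_0 card_1_singletonE)
        show ?thesis
        proof (cases "F = {}")
          case False
          then have "\<forall>y\<in>Q. \<forall>z\<in>R. \<exists>i\<in>F. (\<lambda>_. (y0, z0)) i = (y, z)" using y0 z0 by auto
          then show ?thesis by (intro exI[of _ "\<lambda>_. 0"] exI[of _ "\<lambda>_. (y0, z0)"]) blast
        next
          case F: True
          have "\<alpha> \<le> card D + card E + card H"
          proof (rule ccontr)
            assume "\<not> ?thesis"
            then have le: "card D + card E + card H \<le> A" using A by simp
            then have A1: "A \<ge> 1" using ne F pos by auto
            define mx where "mx = max q r"
            have mx: "q \<le> mx" "r \<le> mx" "1 \<le> mx" using q by (auto simp: mx_def)
            have "s \<le> mx" using s ne F mx by force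
            moreover have "card D * r + card E * q + card H \<le> (card D + card E + card H) * mx"
              using mx by (simp add: distrib_right add_mono)
            moreover have "(card D + card E + card H) * mx \<le> A * mx" using le by simp
            moreover have "A * q * r < card D * r + card E * q + card H + s" using sup' F True by simp
            ultimately have "A * q * r < A * mx + mx" by linarith
            also have "\<dots> \<le> A * (2 * mx)" using A1 by (cases A) auto
            also have "2 * mx \<le> q * r" using q r by (auto simp: mx_def max_def)
            then have "A * (2 * mx) \<le> A * q * r" by (simp add: mult.assoc)
            finally show False by simp
          qed
          then have "\<forall>y\<in>Q. \<forall>z\<in>R. \<alpha> \<le> card {i \<in> D. (\<lambda>_. y0) i = y} + card {i \<in> E. (\<lambda>_. z0) i = z} + card {i \<in> H. (\<lambda>_. (y0, z0)) i = (y, z)}"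
            using y0 z0 by auto
          then show ?thesis
            by (intro exI[of _ "\<lambda>_. y0"] exI[of _ "\<lambda>_. z0"] exI[of _ "\<lambda>_. (y0, z0)"]) blast
        qed
      next
        case BC: False
        have cells: "card (Q \<times> R) = (B + 1) * (C + 1)" by (simp only: card_cartesian_product cQ cR)
        \<comment> \<open>Each term of \<open>F\<close> completes one cell at once, its height being
          \<open>p\<close>, which is at least \<open>\<alpha>\<close>; \<open>H\<close> supplies
          \<open>\<alpha>\<close> terms to every cell left over.\<close>
        define m where "m = min (card F) (card (Q \<times> R))"
        obtain X where X: "X \<subseteq> Q \<times> R" "card X = m" "finite X"
          using obtain_subset_with_card_n[of m "Q \<times> R"] by (auto simp: m_def)
        have "1 * card X \<le> card F" using X by (simp add: m_def)
        with distribute_evenly[OF fin(3) X(3)] obtain \<phi>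
          where \<phi>: "\<And>x. x \<in> X \<Longrightarrow> 1 \<le> card {i \<in> F. \<phi> i = x}" by blast
        have cd: "card (Q \<times> R - X) = (B + 1) * (C + 1) - m"
          using X cells by (simp add: card_Diff_subset)
        have "\<alpha> * card (Q \<times> R - X) \<le> card H"
        proof (cases "card F < (B + 1) * (C + 1)")
          case True
          have "p * ((B + 1) * (C + 1) - card F) \<le> card H"
            by (rule grid_cover_arith[OF p q r _ _ _ DE True, of s])
               (use BC Q R cQ cR s ne sup' pos in auto)
          moreover have "m = card F" using True cells by (simp add: m_def)
          ultimately show ?thesis using cd al by (metis le_trans mult_le_mono1)
        next
          case False
          then have "card (Q \<times> R - X) = 0" using cd cells by (simp add: m_def)
          then show ?thesis by simp
        qed
        then obtain \<eta> where \<eta>: "\<And>x. x \<in> Q \<times> R - X \<Longrightarrow> \<alpha> \<le> card {i \<in> H. \<eta> i = x}"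
          using distribute_evenly[OF fin(4), of "Q \<times> R - X" \<alpha>] fin by auto
        have "(\<exists>i\<in>F. \<phi> i = (y, z)) \<or>
           \<alpha> \<le> card {i \<in> D. (\<lambda>_. 0) i = y} + card {i \<in> E. (\<lambda>_. 0) i = z} + card {i \<in> H. \<eta> i = (y, z)}"
          if y: "y \<in> Q" and z: "z \<in> R" for y z
        proof (cases "(y, z) \<in> X")
          case True
          then have "{i \<in> F. \<phi> i = (y, z)} \<noteq> {}" using \<phi>[OF True] by (metis card.empty not_one_le_zero)
          then show ?thesis by blast
        next
          case False
          then show ?thesis using \<eta>[of "(y, z)"] y z by simp
        qed
        then show ?thesis
          by (intro exI[of _ "\<lambda>_. 0"] exI[of _ \<phi>] exI[of _ \<eta>]) blast
      qed
    qed
  qed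
qed

text \<open>\<open>w i = 1\<close> stands for an order divisible by \<open>p\<close>, and
  \<open>d i\<close> for the part of the order prime to \<open>p\<close>, so \<open>X\<close>
  collects the terms of composite order. The term of \<open>X\<close> with least area is left out:
  this bounds its area by that of every other composite term, and a second member of
  \<open>X\<close> keeps the grid problem nonempty. \<open>area\<close> is k(U) >= K^*(G) multiplied
  by \<open>p * q * r\<close>.\<close>

theorem two_prime_grid_cover:
  fixes w d :: "'i \<Rightarrow> nat"
  assumes p: "p \<ge> 2" and q: "q \<ge> 2" and r: "r \<ge> 2" and qr: "coprime q r" and I: "finite I"
    and wd: "\<And>i. i \<in> I \<Longrightarrow> (w i = 1 \<or> w i = p) \<and> d i \<in> {1, q, r, q * r} \<and> (w i = p \<longrightarrow> d i \<noteq> 1)"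
    and i12: "i1 \<in> I" "i2 \<in> I" "i1 \<noteq> i2" "i1 \<in> X" "i2 \<in> X"
    and X: "X = {i \<in> I. d i = q * r \<or> (w i = 1 \<and> d i \<noteq> 1)}"
    and area: "3 * p * q * r + 1 \<le> (\<Sum>i\<in>I. w i * (q * r div d i)) + q * r + p * r + p * q"
  shows "\<exists>i\<in>I. \<exists>t. \<forall>c. p \<le> cover_height w d t (I - {i}) c"
proof -
  define nominal where "nominal = (\<lambda>i. w i * (q * r div d i))"
  have neq: "q \<noteq> r" using qr q by auto
  have neqs: "q \<noteq> 1" "r \<noteq> 1" "q * r \<noteq> 1" "q * r \<noteq> q" "q * r \<noteq> r" "p \<noteq> 1" using p q r by auto
  have "Min (nominal ` X) \<in> nominal ` X" using i12 I X by (intro Min_in) auto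
  then obtain i0 where i0: "i0 \<in> X" "nominal i0 = Min (nominal ` X)" by auto
  have i0min: "nominal i0 \<le> nominal i" if "i \<in> X" for i
    unfolding i0(2) using that I X by (intro Min_le) auto
  have i0I: "i0 \<in> I" using i0 X by auto
  define S where "S = I - {i0}"
  have finS: "finite S" using I by (simp add: S_def)
  define cls where "cls = (\<lambda>v e. {i \<in> S. w i = v \<and> d i = e})"
  have fincls: "finite (cls v e)" for v e using finS by (simp add: cls_def)
  have geI: "p \<le> cover_height w d t S c" if "i \<in> S" "w i = p" "[c = t i] (mod d i)" for t c i
  proof -
    have "p = cover_height w d t {i} c" using that by (simp add: cover_height_def)
    also have "\<dots> \<le> cover_height w d t S c" using that finS by (intro cover_height_mono) auto
    finally show ?thesis .
  qed
  have card_le: "card Y \<le> cover_height w d t S c" if "Y \<subseteq> S" "\<And>i. i \<in> Y \<Longrightarrow> [c = t i] (mod d i)" for t c Y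
  proof -
    have "card Y = (\<Sum>i\<in>Y. 1)" by simp
    also have "\<dots> \<le> cover_height w d t Y c"
      unfolding cover_height_def using that wd p by (intro sum_mono) (fastforce simp: S_def)
    also have "\<dots> \<le> cover_height w d t S c" using that finS by (intro cover_height_mono) auto
    finally show ?thesis .
  qed
  \<comment> \<open>Terms of order \<open>p\<close> raise every height by one; those of order
    \<open>q\<close> or \<open>r\<close> finish a whole column or row. What remains is a smaller
    grid with missing height \<open>p - a\<close>.\<close>
  define a where "a = card (cls 1 1)"
  define b where "b = card (cls p q)"
  define c where "c = card (cls p r)"
  obtain fb where fb: "bij_betw fb (cls p q) {..<b}"
    using ex_bij_betw_finite_nat[OF fincls] unfolding b_def atLeast0LessThan by blast
  obtain fc where fc: "bij_betw fc (cls p r) {..<c}"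
    using ex_bij_betw_finite_nat[OF fincls] unfolding c_def atLeast0LessThan by blast
  have hit_b: "\<exists>i\<in>cls p q. fb i = y" if "y < b" for y
    using that bij_betw_imp_surj_on[OF fb] by (metis imageE lessThan_iff)
  have hit_c: "\<exists>i\<in>cls p r. fc i = z" if "z < c" for z
    using that bij_betw_imp_surj_on[OF fc] by (metis imageE lessThan_iff)
  have "\<exists>t. \<forall>u. p \<le> cover_height w d t S u"
  proof (cases "p \<le> a")
    case True
    have "p \<le> cover_height w d (\<lambda>_. 0) S u" for u
      using card_le[of "cls 1 1" u "\<lambda>_. 0"] True by (simp add: cls_def a_def cong_def)
    then show ?thesis by blast
  next
    case a: False
    show ?thesis
    proof (cases "q \<le> b \<or> r \<le> c")
      case True
      then show ?thesis
      proof
        assume "q \<le> b"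
        have "p \<le> cover_height w d fb S u" for u
        proof -
          have "u mod q < q" using q by simp
          then obtain i where "i \<in> cls p q" "fb i = u mod q" using hit_b \<open>q \<le> b\<close> by (meson less_le_trans)
          then show ?thesis using geI[of i u fb] by (simp add: cls_def cong_def)
        qed
        then show ?thesis by blast
      next
        assume "r \<le> c"
        have "p \<le> cover_height w d fc S u" for u
        proof -
          have "u mod r < r" using r by simp
          then obtain i where "i \<in> cls p r" "fc i = u mod r" using hit_c \<open>r \<le> c\<close> by (meson less_le_trans)
          then show ?thesis using geI[of i u fc] by (simp add: cls_def cong_def)
        qed
        then show ?thesis by blast
      qed
    next
      case bc: False
      define D where "D = cls 1 q"
      define E where "E = cls 1 r"
      define F where "F = cls p (q * r)"
      define H where "H = cls 1 (q * r)"
      have Ssplit: "S = cls 1 1 \<union> (cls p q \<union> (cls p r \<union> (D \<union> (E \<union> (F \<union> H)))))"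
        using wd by (auto simp: cls_def D_def E_def F_def H_def S_def)
      have sum_cls: "(\<Sum>i\<in>cls v e. nominal i) = card (cls v e) * (v * (q * r div e))" for v e
        by (simp add: cls_def nominal_def)
      have "(\<Sum>i\<in>S. nominal i) = (\<Sum>i\<in>cls 1 1. nominal i) + ((\<Sum>i\<in>cls p q. nominal i) + ((\<Sum>i\<in>cls p r. nominal i)
          + ((\<Sum>i\<in>D. nominal i) + ((\<Sum>i\<in>E. nominal i) + ((\<Sum>i\<in>F. nominal i) + (\<Sum>i\<in>H. nominal i))))))"
        unfolding D_def E_def F_def H_def
        apply (subst Ssplit)
        unfolding D_def E_def F_def H_def
        apply (subst sum.union_disjoint, (use fincls neq neqs in \<open>auto simp: cls_def\<close>)[3])+
        apply simp
        done
      also have "\<dots> = a * (q * r) + (b * (p * r) + (c * (p * q) + (card D * r + (card E * q + (card F * p + card H)))))"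
        unfolding D_def E_def F_def H_def sum_cls a_def b_def c_def using q r by simp
      finally have SS: "(\<Sum>i\<in>S. nominal i) = a * (q * r) + (b * (p * r) + (c * (p * q) + (card D * r + (card E * q + (card F * p + card H)))))" .
      have "(\<Sum>i\<in>I. nominal i) = (\<Sum>i\<in>S. nominal i) + nominal i0"
        using I i0I by (simp add: S_def sum.remove[of I i0])
      then have tot: "3 * p * q * r + 1 \<le> a * (q * r) + b * (p * r) + c * (p * q) + card D * r + card E * q + card F * p + card H + nominal i0 + q * r + p * r + p * q"
        using area SS unfolding nominal_def by simp
      have DX: "D \<subseteq> X" "E \<subseteq> X" "F \<subseteq> X" "H \<subseteq> X"
        using X neqs by (auto simp: D_def E_def F_def H_def cls_def S_def)
      have Xne: "D \<noteq> {} \<or> E \<noteq> {} \<or> F \<noteq> {} \<or> H \<noteq> {}"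
      proof -
        obtain i where i: "i \<in> X" "i \<in> S" using i12 by (cases "i1 = i0") (auto simp: S_def)
        then have "i \<notin> cls 1 1" "i \<notin> cls p q" "i \<notin> cls p r" using X neqs by (auto simp: cls_def)
        then have "i \<in> D \<union> E \<union> F \<union> H" using i(2) Ssplit by blast
        then show ?thesis by blast
      qed
      have "nominal i = r" if "i \<in> D" for i using that q by (simp add: D_def cls_def nominal_def)
      moreover have "nominal i = q" if "i \<in> E" for i using that r by (simp add: E_def cls_def nominal_def)
      moreover have "nominal i = p" if "i \<in> F" for i using that q r by (simp add: F_def cls_def nominal_def)
      moreover have "nominal i = 1" if "i \<in> H" for i using that q r by (simp add: H_def cls_def nominal_def)
      ultimately have s: "D \<noteq> {} \<Longrightarrow> nominal i0 \<le> r" "E \<noteq> {} \<Longrightarrow> nominal i0 \<le> q" "F \<noteq> {} \<Longrightarrow> nominal i0 \<le> p" "H \<noteq> {} \<Longrightarrow> nominal i0 \<le> 1"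
        using i0min DX by (metis ex_in_conv subsetD)+
      define Q where "Q = {b..<q}"
      define R where "R = {c..<r}"
      have "\<exists>\<kappa> \<rho> \<phi> \<eta>. \<forall>y\<in>Q. \<forall>z\<in>R. (\<exists>i\<in>F. \<phi> i = (y, z)) \<or>
         p - a \<le> card {i \<in> D. \<kappa> i = y} + card {i \<in> E. \<rho> i = z} + card {i \<in> H. \<eta> i = (y, z)}"
      proof (rule grid_cover[OF p q r, where s = "nominal i0"])
        obtain a' b' c' where abc: "p = Suc (a + a')" "q = Suc (b + b')" "r = Suc (c + c')"
          using a bc by (metis less_imp_Suc_add not_le)
        have "3 * p * q * r = (a + a' + 1) * (q * r) + (b + b' + 1) * (p * r) + (c + c' + 1) * (p * q)"
          using abc by (simp add: algebra_simps)
        then have "a' * (q * r) + b' * (p * r) + c' * (p * q) + 1 \<le> card D * r + card E * q + card F * p + card H + nominal i0"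
          using tot by (simp add: algebra_simps)
        moreover have "p - a - 1 = a'" "card Q - 1 = b'" "card R - 1 = c'" using abc by (auto simp: Q_def R_def)
        ultimately show "(p - a - 1) * q * r + (card Q - 1) * p * r + (card R - 1) * p * q
          < card D * r + card E * q + card F * p + card H + nominal i0" by (simp add: mult.assoc)
      qed (use a bc Xne s fincls in \<open>auto simp: Q_def R_def D_def E_def F_def H_def\<close>)
      then obtain \<kappa> \<rho> \<phi> \<eta> where grid: "\<And>y z. y \<in> Q \<Longrightarrow> z \<in> R \<Longrightarrow> (\<exists>i\<in>F. \<phi> i = (y, z)) \<or>
         p - a \<le> card {i \<in> D. \<kappa> i = y} + card {i \<in> E. \<rho> i = z} + card {i \<in> H. \<eta> i = (y, z)}" by blast
      \<comment> \<open>\<open>cr\<close> translates a cell of the grid into a residue modulo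
        \<open>q * r\<close>.\<close>
      obtain cr where cr: "\<And>y z. [cr (y, z) = y] (mod q) \<and> [cr (y, z) = z] (mod r)"
      proof -
        have "\<forall>yz. \<exists>x. [x = fst yz] (mod q) \<and> [x = snd yz] (mod r)"
          using binary_chinese_remainder_nat[OF qr] by blast
        then obtain f where "\<forall>yz. [f yz = fst yz] (mod q) \<and> [f yz = snd yz] (mod r)" by metis
        then show ?thesis using that[of f] by simp
      qed
      have crc: "[u = cr (u mod q, u mod r)] (mod q * r)" for u
      proof -
        have "[u = cr (u mod q, u mod r)] (mod q)" "[u = cr (u mod q, u mod r)] (mod r)"
          using cr[of "u mod q" "u mod r"] by (auto simp: cong_def)
        then show ?thesis using qr by (simp add: coprime_cong_mult_nat)
      qed
      define t where "t = (\<lambda>i. if i \<in> cls p q then fb i else if i \<in> cls p r then fc i else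
        if i \<in> D then \<kappa> i else if i \<in> E then \<rho> i else if i \<in> F then cr (\<phi> i) else cr (\<eta> i))"
      have tv: "i \<in> cls p q \<Longrightarrow> t i = fb i" "i \<in> cls p r \<Longrightarrow> t i = fc i" "i \<in> D \<Longrightarrow> t i = \<kappa> i"
        "i \<in> E \<Longrightarrow> t i = \<rho> i" "i \<in> F \<Longrightarrow> t i = cr (\<phi> i)" "i \<in> H \<Longrightarrow> t i = cr (\<eta> i)" for i
        using neq neqs by (auto simp: t_def D_def E_def F_def H_def cls_def)
      have "p \<le> cover_height w d t S u" for u
      proof -
        define y where "y = u mod q"
        define z where "z = u mod r"
        have yz: "y < q" "z < r" using q r by (auto simp: y_def z_def)
        consider "y < b" | "z < c" | "y \<in> Q" "z \<in> R" using yz by (force simp: Q_def R_def)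
        then show ?thesis
        proof cases
          case 1
          then obtain i where i: "i \<in> cls p q" "fb i = u mod q" using hit_b y_def by blast
          then show ?thesis using geI[of i u t] tv(1)[OF i(1)] by (simp add: cls_def cong_def)
        next
          case 2
          then obtain i where i: "i \<in> cls p r" "fc i = u mod r" using hit_c z_def by blast
          then show ?thesis using geI[of i u t] tv(2)[OF i(1)] by (simp add: cls_def cong_def)
        next
          case 3
          from grid[OF this] show ?thesis
          proof
            assume "\<exists>i\<in>F. \<phi> i = (y, z)"
            then obtain i where i: "i \<in> F" "\<phi> i = (y, z)" by blast
            have "[u = t i] (mod d i)" using tv(5)[OF i(1)] i crc[of u] by (simp add: F_def cls_def y_def z_def)
            then show ?thesis using geI[of i u t] i by (simp add: F_def cls_def)
          next
            assume le: "p - a \<le> card {i \<in> D. \<kappa> i = y} + card {i \<in> E. \<rho> i = z} + card {i \<in> H. \<eta> i = (y, z)}"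
            let ?D = "{i \<in> D. \<kappa> i = y}" and ?E = "{i \<in> E. \<rho> i = z}" and ?H = "{i \<in> H. \<eta> i = (y, z)}"
            have fins: "finite ?D" "finite ?E" "finite ?H" using fincls by (auto simp: D_def E_def H_def)
            have c1: "card (?D \<union> ?E) = card ?D + card ?E"
              using fins neq by (intro card_Un_disjoint) (auto simp: D_def E_def cls_def)
            have c2: "card (?D \<union> ?E \<union> ?H) = card (?D \<union> ?E) + card ?H"
              using fins neqs by (intro card_Un_disjoint) (auto simp: D_def E_def H_def cls_def)
            have c3: "card (cls 1 1 \<union> (?D \<union> ?E \<union> ?H)) = a + card (?D \<union> ?E \<union> ?H)"
              unfolding a_def using fins fincls neqs by (intro card_Un_disjoint) (auto simp: D_def E_def H_def cls_def)
            have "card (cls 1 1 \<union> (?D \<union> ?E \<union> ?H)) \<le> cover_height w d t S u"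
            proof (rule card_le)
              show "cls 1 1 \<union> (?D \<union> ?E \<union> ?H) \<subseteq> S" by (auto simp: D_def E_def H_def cls_def)
              fix i assume "i \<in> cls 1 1 \<union> (?D \<union> ?E \<union> ?H)"
              then consider "i \<in> cls 1 1" | "i \<in> ?D" | "i \<in> ?E" | "i \<in> ?H" by blast
              then show "[u = t i] (mod d i)"
              proof cases
                case 1 then show ?thesis by (simp add: cls_def cong_def)
              next
                case 2 then show ?thesis using tv(3)[of i] by (simp add: D_def cls_def y_def cong_def)
              next
                case 3 then show ?thesis using tv(4)[of i] by (simp add: E_def cls_def z_def cong_def)
              next
                case 4 then show ?thesis using tv(6)[of i] crc[of u] by (simp add: H_def cls_def y_def z_def)
              qed
            qed
            then show ?thesis using c1 c2 c3 le by linarith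
          qed
        qed
      qed
      then show ?thesis by blast
    qed
  qed
  then show ?thesis using i0I unfolding S_def by blast
qed

section \<open>Decomposition of finite abelian groups\<close>

context comm_group
begin

lemma subgroup_if_mult_closed:
  assumes fin: "finite (carrier G)" and K: "K \<subseteq> carrier G" "\<one> \<in> K"
    and mult: "\<And>x y. x \<in> K \<Longrightarrow> y \<in> K \<Longrightarrow> x \<otimes> y \<in> K"
  shows "subgroup K G"
proof (rule subgroupI)
  fix x assume x: "x \<in> K"
  then have xc: "x \<in> carrier G" using K by blast
  have pw: "x [^] (n::nat) \<in> K" for n by (induction n) (auto simp: K x mult)
  have "ord x > 0" using fin xc ord_ge_1 by (simp add: Suc_le_eq)
  then have "x [^] (ord x - 1) \<otimes> x = x [^] ord x" by (metis Suc_diff_1 nat_pow_Suc)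
  also have "\<dots> = \<one>" using xc by simp
  finally have "inv x = x [^] (ord x - 1)" using xc inv_equality by (metis nat_pow_closed)
  then show "inv x \<in> K" using pw by simp
qed (use K mult in auto)

lemma pow_mod_ord: "x \<in> carrier G \<Longrightarrow> x [^] (n mod ord x) = x [^] (n::nat)"
proof -
  assume x: "x \<in> carrier G"
  have "x [^] n = x [^] (ord x * (n div ord x) + n mod ord x)" by simp
  also have "\<dots> = (x [^] ord x) [^] (n div ord x) \<otimes> x [^] (n mod ord x)"
    using x by (simp add: nat_pow_mult nat_pow_pow del: pow_ord_eq_1)
  also have "\<dots> = x [^] (n mod ord x)" using x by simp
  finally show ?thesis by simp
qed

text \<open>For a subgroup \<open>L\<close> of a finite group this is the subgroup generated by
  \<open>L\<close> and \<open>g\<close>; natural exponents suffice because \<open>g\<close> has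
  finite order.\<close>

definition cyclic_ext :: "'a set \<Rightarrow> 'a \<Rightarrow> 'a set" where
  "cyclic_ext L g = {l \<otimes> g [^] (n::nat) | l n. l \<in> L}"

lemma cyclic_extE:
  assumes "x \<in> cyclic_ext L g" obtains l and n :: nat where "l \<in> L" "x = l \<otimes> g [^] n"
  using assms unfolding cyclic_ext_def by blast

lemma cyclic_ext_subgroup:
  assumes fin: "finite (carrier G)" and L: "subgroup L G" and g: "g \<in> carrier G"
  shows "subgroup (cyclic_ext L g) G"
proof (rule subgroup_if_mult_closed[OF fin])
  have Lc: "L \<subseteq> carrier G" using L subgroup.subset by blast
  show "cyclic_ext L g \<subseteq> carrier G" using Lc g by (auto simp: cyclic_ext_def)
  have "\<one> = \<one> \<otimes> g [^] (0::nat)" by simp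
  then show "\<one> \<in> cyclic_ext L g" unfolding cyclic_ext_def using subgroup.one_closed[OF L] by blast
  fix x y assume "x \<in> cyclic_ext L g" "y \<in> cyclic_ext L g"
  then obtain l n l' n' where x: "l \<in> L" "x = l \<otimes> g [^] (n::nat)" and y: "l' \<in> L" "y = l' \<otimes> g [^] (n'::nat)"
    by (meson cyclic_extE)
  have "x \<otimes> y = (l \<otimes> l') \<otimes> g [^] (n + n')"
    unfolding x y nat_pow_mult[OF g, symmetric]
    using Lc x(1) y(1) g by (simp add: m_ac subset_iff)
  then show "x \<otimes> y \<in> cyclic_ext L g"
    unfolding cyclic_ext_def using subgroup.m_closed[OF L x(1) y(1)] by blast
qed

lemma subgroup_nat_pow_closed:
  assumes "subgroup L G" "x \<in> L" shows "x [^] (n::nat) \<in> L"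
  using assms by (induction n) (auto simp: subgroup.one_closed subgroup.m_closed)

lemma subset_cyclic_ext:
  assumes "L \<subseteq> carrier G" "g \<in> carrier G" shows "L \<subseteq> cyclic_ext L g"
proof
  fix x assume "x \<in> L"
  then have "x = x \<otimes> g [^] (0::nat)" using assms by auto
  then show "x \<in> cyclic_ext L g" unfolding cyclic_ext_def using \<open>x \<in> L\<close> by blast
qed

lemma gen_in_cyclic_ext:
  assumes "subgroup L G" "g \<in> carrier G" shows "g [^] (n::nat) \<in> cyclic_ext L g"
proof -
  have "g [^] n = \<one> \<otimes> g [^] n" using assms by simp
  then show ?thesis unfolding cyclic_ext_def using subgroup.one_closed[OF assms(1)] by blast
qed

text \<open>\<open>L\<close> is taken of maximal size among the subgroups of \<open>K\<close> that
  meet the powers of \<open>g\<close> trivially. If \<open>L\<close> and \<open>g\<close> did not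
  generate \<open>K\<close>, some \<open>y\<close> outside their span would have
  \<open>y [^] l\<close> in \<open>L\<close> for a prime \<open>l\<close>, and adjoining
  \<open>y\<close> would give a larger such subgroup. Maximality of the order of \<open>g\<close>
  enters in the case \<open>l = p\<close>.\<close>

lemma cyclic_complement:
  assumes fin: "finite (carrier G)" and K: "subgroup K G" and gK: "g \<in> K"
    and p: "prime p" and og: "ord g = p ^ m" and m: "m > 0"
    and mx: "\<And>x. x \<in> K \<Longrightarrow> \<not> p ^ Suc m dvd ord x"
  shows "\<exists>L. subgroup L G \<and> L \<subseteq> K \<and> (\<forall>n::nat. g [^] n \<in> L \<longrightarrow> g [^] n = \<one>) \<and> K = cyclic_ext L g"
proof -
  have Kc: "K \<subseteq> carrier G" using K subgroup.subset by blast
  have g: "g \<in> carrier G" using gK Kc by blast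
  define LL where "LL = {L. subgroup L G \<and> L \<subseteq> K \<and> (\<forall>n::nat. g [^] n \<in> L \<longrightarrow> g [^] n = \<one>)}"
  have "subgroup {\<one>} G" by (rule triv_subgroup)
  then have "{\<one>} \<in> LL" using subgroup.one_closed[OF K] by (auto simp: LL_def)
  moreover have finLL: "finite LL"
    by (rule finite_subset[of _ "Pow K"]) (use fin Kc finite_subset in \<open>auto simp: LL_def\<close>)
  ultimately have "Max (card ` LL) \<in> card ` LL" by (intro Max_in) auto
  then obtain L where LLL: "L \<in> LL" and Lmax: "card L = Max (card ` LL)" by auto
  then have L: "subgroup L G" "L \<subseteq> K" and triv: "\<And>n::nat. g [^] n \<in> L \<Longrightarrow> g [^] n = \<one>" by (auto simp: LL_def)
  have Lc: "L \<subseteq> carrier G" using L Kc by blast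
  define M where "M = cyclic_ext L g"
  have M: "subgroup M G" unfolding M_def by (rule cyclic_ext_subgroup[OF fin L(1) g])
  have "M \<subseteq> K"
  proof
    fix x assume "x \<in> M"
    then obtain l n where "l \<in> L" "x = l \<otimes> g [^] (n::nat)" unfolding M_def by (rule cyclic_extE)
    then show "x \<in> K" using L K gK subgroup_nat_pow_closed[OF K gK] subgroup.m_closed[OF K] by auto
  qed
  moreover have "K \<subseteq> M"
  proof (rule ccontr)
    assume "\<not> K \<subseteq> M"
    then obtain x0 where x0: "x0 \<in> K" "x0 \<notin> M" by blast
    then have x0c: "x0 \<in> carrier G" using Kc by blast
    \<comment> \<open>Dividing the least exponent that carries \<open>x0\<close> into
      \<open>M\<close> by one of its primes \<open>l\<close> yields an \<open>x\<close> outside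
      \<open>M\<close> whose \<open>l\<close>-th power is inside.\<close>
    have "\<exists>t::nat. t > 0 \<and> x0 [^] t \<in> M"
      using x0c fin ord_ge_1[OF fin x0c] subgroup.one_closed[OF M] by (intro exI[of _ "ord x0"]) auto
    then obtain t :: nat where t: "t > 0" "x0 [^] t \<in> M" "\<And>t'::nat. t' > 0 \<Longrightarrow> x0 [^] t' \<in> M \<Longrightarrow> t \<le> t'"
      using exists_least_iff[of "\<lambda>t::nat. t > 0 \<and> x0 [^] t \<in> M"] by (metis not_le)
    have "t \<noteq> 1" using t x0 x0c by (metis nat_pow_eone)
    then obtain l where l: "prime l" "l dvd t" using prime_factor_nat by blast
    define x where "x = x0 [^] (t div l)"
    have l1: "l > 1" using l prime_gt_1_nat by blast
    have xK: "x \<in> K" unfolding x_def by (rule subgroup_nat_pow_closed[OF K x0(1)])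
    have xc: "x \<in> carrier G" using xK Kc by blast
    have "0 < t div l" "t div l < t" using l l1 t(1) by (auto simp: dvd_div_eq_0_iff)
    then have xM: "x \<notin> M" using t(3)[of "t div l"] by (auto simp: x_def)
    have "x [^] l = x0 [^] t" using l x0c by (simp add: x_def nat_pow_pow)
    then have "x [^] l \<in> M" using t by simp
    then obtain u c where u: "u \<in> L" and xu: "x [^] l = u \<otimes> g [^] (c::nat)" unfolding M_def by (rule cyclic_extE)
    have uc: "u \<in> carrier G" using u Lc by blast
    \<comment> \<open>The cyclic part of \<open>x [^] l\<close> must be an \<open>l\<close>-th power
      so that it can be divided out of \<open>x\<close>. For \<open>l\<close> other than
      \<open>p\<close>, \<open>l\<close> is invertible modulo \<open>p ^ m\<close>. For
      \<open>l = p\<close>, a \<open>c\<close> prime to \<open>p\<close> would give the order of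
      \<open>x\<close> a higher power of \<open>p\<close> than \<open>p ^ m\<close>.\<close>
    have "\<exists>c'. g [^] c = g [^] (l * c' :: nat)"
    proof (cases "l = p")
      case False
      then have "coprime l (p ^ m)" using l p by (simp add: primes_coprime)
      then obtain v where "[l * v = 1] (mod p ^ m)" using cong_solve_coprime_nat by (metis One_nat_def)
      from cong_scalar_right[OF this, of c] have "l * (v * c) mod ord g = c mod ord g"
        by (simp add: cong_def og mult.assoc)
      then have "g [^] c = g [^] (l * (v * c))"
        using pow_mod_ord[OF g] by metis
      then show ?thesis by blast
    next
      case True
      define s where "s = ord x div p ^ multiplicity p (ord x)"
      have ox: "ord x > 0" using ord_ge_1[OF fin xc] by simp
      have oxs: "ord x = p ^ multiplicity p (ord x) * s" unfolding s_def by (simp add: multiplicity_dvd)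
      have ps: "\<not> p dvd s"
        unfolding s_def using p ox by (metis multiplicity_decompose not_prime_unit not_gr_zero)
      have "multiplicity p (ord x) \<le> m"
        using mx[OF xK] ox p by (metis multiplicity_dvd' not_less_eq_eq)
      then have "ord x dvd p ^ m * s" by (subst oxs) (simp add: le_imp_power_dvd mult_dvd_mono)
      moreover obtain m' where m': "m = Suc m'" using m by (cases m) auto
      ultimately have "ord x dvd l * (p ^ m' * s)" using True by (simp add: mult.assoc)
      then have "x [^] (l * (p ^ m' * s)) = \<one>" using pow_eq_id[OF xc] by blast
      then have "(u \<otimes> g [^] c) [^] (p ^ m' * s) = \<one>" unfolding xu[symmetric] using xc by (simp add: nat_pow_pow)
      then have "u [^] (p ^ m' * s) \<otimes> g [^] (c * (p ^ m' * s)) = \<one>"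
        using uc g by (simp add: nat_pow_distrib nat_pow_pow)
      then have "g [^] (c * (p ^ m' * s)) = inv (u [^] (p ^ m' * s))"
        using uc g by (metis inv_equality inv_inv nat_pow_closed m_comm)
      moreover have "inv (u [^] (p ^ m' * s)) \<in> L"
        using subgroup_nat_pow_closed[OF L(1) u] subgroup.m_inv_closed[OF L(1)] by blast
      ultimately have "g [^] (c * (p ^ m' * s)) = \<one>" using triv by metis
      then have "p ^ m dvd c * (p ^ m' * s)" using pow_eq_id[OF g] og by metis
      then have "p ^ m' * p dvd p ^ m' * (c * s)" by (simp add: m' mult_ac)
      then have "p dvd c * s" using p by (simp add: prime_gt_0_nat)
      then have "p dvd c" using ps p by (simp add: prime_dvd_mult_iff)
      then show ?thesis using True by (metis dvdE)
    qed
    then obtain c' where c': "g [^] c = g [^] (l * c')" by blast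
    define y where "y = x \<otimes> inv (g [^] c')"
    have yc: "y \<in> carrier G" using xc g by (simp add: y_def)
    have "y [^] l = x [^] l \<otimes> inv (g [^] (l * c'))"
      unfolding y_def using xc g by (simp add: nat_pow_distrib nat_pow_inv nat_pow_pow mult.commute)
    also have "\<dots> = u" unfolding xu c' using uc g by (simp add: m_assoc)
    finally have yl: "y [^] l = u" .
    have yK: "y \<in> K"
      unfolding y_def using subgroup.m_closed[OF K xK] subgroup.m_inv_closed[OF K] subgroup_nat_pow_closed[OF K gK] by blast
    have gM: "g [^] (n::nat) \<in> M" for n unfolding M_def by (rule gen_in_cyclic_ext[OF L(1) g])
    have yM: "y \<notin> M"
    proof
      assume "y \<in> M"
      then have "y \<otimes> g [^] c' \<in> M" using gM subgroup.m_closed[OF M] by blast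
      moreover have "y \<otimes> g [^] c' = x" using xc g by (simp add: y_def m_assoc)
      ultimately show False using xM by simp
    qed
    have LM: "L \<subseteq> M" unfolding M_def by (rule subset_cyclic_ext[OF Lc g])
    define L' where "L' = cyclic_ext L y"
    have L': "subgroup L' G" unfolding L'_def by (rule cyclic_ext_subgroup[OF fin L(1) yc])
    have "L' \<in> LL"
    proof -
      have "L' \<subseteq> K"
      proof
        fix z assume "z \<in> L'"
        then obtain v n where "v \<in> L" "z = v \<otimes> y [^] (n::nat)" unfolding L'_def by (rule cyclic_extE)
        then show "z \<in> K" using L subgroup_nat_pow_closed[OF K yK] subgroup.m_closed[OF K] by auto
      qed
      \<comment> \<open>If \<open>l\<close> divides the exponent \<open>k\<close> of
        \<open>y\<close>, that power of \<open>y\<close> is in \<open>L\<close>; otherwise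
        \<open>k\<close> is invertible modulo \<open>l\<close> and \<open>y\<close> itself would
        fall into \<open>M\<close>.\<close>
      moreover have "g [^] n = \<one>" if n: "g [^] n \<in> L'" for n :: nat
      proof -
        from n obtain v k where v: "v \<in> L" and gv: "g [^] n = v \<otimes> y [^] (k::nat)" unfolding L'_def by (rule cyclic_extE)
        have vc: "v \<in> carrier G" using v Lc by blast
        show ?thesis
        proof (cases "l dvd k")
          case True
          then obtain k' where "k = l * k'" by blast
          then have "y [^] k = u [^] k'" using yl yc by (metis nat_pow_pow)
          then have "y [^] k \<in> L" using subgroup_nat_pow_closed[OF L(1) u] by simp
          then have "g [^] n \<in> L" unfolding gv using v subgroup.m_closed[OF L(1)] by blast
          then show ?thesis by (rule triv)
        next
          case False
          then have "coprime k l" using l by (metis coprime_commute prime_imp_coprime)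
          then obtain k' where k': "[k * k' = 1] (mod l)" using cong_solve_coprime_nat by (metis One_nat_def)
          have "y [^] k = inv v \<otimes> g [^] n" unfolding gv using vc yc by (simp add: m_assoc[symmetric])
          then have "y [^] k \<in> M"
            using gM subgroup.m_closed[OF M] subgroup.m_inv_closed[OF M] v LM by auto
          then have A: "y [^] (k * k') \<in> M"
            using subgroup_nat_pow_closed[OF M] yc by (metis nat_pow_pow)
          have yl': "y [^] (l * j) \<in> M" for j :: nat
            using subgroup_nat_pow_closed[OF L(1) u, of j] yl yc LM by (metis nat_pow_pow subsetD)
          have "k * k' mod l = 1" using k' l1 by (simp add: cong_def)
          then have "k * k' = l * (k * k' div l) + 1" by (metis mult_div_mod_eq)
          then have "y [^] (k * k') = y [^] (l * (k * k' div l)) \<otimes> y"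
            using yc by (metis nat_pow_mult nat_pow_eone)
          then have "y = inv (y [^] (l * (k * k' div l))) \<otimes> y [^] (k * k')"
            using yc by (simp add: m_assoc[symmetric])
          then have "y \<in> M" using A yl' subgroup.m_closed[OF M] subgroup.m_inv_closed[OF M] by metis
          then show ?thesis using yM by blast
        qed
      qed
      ultimately show ?thesis using L' by (auto simp: LL_def)
    qed
    moreover have "L \<subset> L'"
    proof -
      have "L \<subseteq> L'" unfolding L'_def by (rule subset_cyclic_ext[OF Lc yc])
      moreover have "y \<in> L'" unfolding L'_def using gen_in_cyclic_ext[OF L(1) yc, of 1] yc by simp
      ultimately show ?thesis using yM LM by blast
    qed
    then have "card L < card L'"
      using fin subgroup.subset[OF L'] by (meson finite_subset psubset_card_mono)
    ultimately show False using Lmax finLL by (metis Max_ge finite_imageI imageI not_le)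
  qed
  ultimately show ?thesis using L triv unfolding M_def by blast
qed

definition prime_power_basis :: "'a set \<Rightarrow> 'a list \<Rightarrow> bool" where
  "prime_power_basis K bs \<longleftrightarrow> set bs \<subseteq> K \<and> (\<forall>b\<in>set bs. primepow (ord b)) \<and>
     (\<forall>x\<in>K. \<exists>c. x = (\<Otimes>i\<in>{..<length bs}. (bs ! i) [^] (c i :: nat))) \<and>
     (\<forall>c. (\<Otimes>i\<in>{..<length bs}. (bs ! i) [^] (c i :: nat)) = \<one> \<longrightarrow> (\<forall>i<length bs. ord (bs ! i) dvd c i))"

text \<open>Induction on the size of \<open>K\<close>: for a prime \<open>p\<close> dividing some
  order, a cyclic factor of largest p-power order is split off, and the complement is
  smaller.\<close>

lemma ex_prime_power_basis:
  assumes fin: "finite (carrier G)" and "subgroup K G"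
  shows "\<exists>bs. prime_power_basis K bs"
  using assms(2)
proof (induction "card K" arbitrary: K rule: less_induct)
  case less
  then have K: "subgroup K G" by simp
  have Kc: "K \<subseteq> carrier G" using K subgroup.subset by blast
  have Kf: "finite K" using Kc fin finite_subset by blast
  show ?case
  proof (cases "K = {\<one>}")
    case True
    then have "prime_power_basis K []" by (auto simp: prime_power_basis_def)
    then show ?thesis by blast
  next
    case False
    then obtain z where z: "z \<in> K" "z \<noteq> \<one>" using subgroup.one_closed[OF K] by blast
    then have "ord z \<noteq> 1" using ord_eq_1 Kc by blast
    then obtain p where p: "prime p" "p dvd ord z" using prime_factor_nat by blast
    have opos: "ord x > 0" if "x \<in> K" for x using ord_ge_1[OF fin] that Kc by force
    define mm where "mm = (\<lambda>x. multiplicity p (ord x))"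
    have "Max (mm ` K) \<in> mm ` K" using Kf z by (intro Max_in) auto
    then obtain x0 where x0: "x0 \<in> K" "mm x0 = Max (mm ` K)" by auto
    define m where "m = mm x0"
    have mge: "mm x \<le> m" if "x \<in> K" for x unfolding m_def x0(2) using Kf that by (intro Max_ge) auto
    have "mm z \<ge> 1" unfolding mm_def using p opos[OF z(1)] by (metis One_nat_def Suc_leI not_gr_zero multiplicity_eq_zero_iff not_prime_unit)
    then have m0: "m > 0" using mge[OF z(1)] by simp
    have x0c: "x0 \<in> carrier G" using x0 Kc by blast
    define s where "s = ord x0 div p ^ m"
    have os: "ord x0 = p ^ m * s" unfolding s_def m_def mm_def by (simp add: multiplicity_dvd)
    have s0: "s \<noteq> 0" using os opos[OF x0(1)] by (metis mult_0_right not_gr_zero)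
    \<comment> \<open>Raising to \<open>s\<close>, the part of the order prime to \<open>p\<close>,
      leaves an element of order exactly \<open>p ^ m\<close>.\<close>
    define g where "g = x0 [^] s"
    have gK: "g \<in> K" unfolding g_def by (rule subgroup_nat_pow_closed[OF K x0(1)])
    have g: "g \<in> carrier G" using gK Kc by blast
    have og: "ord g = p ^ m" unfolding g_def using ord_pow[OF x0c, of s] os s0 by simp
    have mx: "\<not> p ^ Suc m dvd ord x" if "x \<in> K" for x
    proof
      assume "p ^ Suc m dvd ord x"
      then have "Suc m \<le> mm x" unfolding mm_def using opos[OF that] p by (intro multiplicity_geI) auto
      then show False using mge[OF that] by simp
    qed
    obtain L where L: "subgroup L G" "L \<subseteq> K" and triv: "\<And>n::nat. g [^] n \<in> L \<Longrightarrow> g [^] n = \<one>"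
      and KL: "K = cyclic_ext L g"
      using cyclic_complement[OF fin K gK p(1) og m0 mx] by blast
    have Lc: "L \<subseteq> carrier G" using L Kc by blast
    have "g \<noteq> \<one>" using og m0 p ord_id by (metis nat_power_eq_Suc_0_iff not_prime_1 One_nat_def neq0_conv)
    then have "g \<notin> L" using triv[of 1] g by auto
    then have "card L < card K" using L gK Kf by (metis psubsetI psubset_card_mono)
    from less.hyps[OF this L(1)] obtain bs where bs: "prime_power_basis L bs" by blast
    let ?n = "length bs"
    have bsL: "set bs \<subseteq> L" and bsp: "\<And>b. b \<in> set bs \<Longrightarrow> primepow (ord b)"
      and gen: "\<And>x. x \<in> L \<Longrightarrow> \<exists>c. x = (\<Otimes>i\<in>{..<?n}. (bs ! i) [^] (c i :: nat))"
      and ind: "\<And>c i. (\<Otimes>i\<in>{..<?n}. (bs ! i) [^] (c i :: nat)) = \<one> \<Longrightarrow> i < ?n \<Longrightarrow> ord (bs ! i) dvd c i"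
      using bs unfolding prime_power_basis_def by blast+
    have bsi: "bs ! i \<in> L" if "i < ?n" for i using bsL that nth_mem by blast
    have bsic: "bs ! i \<in> carrier G" if "i < ?n" for i using bsi[OF that] Lc by blast
    have fpL: "(\<Otimes>i\<in>{..<k}. (bs ! i) [^] (c i :: nat)) \<in> L" if "k \<le> ?n" for c k
      using that
    proof (induction k)
      case (Suc k)
      then have "(\<Otimes>i\<in>{..<Suc k}. (bs ! i) [^] (c i :: nat)) = (bs ! k) [^] c k \<otimes> (\<Otimes>i\<in>{..<k}. (bs ! i) [^] (c i :: nat))"
        unfolding lessThan_Suc by (subst finprod_insert) (use bsic in auto)
      then show ?case using Suc subgroup.m_closed[OF L(1)] subgroup_nat_pow_closed[OF L(1) bsi] by simp
    qed (simp add: subgroup.one_closed[OF L(1)])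
    have step: "(\<Otimes>i\<in>{..<length (bs @ [g])}. ((bs @ [g]) ! i) [^] (c i :: nat))
        = g [^] c ?n \<otimes> (\<Otimes>i\<in>{..<?n}. (bs ! i) [^] (c i :: nat))" for c
    proof -
      have "(\<Otimes>i\<in>{..<length (bs @ [g])}. ((bs @ [g]) ! i) [^] (c i :: nat))
        = g [^] c ?n \<otimes> (\<Otimes>i\<in>{..<?n}. ((bs @ [g]) ! i) [^] (c i :: nat))"
        by (simp add: lessThan_Suc, subst finprod_insert) (use bsic g in \<open>auto simp: nth_append\<close>)
      also have "(\<Otimes>i\<in>{..<?n}. ((bs @ [g]) ! i) [^] (c i :: nat)) = (\<Otimes>i\<in>{..<?n}. (bs ! i) [^] (c i :: nat))"
        by (rule finprod_cong') (use bsic in \<open>auto simp: nth_append\<close>)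
      finally show ?thesis .
    qed
    have "prime_power_basis K (bs @ [g])"
      unfolding prime_power_basis_def
    proof (intro conjI ballI allI impI)
      show "set (bs @ [g]) \<subseteq> K" using bsL L gK by auto
      show "primepow (ord b)" if "b \<in> set (bs @ [g])" for b
        using that bsp og p m0 by (auto simp: primepow_prime_power)
      show "\<exists>c. x = (\<Otimes>i\<in>{..<length (bs @ [g])}. ((bs @ [g]) ! i) [^] (c i :: nat))" if x: "x \<in> K" for x
      proof -
        from x obtain l n where l: "l \<in> L" "x = l \<otimes> g [^] (n::nat)" unfolding KL by (rule cyclic_extE)
        from gen[OF l(1)] obtain c where c: "l = (\<Otimes>i\<in>{..<?n}. (bs ! i) [^] (c i :: nat))" by blast
        have "(\<Otimes>i\<in>{..<?n}. (bs ! i) [^] ((c(?n := n)) i)) = l"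
          unfolding c by (rule finprod_cong') (use bsic in auto)
        then have "x = (\<Otimes>i\<in>{..<length (bs @ [g])}. ((bs @ [g]) ! i) [^] ((c(?n := n)) i :: nat))"
          unfolding step l(2) using l(1) Lc g by (simp add: m_comm subset_iff)
        then show ?thesis by blast
      qed
      fix c :: "nat \<Rightarrow> nat" and i
      assume eq: "(\<Otimes>i\<in>{..<length (bs @ [g])}. ((bs @ [g]) ! i) [^] (c i :: nat)) = \<one>" and i: "i < length (bs @ [g])"
      let ?l = "\<Otimes>i\<in>{..<?n}. (bs ! i) [^] (c i :: nat)"
      have l: "?l \<in> L" by (rule fpL) simp
      have e: "g [^] c ?n \<otimes> ?l = \<one>" using eq unfolding step .
      then have "g [^] c ?n = inv ?l" using l Lc g by (metis inv_equality nat_pow_closed subsetD inv_inv m_comm)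
      then have g1: "g [^] c ?n = \<one>" using triv l subgroup.m_inv_closed[OF L(1)] by metis
      then have "?l = \<one>" using e l Lc by (metis l_one subsetD)
      then show "ord ((bs @ [g]) ! i) dvd c i"
        using ind[of c i] i g1 pow_eq_id[OF g] by (cases "i < ?n") (auto simp: nth_append less_Suc_eq)
    qed
    then show ?thesis by blast
  qed
qed

text \<open>Existence gives meaning to the choice operator in \<open>k_star\<close>.\<close>

theorem ex_prime_power_decomposition:
  assumes fin: "finite (carrier G)"
  shows "\<exists>ns. prime_power_decomposition G ns"
proof -
  obtain bs where bs: "prime_power_basis (carrier G) bs"
    using ex_prime_power_basis[OF fin subgroup_self] by blast
  let ?n = "length bs"
  define ns where "ns = map ord bs"
  have bsL: "set bs \<subseteq> carrier G" and bsp: "\<And>b. b \<in> set bs \<Longrightarrow> primepow (ord b)"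
    and gen: "\<And>x. x \<in> carrier G \<Longrightarrow> \<exists>c. x = (\<Otimes>i\<in>{..<?n}. (bs ! i) [^] (c i :: nat))"
    and ind: "\<And>c i. (\<Otimes>i\<in>{..<?n}. (bs ! i) [^] (c i :: nat)) = \<one> \<Longrightarrow> i < ?n \<Longrightarrow> ord (bs ! i) dvd c i"
    using bs unfolding prime_power_basis_def by blast+
  have bsc: "bs ! i \<in> carrier G" if "i < ?n" for i using bsL that nth_mem by blast
  have opos: "ord (bs ! i) > 0" if "i < ?n" for i using ord_ge_1[OF fin bsc[OF that]] by simp
  let ?P = "product_group {..<?n} (\<lambda>i. integer_mod_group (ns ! i))"
  have nsi: "ns ! i = ord (bs ! i)" if "i < ?n" for i using that by (simp add: ns_def)
  have carr: "f i \<in> {0..<int (ord (bs ! i))}" if "f \<in> carrier ?P" "i < ?n" for f i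
  proof -
    have "f i \<in> carrier (integer_mod_group (ns ! i))" using that by auto
    then show ?thesis using opos[OF that(2)] that by (simp add: nsi carrier_integer_mod_group)
  qed
  define h where "h = (\<lambda>f. \<Otimes>i\<in>{..<?n}. (bs ! i) [^] nat (f i))"
  have hom: "h \<in> hom ?P G"
  proof (rule homI)
    fix f assume "f \<in> carrier ?P"
    show "h f \<in> carrier G" unfolding h_def by (rule finprod_closed) (use bsc in auto)
  next
    fix f f' assume f: "f \<in> carrier ?P" "f' \<in> carrier ?P"
    have "h (f \<otimes>\<^bsub>?P\<^esub> f') = (\<Otimes>i\<in>{..<?n}. (bs ! i) [^] nat (f i) \<otimes> (bs ! i) [^] nat (f' i))"
      unfolding h_def
    proof (rule finprod_cong')
      fix i assume "i \<in> {..<?n}"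
      then have i: "i < ?n" by simp
      have "(f \<otimes>\<^bsub>?P\<^esub> f') i = (f i + f' i) mod int (ord (bs ! i))" using i by (simp add: nsi)
      then have "nat ((f \<otimes>\<^bsub>?P\<^esub> f') i) = (nat (f i) + nat (f' i)) mod ord (bs ! i)"
        using carr[OF f(1) i] carr[OF f(2) i] by (simp add: nat_mod_distrib nat_add_distrib)
      then show "(bs ! i) [^] nat ((f \<otimes>\<^bsub>?P\<^esub> f') i) = (bs ! i) [^] nat (f i) \<otimes> (bs ! i) [^] nat (f' i)"
        using bsc[OF i] by (metis nat_pow_mult pow_mod_ord)
    qed (use bsc in auto)
    also have "\<dots> = h f \<otimes> h f'" unfolding h_def by (rule finprod_multf) (use bsc in auto)
    finally show "h (f \<otimes>\<^bsub>?P\<^esub> f') = h f \<otimes> h f'" .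
  qed
  have grpP: "group ?P" by simp
  interpret hh: group_hom ?P G h
    by (simp add: group_hom_def group_hom_axioms_def hom is_group)
  have inj: "inj_on h (carrier ?P)"
  proof (subst hh.inj_on_one_iff, intro ballI impI allI)
    fix f assume f: "f \<in> carrier ?P" "h f = \<one>"
    have "f i = 0" if i: "i < ?n" for i
    proof -
      have "ord (bs ! i) dvd nat (f i)" using ind[of "\<lambda>i. nat (f i)" i] f i by (simp add: h_def)
      moreover have "nat (f i) < ord (bs ! i)" using carr[OF f(1) i] opos[OF i] by auto
      ultimately have "nat (f i) = 0" using nat_dvd_not_less by blast
      then show ?thesis using carr[OF f(1) i] by auto
    qed
    then show "f = \<one>\<^bsub>?P\<^esub>" using f(1) by (auto simp: fun_eq_iff PiE_def extensional_def)
  qed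
  have surj: "h ` carrier ?P = carrier G"
  proof
    show "h ` carrier ?P \<subseteq> carrier G" using hom by (auto simp: hom_def)
    show "carrier G \<subseteq> h ` carrier ?P"
    proof
      fix x assume "x \<in> carrier G"
      then obtain c where c: "x = (\<Otimes>i\<in>{..<?n}. (bs ! i) [^] (c i :: nat))" using gen by blast
      define f where "f = (\<lambda>i\<in>{..<?n}. int (c i mod ord (bs ! i)))"
      have "f \<in> carrier ?P" using opos by (auto simp: f_def carrier_integer_mod_group nsi)
      moreover have "h f = x"
        unfolding h_def c by (rule finprod_cong') (use bsc in \<open>auto simp: f_def pow_mod_ord\<close>)
      ultimately show "x \<in> h ` carrier ?P" by blast
    qed
  qed
  have "h \<in> iso ?P G" using hom inj surj by (simp add: iso_iff)
  then have "?P \<cong> G" by (rule is_isoI)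
  then have "G \<cong> ?P" by (rule group.iso_sym[OF grpP])
  then show ?thesis unfolding prime_power_decomposition_def using bsp by (intro exI[of _ ns]) (auto simp: ns_def)
qed

end

section \<open>Minimal zero-sum sequences\<close>

text \<open>Since \<open>d i\<close> annihilates \<open>y i\<close> modulo \<open>n\<close>, the
  index \<open>c\<close> satisfies the character condition for \<open>i\<close> as soon as it is
  congruent to \<open>t i\<close> modulo \<open>d i\<close>. This turns character conditions into
  residue classes that can be placed freely.\<close>

lemma weighted_cover_zero_subsum:
  fixes x :: "'i \<Rightarrow> nat \<Rightarrow> nat"
  assumes p: "prime p" and J: "finite J" and I: "finite I"
    and a: "\<And>j. j \<in> J \<Longrightarrow> a j \<le> e" and m: "\<And>i. i \<in> I \<Longrightarrow> m i \<le> e"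
    and dv: "\<And>i j. i \<in> I \<Longrightarrow> j \<in> J \<Longrightarrow> p ^ a j dvd p ^ m i * x i j"
    and n: "n > 0" and pn: "\<not> p dvd n" and d: "\<And>i. i \<in> I \<Longrightarrow> n dvd d i * y i"
    and big: "\<And>c. (\<Sum>j\<in>J. p ^ e - p ^ (e - a j)) < cover_height (\<lambda>i. p ^ (e - m i)) d t I c"
  shows "\<exists>T. T \<subseteq> I \<and> T \<noteq> {} \<and> (\<forall>j\<in>J. p ^ a j dvd (\<Sum>i\<in>T. x i j)) \<and> n dvd (\<Sum>i\<in>T. y i)"
proof (rule zero_subsum_of_character_cover[OF p J I a m dv n pn])
  fix c :: nat assume "c < n"
  have impl: "[c * y i = t i * y i] (mod n)" if "i \<in> I" "[c = t i] (mod d i)" for i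
  proof -
    have "int (d i) dvd int c - int (t i)"
      using that(2) by (metis cong_iff_dvd_diff cong_int_iff)
    then have "int (d i) * int (y i) dvd (int c - int (t i)) * int (y i)" by simp
    moreover have "int n dvd int (d i) * int (y i)" using d[OF that(1)] by (metis int_dvd_int_iff of_nat_mult)
    ultimately have "int n dvd int (c * y i) - int (t i * y i)"
      by (metis dvd_trans left_diff_distrib of_nat_mult)
    then show ?thesis by (metis cong_iff_dvd_diff cong_int_iff)
  qed
  have "cover_height (\<lambda>i. p ^ (e - m i)) d t I c = (\<Sum>i | i \<in> I \<and> [c = t i] (mod d i). p ^ (e - m i))"
    unfolding cover_height_def using I by (subst sum.inter_filter[symmetric]) auto
  also have "\<dots> \<le> (\<Sum>i | i \<in> I \<and> [c * y i = t i * y i] (mod n). p ^ (e - m i))"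
    using I impl by (intro sum_mono2) auto
  finally show "(\<Sum>j\<in>J. p ^ e - p ^ (e - a j)) < (\<Sum>i | i \<in> I \<and> [c * y i = t i * y i] (mod n). p ^ (e - m i))"
    using big[of c] by linarith
qed

text \<open>
  If the orders in a minimal zero-sum sequence are at most \<open>p^s < p^e\<close>, replacing a
  term of order \<open>p^s\<close> by \<open>p^(e - s) - 1\<close> copies of a basis element of order \<open>p^e\<close> leaves it
  zero-sum free.
\<close>

lemma p_group_minimal_bound:
  fixes x :: "'i \<Rightarrow> nat \<Rightarrow> nat"
  assumes p: "prime p" and J: "finite J" and I: "finite I" "I \<noteq> {}"
    and a: "\<And>j. j \<in> J \<Longrightarrow> a j \<le> e" and j0: "j0 \<in> J" "a j0 = e" and m: "\<And>i. i \<in> I \<Longrightarrow> m i \<le> e"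
    and dv: "\<And>i j. i \<in> I \<Longrightarrow> j \<in> J \<Longrightarrow> p ^ a j dvd p ^ m i * x i j"
    and free: "\<And>T. T \<subset> I \<Longrightarrow> \<forall>j\<in>J. p ^ a j dvd (\<Sum>i\<in>T. x i j) \<Longrightarrow> T = {}"
  shows "(\<Sum>i\<in>I. p ^ (e - m i)) \<le> (\<Sum>j\<in>J. p ^ e - p ^ (e - a j)) + 1"
proof (rule ccontr)
  assume neg: "\<not> ?thesis"
  have p0: "p > 0" using p prime_gt_0_nat by blast
  have "Max (m ` I) \<in> m ` I" using I by (intro Max_in) auto
  then obtain i0 where i0: "i0 \<in> I" "m i0 = Max (m ` I)" by auto
  have mle: "m i \<le> m i0" if "i \<in> I" for i unfolding i0(2) using I that by (intro Max_ge) auto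
  define s where "s = m i0"
  \<comment> \<open>Each copy weighs 1, so the copies weigh one less than the removed term
    \<open>i0\<close>; this is the \<open>+ 1\<close> in the bound. For \<open>s = e\<close> there
    are no copies.\<close>
  define K where "K = {..<p ^ (e - s) - 1}"
  define I' where "I' = Inl ` (I - {i0}) \<union> Inr ` K"
  define m' where "m' = case_sum m (\<lambda>_::nat. e)"
  define x' where "x' = case_sum x (\<lambda>(_::nat) j. if j = j0 then 1 else 0)"
  have se: "s \<le> e" unfolding s_def by (rule m[OF i0(1)])
  have sumI': "(\<Sum>i\<in>I'. f i) = (\<Sum>i\<in>I - {i0}. f (Inl i)) + (\<Sum>i\<in>K. f (Inr i))" for f :: "'i + nat \<Rightarrow> nat"
    unfolding I'_def using I by (subst sum.union_disjoint) (auto simp: sum.reindex K_def)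
  have "(\<Sum>i\<in>I'. p ^ (e - m' i)) = (\<Sum>i\<in>I - {i0}. p ^ (e - m i)) + (p ^ (e - s) - 1)"
    unfolding sumI' by (simp add: m'_def K_def)
  moreover have "(\<Sum>i\<in>I. p ^ (e - m i)) = p ^ (e - s) + (\<Sum>i\<in>I - {i0}. p ^ (e - m i))"
    using I i0 by (simp add: sum.remove s_def)
  moreover have "p ^ (e - s) \<ge> 1" using p0 by simp
  ultimately have big: "(\<Sum>j\<in>J. p ^ e - p ^ (e - a j)) < (\<Sum>i\<in>I'. p ^ (e - m' i))" using neg by linarith
  have "int p dvd (\<Sum>T | T \<subseteq> I' \<and> (\<forall>j\<in>J. [(\<Sum>i\<in>T. x' i j) = 0] (mod p ^ a j)). (-1) ^ card T)"
  proof (rule signed_subsum_count_dvd[OF p J _ a _ _ big])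
    show "finite I'" using I by (simp add: I'_def K_def)
    show "m' i \<le> e" if "i \<in> I'" for i using that m by (auto simp: I'_def m'_def)
    show "p ^ a j dvd p ^ m' i * x' i j" if "i \<in> I'" "j \<in> J" for i j
      using that dv a by (auto simp: I'_def m'_def x'_def le_imp_power_dvd)
  qed
  \<comment> \<open>Only the empty subset sums to zero, so the signed count is 1.\<close>
  moreover have "{T. T \<subseteq> I' \<and> (\<forall>j\<in>J. [(\<Sum>i\<in>T. x' i j) = 0] (mod p ^ a j))} = {{}}"
  proof (intro equalityI subsetI)
    fix T assume "T \<in> {T. T \<subseteq> I' \<and> (\<forall>j\<in>J. [(\<Sum>i\<in>T. x' i j) = 0] (mod p ^ a j))}"
    then have T: "T \<subseteq> I'" and Tz: "\<And>j. j \<in> J \<Longrightarrow> p ^ a j dvd (\<Sum>i\<in>T. x' i j)" by (auto simp: cong_0_iff)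
    define T1 where "T1 = {i. Inl i \<in> T}"
    define T2 where "T2 = {i. Inr i \<in> T}"
    have TT: "T = Inl ` T1 \<union> Inr ` T2" using T by (auto simp: T1_def T2_def I'_def)
    have T1: "T1 \<subseteq> I - {i0}" and T2: "T2 \<subseteq> K" using T by (auto simp: T1_def T2_def I'_def)
    have fin: "finite T1" "finite T2" using finite_subset[OF T1] finite_subset[OF T2] I by (auto simp: K_def)
    have sumT: "(\<Sum>i\<in>T. x' i j) = (\<Sum>i\<in>T1. x i j) + (if j = j0 then card T2 else 0)" for j
      unfolding TT using fin by (subst sum.union_disjoint) (auto simp: sum.reindex x'_def)
    \<comment> \<open>As all orders divide \<open>p ^ s\<close>, every \<open>j0\<close>-th
      coordinate is a multiple of \<open>p ^ (e - s)\<close>; fewer than \<open>p ^ (e - s)\<close>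
      copies of the basis element cannot complete it to zero unless there are none.\<close>
    have "p ^ (e - s) dvd x i j0" if "i \<in> T1" for i
    proof -
      have i: "i \<in> I" using that T1 by auto
      have "p ^ e dvd p ^ m i * x i j0" using dv[OF i j0(1)] j0(2) by simp
      also have "p ^ m i * x i j0 dvd p ^ s * x i j0"
        using mle[OF i] by (intro mult_dvd_mono) (auto simp: s_def le_imp_power_dvd)
      finally have "p ^ s * p ^ (e - s) dvd p ^ s * x i j0" using se by (simp flip: power_add)
      then show ?thesis using p0 by simp
    qed
    then have "p ^ (e - s) dvd (\<Sum>i\<in>T1. x i j0)" by (rule dvd_sum)
    moreover have "p ^ (e - s) dvd (\<Sum>i\<in>T1. x i j0) + card T2"
    proof (rule dvd_trans)
      show "p ^ (e - s) dvd p ^ e" by (simp add: le_imp_power_dvd)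
      show "p ^ e dvd (\<Sum>i\<in>T1. x i j0) + card T2" using Tz[OF j0(1)] sumT[of j0] j0(2) by simp
    qed
    ultimately have "p ^ (e - s) dvd card T2" by (simp add: dvd_add_right_iff)
    moreover have "card T2 \<le> p ^ (e - s) - 1" using card_mono[OF _ T2] by (simp add: K_def)
    then have "card T2 < p ^ (e - s)" using zero_less_power[OF p0, of "e - s"] by linarith
    ultimately have "card T2 = 0" by (meson nat_dvd_not_less not_gr_zero)
    then have T20: "T2 = {}" using fin by simp
    have "T1 = {}"
    proof (rule free)
      show "T1 \<subset> I" using T1 i0 by blast
      show "\<forall>j\<in>J. p ^ a j dvd (\<Sum>i\<in>T1. x i j)"
      proof
        fix j assume "j \<in> J"
        then show "p ^ a j dvd (\<Sum>i\<in>T1. x i j)" using Tz[of j] sumT[of j] T20 by (simp split: if_splits)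
      qed
    qed
    then show "T \<in> {{}}" using TT T20 by simp
  qed auto
  ultimately have "int p dvd 1" by simp
  then show False using p by (simp add: prime_nat_iff)
qed

section \<open>Sequences as indexed families\<close>

lemma ex_index_family: "\<exists>u. U = image_mset u (mset_set {..<size U})"
proof -
  obtain us where us: "mset us = U" using ex_mset by blast
  have "U = mset (map (nth us) [0..<length us])" using us by (simp add: map_nth)
  also have "\<dots> = image_mset (nth us) (mset_set {..<size U})"
    using us by (auto simp: atLeast0LessThan[symmetric])
  finally show ?thesis by blast
qed

lemma subset_image_mset_set:
  assumes "finite I" "T \<subseteq># image_mset u (mset_set I)"
  shows "\<exists>K\<subseteq>I. T = image_mset u (mset_set K)"
  using assms
proof (induction I arbitrary: T rule: finite_induct)
  case (insert i I)
  show ?case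
  proof (cases "T \<subseteq># image_mset u (mset_set I)")
    case True
    then show ?thesis using insert.IH by (meson subset_insertI2)
  next
    case False
    have sub: "T \<subseteq># add_mset (u i) (image_mset u (mset_set I))" using insert by simp
    have ui: "u i \<in># T"
    proof (rule ccontr)
      assume "u i \<notin># T"
      then have "count T a \<le> count (image_mset u (mset_set I)) a" for a
        using mset_subset_eq_count[OF sub, of a] by (cases "a = u i") (auto simp: not_in_iff)
      with False show False by (meson mset_subset_eqI)
    qed
    then obtain T' where T': "T = add_mset (u i) T'" by (metis mset_add)
    then have "T' \<subseteq># image_mset u (mset_set I)" using sub by simp
    then obtain K where K: "K \<subseteq> I" "T' = image_mset u (mset_set K)" using insert.IH by blast
    have "T = image_mset u (mset_set (insert i K))"
      using K insert T' finite_subset[OF K(1)] by (subst mset_set.insert) auto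
    then show ?thesis using K by (intro exI[of _ "insert i K"]) auto
  qed
qed auto

lemma image_mset_set_subset_eq:
  assumes "finite I" "K \<subseteq> I"
  shows "image_mset u (mset_set K) \<subseteq># image_mset u (mset_set I)"
  using assms by (intro image_mset_subseteq_mono) (simp add: subset_imp_msubset_mset_set)

context comm_group
begin

text \<open>Indexed counterpart of \<open>minimal_zero_sum\<close>: equal terms get different
  indices, so subsequences become index sets, over which the group algebra and covering arguments
  run.\<close>

definition minimal_zero_index :: "('i \<Rightarrow> 'a) \<Rightarrow> 'i set \<Rightarrow> bool" where
  "minimal_zero_index u I \<longleftrightarrow> finite I \<and> I \<noteq> {} \<and> u ` I \<subseteq> carrier G \<and> finprod G u I = \<one> \<and>
     (\<forall>T. T \<subset> I \<and> T \<noteq> {} \<longrightarrow> finprod G u T \<noteq> \<one>)"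

lemma seq_sum_add_mset:
  assumes "set_mset (add_mset g S) \<subseteq> carrier G"
  shows "seq_sum G (add_mset g S) = g \<otimes> seq_sum G S"
proof -
  have g: "g \<in> carrier G" and S: "set_mset S \<subseteq> carrier G" using assms by auto
  let ?A = "set_mset S - {g}"
  have "seq_sum G (add_mset g S) = (\<Otimes>h\<in>insert g ?A. h [^] count (add_mset g S) h)"
    unfolding seq_sum_def by simp
  also have "\<dots> = g [^] Suc (count S g) \<otimes> (\<Otimes>h\<in>?A. h [^] count (add_mset g S) h)"
    by (subst finprod_insert) (use g S in auto)
  also have "(\<Otimes>h\<in>?A. h [^] count (add_mset g S) h) = (\<Otimes>h\<in>?A. h [^] count S h)"
    by (rule finprod_cong') (use g S in auto)
  also have "g [^] Suc (count S g) \<otimes> (\<Otimes>h\<in>?A. h [^] count S h) = g \<otimes> (g [^] count S g \<otimes> (\<Otimes>h\<in>?A. h [^] count S h))"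
  proof -
    have "(\<Otimes>h\<in>?A. h [^] count S h) \<in> carrier G" by (rule finprod_closed) (use S in auto)
    then show ?thesis using g by (subst nat_pow_Suc2) (auto simp: m_assoc)
  qed
  also have "g [^] count S g \<otimes> (\<Otimes>h\<in>?A. h [^] count S h) = seq_sum G S"
  proof (cases "g \<in># S")
    case True
    then have "set_mset S = insert g ?A" by auto
    then have "seq_sum G S = (\<Otimes>h\<in>insert g ?A. h [^] count S h)" unfolding seq_sum_def by simp
    also have "\<dots> = g [^] count S g \<otimes> (\<Otimes>h\<in>?A. h [^] count S h)"
      by (subst finprod_insert) (use g S in auto)
    finally show ?thesis by simp
  next
    case False
    then have "?A = set_mset S" "count S g = 0" by (auto simp: not_in_iff)
    then show ?thesis using S by (auto simp: seq_sum_def intro!: finprod_closed l_one)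
  qed
  finally show ?thesis .
qed

lemma seq_sum_image_mset_set:
  assumes "finite I" "u ` I \<subseteq> carrier G"
  shows "seq_sum G (image_mset u (mset_set I)) = finprod G u I"
  using assms
proof (induction I rule: finite_induct)
  case empty
  show ?case by (simp add: seq_sum_def)
next
  case (insert i I)
  have "seq_sum G (image_mset u (mset_set (insert i I))) = seq_sum G (add_mset (u i) (image_mset u (mset_set I)))"
    using insert by simp
  also have "\<dots> = u i \<otimes> seq_sum G (image_mset u (mset_set I))"
    by (rule seq_sum_add_mset) (use insert in auto)
  also have "\<dots> = finprod G u (insert i I)"
    using insert by (subst finprod_insert) auto
  finally show ?case .
qed

lemma cross_number_add_mset:
  "cross_number G (add_mset g S) = 1 / real (ord g) + cross_number G S"
proof -
  let ?A = "set_mset (add_mset g S)"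
  have "cross_number G S = (\<Sum>h\<in>?A. real (count S h) / real (ord h))"
    unfolding cross_number_def by (rule sum.mono_neutral_left) (auto simp: not_in_iff)
  moreover have "cross_number G (add_mset g S)
      = (\<Sum>h\<in>?A. real (count S h) / real (ord h) + (if h = g then 1 / real (ord g) else 0))"
    unfolding cross_number_def by (rule sum.cong) (auto simp: add_divide_distrib)
  ultimately show ?thesis by (simp add: sum.distrib)
qed

lemma cross_number_image_mset_set:
  assumes "finite I"
  shows "cross_number G (image_mset u (mset_set I)) = (\<Sum>i\<in>I. 1 / real (ord (u i)))"
  using assms
proof (induction I rule: finite_induct)
  case empty
  show ?case by (simp add: cross_number_def)
next
  case (insert i I)
  then show ?case by (simp add: cross_number_add_mset)
qed

lemma minimal_zero_sum_iff_index:
  assumes I: "finite I"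
  shows "minimal_zero_sum G (image_mset u (mset_set I)) \<longleftrightarrow> minimal_zero_index u I"
proof -
  let ?U = "image_mset u (mset_set I)"
  have zs: "zero_sum G (image_mset u (mset_set K)) \<longleftrightarrow> finprod G u K = \<one>" if "u ` I \<subseteq> carrier G" "K \<subseteq> I" for K
  proof -
    have "finite K" "u ` K \<subseteq> carrier G" using that I finite_subset by auto
    then show ?thesis by (simp add: zero_sum_def seq_sum_image_mset_set)
  qed
  have ne: "image_mset u (mset_set K) = {#} \<longleftrightarrow> K = {}" if "K \<subseteq> I" for K
    using that I finite_subset by (auto simp: mset_set_empty_iff)
  show ?thesis
  proof
    assume U: "minimal_zero_sum G ?U"
    then have c: "u ` I \<subseteq> carrier G" using I by (auto simp: minimal_zero_sum_def zero_sum_def)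
    have "finprod G u T \<noteq> \<one>" if T: "T \<subset> I" "T \<noteq> {}" for T
    proof -
      have "image_mset u (mset_set T) \<subset># ?U"
      proof (rule subset_mset.le_neq_trans)
        show "image_mset u (mset_set T) \<subseteq># ?U" using T I by (intro image_mset_set_subset_eq) auto
        have "card T < card I" using T I by (intro psubset_card_mono)
        then show "image_mset u (mset_set T) \<noteq> ?U" by (metis nat_neq_iff size_image_mset size_mset_set)
      qed
      then have "\<not> zero_sum G (image_mset u (mset_set T))"
        using U ne[of T] T by (auto simp: minimal_zero_sum_def)
      then show ?thesis using zs[OF c, of T] T by auto
    qed
    then show "minimal_zero_index u I"
      using U c I zs[OF c, of I] ne[of I] unfolding minimal_zero_index_def minimal_zero_sum_def by auto
  next
    assume M: "minimal_zero_index u I"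
    then have c: "u ` I \<subseteq> carrier G" by (simp add: minimal_zero_index_def)
    have "\<not> zero_sum G T" if T: "T \<subset># ?U" "T \<noteq> {#}" for T
    proof -
      obtain K where K: "K \<subseteq> I" "T = image_mset u (mset_set K)"
        using subset_image_mset_set[OF I] T subset_mset.less_imp_le by blast
      then have "K \<subset> I" "K \<noteq> {}" using T by auto
      then show ?thesis using M zs[OF c K(1)] K(2) unfolding minimal_zero_index_def by auto
    qed
    then show "minimal_zero_sum G ?U"
      using M ne[of I] zs[OF c, of I] unfolding minimal_zero_sum_def minimal_zero_index_def by auto
  qed
qed

end

section \<open>Coordinates\<close>

text \<open>On the unit cube, product minus sum is nonincreasing in each variable: its partial
  derivative is a product of numbers at most 1, minus 1. It will show that the worst case for a
  single mixed term is order exp(G).\<close>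

lemma prod_minus_sum_mono:
  fixes x y :: "'i \<Rightarrow> real"
  assumes "finite A" "\<And>i. i \<in> A \<Longrightarrow> 0 \<le> y i \<and> y i \<le> x i \<and> x i \<le> 1"
  shows "(\<Prod>i\<in>A. x i) - (\<Sum>i\<in>A. x i) \<le> (\<Prod>i\<in>A. y i) - (\<Sum>i\<in>A. y i)"
proof -
  have "norm ((\<Prod>i\<in>A. x i) - (\<Prod>i\<in>A. y i)) \<le> (\<Sum>i\<in>A. norm (x i - y i))"
    by (rule norm_prod_diff) (use assms in fastforce)+
  also have "\<dots> = (\<Sum>i\<in>A. x i - y i)" using assms by (intro sum.cong) auto
  finally show ?thesis by (simp add: sum_subtractf)
qed

text \<open>Coordinates are natural numbers that matter only modulo \<open>ns ! i\<close>. Zero-sum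
  conditions thus become divisibilities, the form used by the counting theorems.\<close>

locale coordinate_group = comm_group G for G (structure) +
  fixes ns :: "nat list" and X :: "'a \<Rightarrow> nat \<Rightarrow> nat"
  assumes fin: "finite (carrier G)"
    and primepow_ns: "i < length ns \<Longrightarrow> primepow (ns ! i)"
    and X_mult: "x \<in> carrier G \<Longrightarrow> y \<in> carrier G \<Longrightarrow> i < length ns \<Longrightarrow> [X (x \<otimes> y) i = X x i + X y i] (mod ns ! i)"
    and X_inj: "x \<in> carrier G \<Longrightarrow> (\<And>i. i < length ns \<Longrightarrow> ns ! i dvd X x i) \<Longrightarrow> x = \<one>"
    and X_surj: "\<exists>x\<in>carrier G. \<forall>i<length ns. [X x i = c i] (mod ns ! i)"

lemma (in comm_group) ex_coordinate_group:
  assumes fin: "finite (carrier G)" and dec: "prime_power_decomposition G ns"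
  shows "\<exists>X. coordinate_group G ns X"
proof -
  let ?n = "length ns"
  let ?P = "product_group {..<?n} (\<lambda>i. integer_mod_group (ns ! i))"
  have pp: "\<And>i. i < ?n \<Longrightarrow> primepow (ns ! i)" using dec by (auto simp: prime_power_decomposition_def)
  then have pos: "ns ! i > 0" if "i < ?n" for i using that primepow_gt_0_nat by blast
  obtain h where h: "h \<in> iso G ?P" using dec by (auto simp: prime_power_decomposition_def is_iso_def)
  then have hh: "h \<in> hom G ?P" and bij: "bij_betw h (carrier G) (carrier ?P)" by (auto simp: iso_def)
  have carr: "0 \<le> h x i \<and> h x i < int (ns ! i)" if "x \<in> carrier G" "i < ?n" for x i
  proof -
    have "h x \<in> carrier ?P" using hh that by (auto simp: hom_def)
    then have "h x i \<in> carrier (integer_mod_group (ns ! i))" using that by auto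
    then show ?thesis using pos[OF that(2)] by (simp add: carrier_integer_mod_group)
  qed
  define X where "X = (\<lambda>x i. nat (h x i))"
  have "coordinate_group G ns X"
  proof (unfold_locales)
    show "finite (carrier G)" by (rule fin)
    show "primepow (ns ! i)" if "i < ?n" for i by (rule pp[OF that])
    fix x y i assume xy: "x \<in> carrier G" "y \<in> carrier G" "i < ?n"
    have "h (x \<otimes> y) i = (h x i + h y i) mod int (ns ! i)"
      using hom_mult[OF hh xy(1,2)] xy(3) by simp
    then have "X (x \<otimes> y) i = (X x i + X y i) mod (ns ! i)"
      using carr[OF xy(1,3)] carr[OF xy(2,3)] by (simp add: X_def nat_mod_distrib nat_add_distrib)
    then show "[X (x \<otimes> y) i = X x i + X y i] (mod ns ! i)" by (simp add: cong_def)
  next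
    fix x assume x: "x \<in> carrier G" and d: "\<And>i. i < ?n \<Longrightarrow> ns ! i dvd X x i"
    have "h x i = 0" if i: "i < ?n" for i
    proof -
      have "X x i < ns ! i" using carr[OF x i] by (auto simp: X_def)
      then have "X x i = 0" using d[OF i] nat_dvd_not_less by blast
      then show ?thesis using carr[OF x i] by (simp add: X_def)
    qed
    moreover have "h x \<in> carrier ?P" using hh x by (auto simp: hom_def)
    ultimately have "h x = \<one>\<^bsub>?P\<^esub>" by (auto simp: fun_eq_iff PiE_def extensional_def)
    moreover have "h \<one> = \<one>\<^bsub>?P\<^esub>"
      using hom_one[OF hh is_group] by simp
    ultimately show "x = \<one>" using bij x by (metis bij_betw_def inj_onD one_closed)
  next
    fix c :: "nat \<Rightarrow> nat"
    define f where "f = (\<lambda>i\<in>{..<?n}. int (c i mod (ns ! i)))"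
    have "f \<in> carrier ?P" using pos by (auto simp: f_def carrier_integer_mod_group)
    then obtain x where x: "x \<in> carrier G" "h x = f" using bij by (metis bij_betw_def imageE)
    then have "\<forall>i<?n. [X x i = c i] (mod ns ! i)" by (auto simp: X_def f_def cong_def)
    then show "\<exists>x\<in>carrier G. \<forall>i<?n. [X x i = c i] (mod ns ! i)" using x by blast
  qed
  then show ?thesis by blast
qed

lemma (in comm_group) order_decomposition:
  assumes dec: "prime_power_decomposition G ns"
  shows "order G = (\<Prod>i<length ns. ns ! i)"
proof -
  let ?P = "product_group {..<length ns} (\<lambda>i. integer_mod_group (ns ! i))"
  have pos: "ns ! i > 0" if "i < length ns" for i
    using that dec primepow_gt_0_nat by (auto simp: prime_power_decomposition_def)
  obtain h where "h \<in> iso G ?P" using dec by (auto simp: prime_power_decomposition_def is_iso_def)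
  then have "card (carrier G) = card (carrier ?P)" by (auto simp: iso_def bij_betw_same_card)
  also have "\<dots> = (\<Prod>i<length ns. card (carrier (integer_mod_group (ns ! i))))"
    by (simp add: card_PiE)
  also have "\<dots> = (\<Prod>i<length ns. ns ! i)"
    by (rule prod.cong) (auto simp: carrier_integer_mod_group)
  finally show ?thesis by (simp add: order_def)
qed

context coordinate_group
begin

lemma ns_pos: "i < length ns \<Longrightarrow> ns ! i > 0"
  using primepow_ns primepow_gt_0_nat by blast

lemma X_one: "i < length ns \<Longrightarrow> ns ! i dvd X \<one> i"
proof -
  assume i: "i < length ns"
  have "[X \<one> i + X \<one> i = X \<one> i + 0] (mod ns ! i)"
    using X_mult[of \<one> \<one> i] i by (simp add: cong_sym)
  then have "[X \<one> i = 0] (mod ns ! i)" by (simp only: cong_add_lcancel_nat)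
  then show ?thesis by (simp add: cong_0_iff)
qed

lemma X_finprod:
  assumes "finite T" "u ` T \<subseteq> carrier G" "i < length ns"
  shows "[X (finprod G u T) i = (\<Sum>k\<in>T. X (u k) i)] (mod ns ! i)"
  using assms(1,2)
proof (induction T rule: finite_induct)
  case empty
  show ?case using X_one[OF assms(3)] by (simp add: cong_0_iff)
next
  case (insert k T)
  have "finprod G u (insert k T) = u k \<otimes> finprod G u T" using insert by (subst finprod_insert) auto
  moreover have "finprod G u T \<in> carrier G" by (rule finprod_closed) (use insert in auto)
  ultimately have "[X (finprod G u (insert k T)) i = X (u k) i + X (finprod G u T) i] (mod ns ! i)"
    using X_mult[of "u k" "finprod G u T" i] insert assms(3) by auto
  also have "[X (u k) i + X (finprod G u T) i = X (u k) i + (\<Sum>k\<in>T. X (u k) i)] (mod ns ! i)"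
    using insert by (intro cong_add) auto
  finally show ?case using insert by simp
qed

lemma finprod_eq_one_iff:
  assumes "finite T" "u ` T \<subseteq> carrier G"
  shows "finprod G u T = \<one> \<longleftrightarrow> (\<forall>i<length ns. ns ! i dvd (\<Sum>k\<in>T. X (u k) i))"
proof -
  have c: "finprod G u T \<in> carrier G" by (rule finprod_closed) (use assms in auto)
  have "ns ! i dvd X (finprod G u T) i \<longleftrightarrow> ns ! i dvd (\<Sum>k\<in>T. X (u k) i)" if "i < length ns" for i
    using X_finprod[OF assms that] by (rule cong_dvd_iff)
  then show ?thesis using X_inj[OF c] X_one by metis
qed

lemma ord_dvd_iff:
  assumes "x \<in> carrier G"
  shows "ord x dvd n \<longleftrightarrow> (\<forall>i<length ns. ns ! i dvd n * X x i)"
proof -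
  have "finprod G (\<lambda>_. x) {..<n} = x [^] n" using finprod_const[of x "{..<n}"] assms by simp
  moreover have "finprod G (\<lambda>_. x) {..<n} = \<one> \<longleftrightarrow> (\<forall>i<length ns. ns ! i dvd (\<Sum>k\<in>{..<n}. X x i))"
    by (rule finprod_eq_one_iff) (use assms in auto)
  ultimately show ?thesis using pow_eq_id[OF assms, of n] by simp
qed

lemma ord_pos: "x \<in> carrier G \<Longrightarrow> ord x > 0"
  using ord_ge_1[OF fin] by force

lemma ord_dvd_exp: "x \<in> carrier G \<Longrightarrow> ord x dvd group_exp G"
  by (simp add: group_exp_def)

lemma exp_dvd_iff: "group_exp G dvd n \<longleftrightarrow> (\<forall>i<length ns. ns ! i dvd n)"
proof
  assume d: "group_exp G dvd n"
  obtain g where g: "g \<in> carrier G" "\<forall>i<length ns. [X g i = 1] (mod ns ! i)" using X_surj[of "\<lambda>_. 1"] by blast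
  show "\<forall>i<length ns. ns ! i dvd n"
  proof (intro allI impI)
    fix i assume i: "i < length ns"
    have "ord g dvd n" using ord_dvd_exp[OF g(1)] d dvd_trans by blast
    then have "ns ! i dvd n * X g i" using ord_dvd_iff[OF g(1)] i by blast
    moreover have "[n * X g i = n * 1] (mod ns ! i)" using g i by (intro cong_mult) auto
    ultimately show "ns ! i dvd n" using cong_dvd_iff by force
  qed
next
  assume "\<forall>i<length ns. ns ! i dvd n"
  then have "ord x dvd n" if "x \<in> carrier G" for x using ord_dvd_iff[OF that] by simp
  then show "group_exp G dvd n" unfolding group_exp_def by (intro Lcm_least) auto
qed

lemma ns_dvd_exp: "i < length ns \<Longrightarrow> ns ! i dvd group_exp G"
  using exp_dvd_iff[of "group_exp G"] by simp

lemma exp_pos: "group_exp G > 0"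
proof -
  have "group_exp G dvd (\<Prod>i<length ns. ns ! i)"
    unfolding exp_dvd_iff by (auto intro: dvd_prodI)
  moreover have "(\<Prod>i<length ns. ns ! i) > 0" using ns_pos by (intro prod_pos) auto
  ultimately show ?thesis by (meson dvd_pos_nat)
qed

definition primary_indices :: "nat \<Rightarrow> nat set" where
  "primary_indices P = {i. i < length ns \<and> P dvd ns ! i}"

abbreviation idx_exp :: "nat \<Rightarrow> nat \<Rightarrow> nat" where
  "idx_exp P i \<equiv> multiplicity P (ns ! i)"

abbreviation exp_exp :: "nat \<Rightarrow> nat" where
  "exp_exp P \<equiv> multiplicity P (group_exp G)"

lemma finite_primary_indices: "finite (primary_indices P)"
  by (simp add: primary_indices_def)

lemma ns_eq_power:
  assumes "prime P" "i \<in> primary_indices P"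
  shows "ns ! i = P ^ idx_exp P i"
proof -
  have i: "i < length ns" "P dvd ns ! i" using assms by (auto simp: primary_indices_def)
  obtain q k where qk: "prime q" "k > 0" "ns ! i = q ^ k" using primepow_ns[OF i(1)] by (auto simp: primepow_def)
  then have "P dvd q" using i assms by (metis prime_dvd_power)
  then have "P = q" using assms qk by (simp add: primes_dvd_imp_eq)
  then show ?thesis using qk by (simp add: multiplicity_prime_power)
qed

text \<open>The part of the order prime to \<open>P\<close> is invertible modulo powers of
  \<open>P\<close>, so the \<open>P\<close>-part alone annihilates the \<open>P\<close>-coordinates.
  This supplies the hypothesis \<open>dv\<close> of the counting theorems.\<close>

lemma primary_dvd:
  assumes P: "prime P" and x: "x \<in> carrier G" and j: "j \<in> primary_indices P"
  shows "P ^ idx_exp P j dvd P ^ multiplicity P (ord x) * X x j"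
proof -
  have jl: "j < length ns" using j by (simp add: primary_indices_def)
  have "ord x \<noteq> 0" using ord_pos[OF x] by simp
  then obtain s where s: "ord x = P ^ multiplicity P (ord x) * s" "\<not> P dvd s"
    using multiplicity_decompose'[of "ord x" P] P by (metis not_prime_unit)
  have "ns ! j dvd ord x * X x j" using ord_dvd_iff[OF x, of "ord x"] jl by simp
  then have "P ^ idx_exp P j dvd s * (P ^ multiplicity P (ord x) * X x j)"
    using s(1) ns_eq_power[OF P j] by (metis mult.assoc mult.commute)
  moreover have "coprime (P ^ idx_exp P j) s" using s(2) P by (simp add: prime_imp_coprime)
  ultimately show ?thesis by (simp add: coprime_dvd_mult_right_iff)
qed

lemma idx_exp_le: "i < length ns \<Longrightarrow> prime P \<Longrightarrow> idx_exp P i \<le> exp_exp P"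
  using ns_dvd_exp exp_pos by (intro dvd_imp_multiplicity_le) auto

lemma ord_exp_le: "x \<in> carrier G \<Longrightarrow> prime P \<Longrightarrow> multiplicity P (ord x) \<le> exp_exp P"
  using ord_dvd_exp exp_pos by (intro dvd_imp_multiplicity_le) auto

text \<open>Otherwise the exponent divided by \<open>P\<close> would still annihilate the group. The
  index found provides the basis element of order \<open>p ^ e\<close> in
  \<open>p_group_minimal_bound\<close>.\<close>

lemma ex_max_index:
  assumes P: "prime P" "P dvd group_exp G"
  shows "\<exists>j\<in>primary_indices P. idx_exp P j = exp_exp P"
proof (rule ccontr)
  assume neg: "\<not> ?thesis"
  define n where "n = group_exp G div P"
  have n: "group_exp G = n * P" using P by (simp add: n_def)
  have n0: "n > 0" using exp_pos n by (metis mult_0 not_gr_zero)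
  have mult: "exp_exp P = Suc (multiplicity P n)"
    unfolding n using P n0 by (simp add: prime_elem_multiplicity_mult_distrib)
  have "ns ! i dvd n" if i: "i < length ns" for i
  proof (cases "P dvd ns ! i")
    case True
    then have ip: "i \<in> primary_indices P" using i by (simp add: primary_indices_def)
    then have "idx_exp P i \<le> multiplicity P n" using neg idx_exp_le[OF i P(1)] mult by (metis le_Suc_eq)
    then show ?thesis using ns_eq_power[OF P(1) ip] multiplicity_dvd' by metis
  next
    case False
    then have "coprime (ns ! i) P" using P(1) by (metis coprime_commute prime_imp_coprime)
    then show ?thesis using ns_dvd_exp[OF i] n by (metis coprime_dvd_mult_left_iff)
  qed
  then have "group_exp G dvd n" using exp_dvd_iff by blast
  then have "group_exp G \<le> n" using n0 dvd_imp_le by blast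
  then show False using n n0 P(1) prime_gt_1_nat[OF P(1)] by simp
qed

text \<open>The value of \<open>k_star\<close> along the decomposition \<open>ns\<close> at hand;
  the two agree once \<open>ns\<close> is the decomposition selected in
  \<open>k_star\<close>.\<close>

definition kst :: real where "kst = (\<Sum>i<length ns. 1 - 1 / real (ns ! i))"

lemma kst_eq: "kst = (\<Sum>P\<in>prime_factors (group_exp G). \<Sum>j\<in>primary_indices P. 1 - 1 / real P ^ idx_exp P j)"
proof -
  have U: "{..<length ns} = (\<Union>P\<in>prime_factors (group_exp G). primary_indices P)"
  proof (intro equalityI subsetI)
    fix i assume "i \<in> {..<length ns}"
    then have i: "i < length ns" by simp
    obtain q k where qk: "prime q" "k > 0" "ns ! i = q ^ k" using primepow_ns[OF i] by (auto simp: primepow_def)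
    then have "q dvd ns ! i" by simp
    then have "q \<in> prime_factors (group_exp G)" "i \<in> primary_indices q"
      using qk i ns_dvd_exp[OF i] exp_pos by (auto simp: in_prime_factors_iff primary_indices_def intro: dvd_trans)
    then show "i \<in> (\<Union>P\<in>prime_factors (group_exp G). primary_indices P)" by blast
  qed (auto simp: primary_indices_def)
  have disj: "primary_indices P \<inter> primary_indices Q = {}" if "prime P" "prime Q" "P \<noteq> Q" for P Q
  proof (rule ccontr)
    assume "\<not> ?thesis"
    then obtain i where i: "i \<in> primary_indices P" "i \<in> primary_indices Q" by blast
    then have "Q dvd P ^ idx_exp P i" using ns_eq_power[OF that(1) i(1)] by (metis (mono_tags) mem_Collect_eq primary_indices_def)
    then show False using that by (metis prime_dvd_power primes_dvd_imp_eq)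
  qed
  have "kst = (\<Sum>P\<in>prime_factors (group_exp G). \<Sum>j\<in>primary_indices P. 1 - 1 / real (ns ! j))"
    unfolding kst_def U
    by (rule sum.UNION_disjoint) (use disj finite_primary_indices in \<open>auto simp: in_prime_factors_iff\<close>)
  also have "\<dots> = (\<Sum>P\<in>prime_factors (group_exp G). \<Sum>j\<in>primary_indices P. 1 - 1 / real P ^ idx_exp P j)"
    by (intro sum.cong refl) (metis in_prime_factors_iff ns_eq_power of_nat_power)
  finally show ?thesis .
qed

lemma minimal_indexD:
  assumes "minimal_zero_index u I"
  shows "finite I" "I \<noteq> {}" "\<And>i. i \<in> I \<Longrightarrow> u i \<in> carrier G"
    "\<And>j. j < length ns \<Longrightarrow> ns ! j dvd (\<Sum>i\<in>I. X (u i) j)"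
    "\<And>T. T \<subset> I \<Longrightarrow> \<forall>j<length ns. ns ! j dvd (\<Sum>i\<in>T. X (u i) j) \<Longrightarrow> T = {}"
proof -
  show I: "finite I" "I \<noteq> {}" and c: "\<And>i. i \<in> I \<Longrightarrow> u i \<in> carrier G"
    using assms by (auto simp: minimal_zero_index_def)
  show "ns ! j dvd (\<Sum>i\<in>I. X (u i) j)" if "j < length ns" for j
    using finprod_eq_one_iff[OF I(1), of u] c assms that by (auto simp: minimal_zero_index_def)
  show "T = {}" if T: "T \<subset> I" "\<forall>j<length ns. ns ! j dvd (\<Sum>i\<in>T. X (u i) j)" for T
  proof (rule ccontr)
    assume ne: "T \<noteq> {}"
    have "finite T" "u ` T \<subseteq> carrier G" using T I c finite_subset by auto
    then have "finprod G u T = \<one>" using finprod_eq_one_iff T by blast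
    then show False using assms T ne by (auto simp: minimal_zero_index_def)
  qed
qed

text \<open>This is \<open>p_group_minimal_bound\<close> divided by the \<open>P\<close>-part of the
  exponent. Only the \<open>P\<close>-coordinates and the \<open>P\<close>-parts of the orders
  enter, so a mixed term may occur among the \<open>u i\<close>.\<close>

lemma primary_minimal_bound:
  fixes u :: "'i \<Rightarrow> 'a"
  assumes P: "prime P" "P dvd group_exp G" and I: "finite I" "I \<noteq> {}" and u: "\<And>i. i \<in> I \<Longrightarrow> u i \<in> carrier G"
    and free: "\<And>T. T \<subset> I \<Longrightarrow> \<forall>j\<in>primary_indices P. ns ! j dvd (\<Sum>i\<in>T. X (u i) j) \<Longrightarrow> T = {}"
  shows "(\<Sum>i\<in>I. 1 / real P ^ multiplicity P (ord (u i)))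
     \<le> (\<Sum>j\<in>primary_indices P. 1 - 1 / real P ^ idx_exp P j) + 1 / real P ^ exp_exp P"
proof -
  let ?J = "primary_indices P" and ?e = "exp_exp P"
  have P0: "real P > 0" using prime_gt_0_nat[OF P(1)] by simp
  obtain j0 where j0: "j0 \<in> ?J" "idx_exp P j0 = ?e" using ex_max_index[OF P] by blast
  have Jle: "idx_exp P j \<le> ?e" if "j \<in> ?J" for j using that idx_exp_le P by (auto simp: primary_indices_def)
  have ule: "multiplicity P (ord (u i)) \<le> ?e" if "i \<in> I" for i using ord_exp_le[OF u[OF that] P(1)] .
  have pd: "real (P ^ (?e - k)) = real P ^ ?e / real P ^ k" if "k \<le> ?e" for k
    using P0 that by (subst of_nat_power) (simp add: power_diff)
  have "(\<Sum>i\<in>I. P ^ (?e - multiplicity P (ord (u i)))) \<le> (\<Sum>j\<in>?J. P ^ ?e - P ^ (?e - idx_exp P j)) + 1"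
  proof (rule p_group_minimal_bound[where x = "\<lambda>i j. X (u i) j" and a = "idx_exp P" and e = ?e and m = "\<lambda>i. multiplicity P (ord (u i))", OF P(1) finite_primary_indices I _ j0])
    fix T assume T: "T \<subset> I" "\<forall>j\<in>?J. P ^ idx_exp P j dvd (\<Sum>i\<in>T. X (u i) j)"
    have "ns ! j dvd (\<Sum>i\<in>T. X (u i) j)" if "j \<in> ?J" for j
      by (subst ns_eq_power[OF P(1) that]) (use T(2) that in blast)
    then show "T = {}" using free[OF T(1)] by blast
  qed (use Jle ule primary_dvd[OF P(1) u] in auto)
  then have "real (\<Sum>i\<in>I. P ^ (?e - multiplicity P (ord (u i)))) \<le> real ((\<Sum>j\<in>?J. P ^ ?e - P ^ (?e - idx_exp P j)) + 1)"
    by (rule of_nat_mono)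
  moreover have "real (\<Sum>i\<in>I. P ^ (?e - multiplicity P (ord (u i)))) = (\<Sum>i\<in>I. 1 / real P ^ multiplicity P (ord (u i))) * real P ^ ?e"
    unfolding of_nat_sum sum_distrib_right using ule by (intro sum.cong refl) (simp add: pd del: of_nat_power)
  moreover have "real (\<Sum>j\<in>?J. P ^ ?e - P ^ (?e - idx_exp P j)) = (\<Sum>j\<in>?J. 1 - 1 / real P ^ idx_exp P j) * real P ^ ?e"
    unfolding of_nat_sum sum_distrib_right
  proof (intro sum.cong refl)
    fix j assume j: "j \<in> ?J"
    have "P ^ (?e - idx_exp P j) \<le> P ^ ?e" using prime_gt_0_nat[OF P(1)] by (intro power_increasing) auto
    then show "real (P ^ ?e - P ^ (?e - idx_exp P j)) = (1 - 1 / real P ^ idx_exp P j) * real P ^ ?e"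
      using pd[OF Jle[OF j]] P0 by (simp add: of_nat_diff left_diff_distrib)
  qed
  ultimately have "(\<Sum>i\<in>I. 1 / real P ^ multiplicity P (ord (u i))) * real P ^ ?e
      \<le> (\<Sum>j\<in>?J. 1 - 1 / real P ^ idx_exp P j) * real P ^ ?e + 1" by simp
  also have "\<dots> = ((\<Sum>j\<in>?J. 1 - 1 / real P ^ idx_exp P j) + 1 / real P ^ ?e) * real P ^ ?e"
    using P0 by (simp add: distrib_right)
  finally show ?thesis using P0 by (simp add: mult_le_cancel_right)
qed

lemma inverse_eq_prod_primes:
  assumes "n dvd group_exp G"
  shows "1 / real n = (\<Prod>P\<in>prime_factors (group_exp G). 1 / real P ^ multiplicity P n)"
proof -
  have n: "n > 0" using assms exp_pos by (metis dvd_0_left_iff not_gr_zero)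
  have "n = (\<Prod>P\<in>prime_factors n. P ^ multiplicity P n)" using n by (simp add: prime_factorization_nat)
  also have "\<dots> = (\<Prod>P\<in>prime_factors (group_exp G). P ^ multiplicity P n)"
    using assms exp_pos n
    by (intro prod.mono_neutral_left) (auto simp: dvd_prime_factors in_prime_factors_iff not_dvd_imp_multiplicity_0)
  finally have "real n = (\<Prod>P\<in>prime_factors (group_exp G). real P ^ multiplicity P n)"
    by (metis (no_types, lifting) of_nat_power of_nat_prod prod.cong)
  then show ?thesis by (simp add: prod_dividef)
qed

text \<open>Adding the bounds for all primes counts the \<open>P\<close>-parts of
  \<open>u i0\<close> separately, whereas its true share is the product of their reciprocals. The
  difference of product and sum is largest at the full exponents, where the product is the
  reciprocal of exp(G).\<close>

theorem at_most_one_mixed_bound: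
  fixes u :: "'i \<Rightarrow> 'a"
  assumes M: "minimal_zero_index u I" and i0: "i0 \<in> I"
    and pp: "\<And>i. i \<in> I - {i0} \<Longrightarrow> \<exists>P k. prime P \<and> ord (u i) = P ^ k"
  shows "(\<Sum>i\<in>I. 1 / real (ord (u i))) \<le> kst + 1 / real (group_exp G)"
proof -
  note D = minimal_indexD[OF M]
  let ?E = "group_exp G" and ?m = "\<lambda>P i. multiplicity P (ord (u i))"
  define Ip where "Ip = (\<lambda>P. {i \<in> I - {i0}. P dvd ord (u i)})"
  have ordne: "ord (u i) \<noteq> 1" if i: "i \<in> I - {i0}" for i
  proof
    assume "ord (u i) = 1"
    then have "u i = \<one>" using ord_eq_1 D(3) i by blast
    then have "finprod G u {i} = \<one>" using D(3) i by simp
    moreover have "{i} \<subset> I" using i i0 by blast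
    ultimately show False using M by (auto simp: minimal_zero_index_def)
  qed
  have Ip_pow: "\<exists>k. ord (u i) = P ^ k" if "prime P" "i \<in> Ip P" for P i
  proof -
    have i: "i \<in> I - {i0}" "P dvd ord (u i)" using that(2) by (auto simp: Ip_def)
    obtain Q k where Q: "prime Q" "ord (u i) = Q ^ k" using pp[OF i(1)] by blast
    then have "P dvd Q" using i(2) prime_dvd_power[OF that(1)] by simp
    then show ?thesis using Q that primes_dvd_imp_eq by blast
  qed
  have Ip_ord: "ord (u i) = P ^ ?m P i" if "prime P" "i \<in> Ip P" for P i
  proof -
    from Ip_pow[OF that] obtain k where "ord (u i) = P ^ k" by blast
    then show ?thesis using that(1) by (simp add: multiplicity_prime_power)
  qed
  have U: "I - {i0} = (\<Union>P\<in>prime_factors ?E. Ip P)"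
  proof (intro equalityI subsetI)
    fix i assume i: "i \<in> I - {i0}"
    obtain Q where Q: "prime Q" "Q dvd ord (u i)" using ordne[OF i] prime_factor_nat by blast
    then have "Q dvd ?E" using ord_dvd_exp D(3) i by (meson DiffD1 dvd_trans)
    then show "i \<in> (\<Union>P\<in>prime_factors ?E. Ip P)" using Q i exp_pos by (auto simp: Ip_def in_prime_factors_iff)
  qed (auto simp: Ip_def)
  have disj: "Ip P \<inter> Ip Q = {}" if "prime P" "prime Q" "P \<noteq> Q" for P Q
  proof (rule ccontr)
    assume "\<not> ?thesis"
    then obtain i where i: "i \<in> Ip P" "i \<in> Ip Q" by blast
    from Ip_pow[OF that(1) i(1)] obtain k where k: "ord (u i) = P ^ k" by blast
    have "Q dvd ord (u i)" using i(2) by (simp add: Ip_def)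
    then have "Q dvd P" using prime_dvd_power[OF that(2)] k by simp
    then show False using that primes_dvd_imp_eq by blast
  qed
  have finIp: "finite (Ip P)" for P using D(1) by (simp add: Ip_def)
  have "(\<Sum>i\<in>I - {i0}. 1 / real (ord (u i))) = (\<Sum>P\<in>prime_factors ?E. \<Sum>i\<in>Ip P. 1 / real (ord (u i)))"
    unfolding U by (rule sum.UNION_disjoint) (use disj finIp in \<open>auto simp: in_prime_factors_iff\<close>)
  also have "\<dots> = (\<Sum>P\<in>prime_factors ?E. \<Sum>i\<in>Ip P. 1 / real P ^ ?m P i)"
    by (intro sum.cong refl) (metis Ip_ord in_prime_factors_iff of_nat_power)
  finally have s1: "(\<Sum>i\<in>I - {i0}. 1 / real (ord (u i))) = (\<Sum>P\<in>prime_factors ?E. \<Sum>i\<in>Ip P. 1 / real P ^ ?m P i)" .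
  have vanish: "ns ! j dvd X (u i) j" if "prime P" "j \<in> primary_indices P" "i \<in> I - {i0}" "i \<notin> Ip P" for P i j
  proof -
    have "?m P i = 0" using that by (auto simp: Ip_def not_dvd_imp_multiplicity_0)
    then show ?thesis using primary_dvd[OF that(1) _ that(2), of "u i"] D(3) that ns_eq_power[OF that(1,2)] by simp
  qed
  have bd: "(\<Sum>i\<in>Ip P. 1 / real P ^ ?m P i) + 1 / real P ^ ?m P i0
      \<le> (\<Sum>j\<in>primary_indices P. 1 - 1 / real P ^ idx_exp P j) + 1 / real P ^ exp_exp P"
    if PE: "P \<in> prime_factors ?E" for P
  proof -
    have P: "prime P" "P dvd ?E" using PE by (auto simp: in_prime_factors_iff)
    have "(\<Sum>i\<in>insert i0 (Ip P). 1 / real P ^ ?m P i)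
      \<le> (\<Sum>j\<in>primary_indices P. 1 - 1 / real P ^ idx_exp P j) + 1 / real P ^ exp_exp P"
    proof (rule primary_minimal_bound[OF P])
      show "finite (insert i0 (Ip P))" "insert i0 (Ip P) \<noteq> {}" using finIp by auto
      show "u i \<in> carrier G" if "i \<in> insert i0 (Ip P)" for i using that D(3) i0 by (auto simp: Ip_def)
      fix T assume T: "T \<subset> insert i0 (Ip P)" and Tz: "\<forall>j\<in>primary_indices P. ns ! j dvd (\<Sum>i\<in>T. X (u i) j)"
      have off: "ns ! j dvd X (u i) j" if "i \<in> Ip P" "j < length ns" "j \<notin> primary_indices P" for i j
      proof -
        from primepow_ns[OF that(2)] obtain Q k where "prime Q" "k > 0" "ns ! j = Q ^ k"
          by (auto simp: primepow_def)
        then have Q: "prime Q" "Q dvd ns ! j" by auto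
        then have jQ: "j \<in> primary_indices Q" using that by (simp add: primary_indices_def)
        then have "Q \<noteq> P" using that by auto
        then have "i \<notin> Ip Q" using disj[OF Q(1) P(1)] that by blast
        then show ?thesis using vanish[OF Q(1) jQ] that by (auto simp: Ip_def)
      qed
      have free: "S = {}" if S: "S \<subseteq> Ip P" "\<forall>j\<in>primary_indices P. ns ! j dvd (\<Sum>i\<in>S. X (u i) j)" for S
      proof (rule D(5))
        show "S \<subset> I" using S i0 by (auto simp: Ip_def)
        show "\<forall>j<length ns. ns ! j dvd (\<Sum>i\<in>S. X (u i) j)"
        proof (intro allI impI)
          fix j assume j: "j < length ns"
          show "ns ! j dvd (\<Sum>i\<in>S. X (u i) j)"
          proof (cases "j \<in> primary_indices P")
            case True
            then show ?thesis using S by blast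
          next
            case False
            then show ?thesis by (intro dvd_sum) (use S off j in auto)
          qed
        qed
      qed
      show "T = {}"
      proof (cases "i0 \<in> T")
        case False
        then show ?thesis using free T Tz by blast
      next
        case True
        \<comment> \<open>When \<open>T\<close> contains \<open>i0\<close>, its complement is used:
          the whole sum vanishes and the terms of \<open>W\<close> have zero \<open>P\<close>-part,
          so \<open>S\<close> has sum zero and must be empty, against \<open>T\<close> being
          proper.\<close>
        define S where "S = Ip P - T"
        have fT: "finite T" using T finIp by (meson finite_insert finite_subset psubset_imp_subset)
        have "ns ! j dvd (\<Sum>i\<in>S. X (u i) j)" if j: "j \<in> primary_indices P" for j
        proof -
          define W where "W = I - {i0} - Ip P"
          have jl: "j < length ns" using j by (simp add: primary_indices_def)
          have "I = T \<union> (S \<union> W)" using T True i0 by (auto simp: S_def Ip_def W_def)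
          moreover have "(\<Sum>i\<in>T \<union> (S \<union> W). X (u i) j) = (\<Sum>i\<in>T. X (u i) j) + (\<Sum>i\<in>S \<union> W. X (u i) j)"
            using fT finIp[of P] D(1) T by (intro sum.union_disjoint) (auto simp: S_def W_def)
          moreover have "(\<Sum>i\<in>S \<union> W. X (u i) j) = (\<Sum>i\<in>S. X (u i) j) + (\<Sum>i\<in>W. X (u i) j)"
            using finIp[of P] D(1) by (intro sum.union_disjoint) (auto simp: S_def W_def)
          ultimately have "ns ! j dvd (\<Sum>i\<in>T. X (u i) j) + ((\<Sum>i\<in>S. X (u i) j) + (\<Sum>i\<in>W. X (u i) j))"
            using D(4)[OF jl] by simp
          moreover have "ns ! j dvd (\<Sum>i\<in>W. X (u i) j)"
            by (rule dvd_sum) (use vanish[OF P(1) j] W_def in auto)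
          ultimately show ?thesis using Tz j by (simp add: dvd_add_right_iff dvd_add_left_iff)
        qed
        then have "S = {}" using free[of S] S_def by blast
        then show ?thesis using T True by (auto simp: S_def)
      qed
    qed
    then show ?thesis using finIp by (simp add: Ip_def add.commute)
  qed
  have "(\<Sum>i\<in>I. 1 / real (ord (u i))) = 1 / real (ord (u i0)) + (\<Sum>P\<in>prime_factors ?E. \<Sum>i\<in>Ip P. 1 / real P ^ ?m P i)"
    using D(1) i0 s1 by (simp add: sum.remove)
  also have "\<dots> \<le> 1 / real (ord (u i0)) + (\<Sum>P\<in>prime_factors ?E. (\<Sum>j\<in>primary_indices P. 1 - 1 / real P ^ idx_exp P j) + 1 / real P ^ exp_exp P - 1 / real P ^ ?m P i0)"
    using bd by (intro add_left_mono sum_mono) (simp add: algebra_simps)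
  also have "\<dots> = kst + (\<Sum>P\<in>prime_factors ?E. 1 / real P ^ exp_exp P) + ((\<Prod>P\<in>prime_factors ?E. 1 / real P ^ ?m P i0) - (\<Sum>P\<in>prime_factors ?E. 1 / real P ^ ?m P i0))"
    using inverse_eq_prod_primes[OF ord_dvd_exp[OF D(3)[OF i0]]] by (simp add: kst_eq sum.distrib sum_subtractf)
  also have "\<dots> \<le> kst + (\<Sum>P\<in>prime_factors ?E. 1 / real P ^ exp_exp P) + ((\<Prod>P\<in>prime_factors ?E. 1 / real P ^ exp_exp P) - (\<Sum>P\<in>prime_factors ?E. 1 / real P ^ exp_exp P))"
  proof (intro add_left_mono prod_minus_sum_mono)
    fix P assume "P \<in> prime_factors ?E"
    then have P: "prime P" by (auto simp: in_prime_factors_iff)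
    have P1: "real P \<ge> 1" using prime_gt_0_nat[OF P] by simp
    have "?m P i0 \<le> exp_exp P" by (rule ord_exp_le[OF D(3)[OF i0] P])
    then have "real P ^ ?m P i0 \<le> real P ^ exp_exp P" using P1 by (rule power_increasing)
    moreover have "1 \<le> real P ^ ?m P i0" using P1 by simp
    ultimately show "0 \<le> 1 / real P ^ exp_exp P \<and> 1 / real P ^ exp_exp P \<le> 1 / real P ^ ?m P i0 \<and> 1 / real P ^ ?m P i0 \<le> 1"
      using P1 by (auto simp: divide_simps)
  qed simp
  also have "\<dots> = kst + 1 / real ?E" using inverse_eq_prod_primes[of ?E] by simp
  finally show ?thesis .
qed

end

lemma eq_prime_powers_of_dvd:
  fixes p q :: nat
  assumes "prime p" "prime q" "p \<noteq> q" and n: "n dvd p ^ e * q ^ k" "n > 0"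
  shows "n = p ^ multiplicity p n * q ^ multiplicity q n"
proof -
  have "prime_factors n \<subseteq> {p, q}"
  proof
    fix P assume "P \<in> prime_factors n"
    then have P: "prime P" "P dvd n" by (auto simp: in_prime_factors_iff)
    then have "P dvd p ^ e * q ^ k" using n dvd_trans by blast
    then have "P dvd p \<or> P dvd q" using P by (meson prime_dvd_mult_iff prime_dvd_power)
    then show "P \<in> {p, q}" using P assms by (auto dest: primes_dvd_imp_eq)
  qed
  then have "(\<Prod>P\<in>prime_factors n. P ^ multiplicity P n) = (\<Prod>P\<in>{p, q}. P ^ multiplicity P n)"
    using n assms by (intro prod.mono_neutral_left) (auto simp: in_prime_factors_iff not_dvd_imp_multiplicity_0)
  moreover have "n = (\<Prod>P\<in>prime_factors n. P ^ multiplicity P n)" using n by (simp add: prime_factorization_nat)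
  ultimately show ?thesis using assms by simp
qed

context coordinate_group
begin

text \<open>The standard example: \<open>ns ! j - 1\<close> copies of each basis element
  \<open>e j\<close>, and one \<open>g\<close> with all coordinates 1. The order of \<open>g\<close>
  is the exponent.\<close>

theorem ex_extremal:
  "\<exists>U. minimal_zero_sum G U \<and> cross_number G U = kst + 1 / real (group_exp G)"
proof -
  let ?r = "length ns"
  have "\<forall>j. \<exists>x. x \<in> carrier G \<and> (\<forall>i<?r. [X x i = of_bool (i = j)] (mod ns ! i))"
    using X_surj[of "\<lambda>i. of_bool (i = _)"] by (metis (no_types, lifting) X_surj)
  then obtain e where e: "\<And>j. e j \<in> carrier G" "\<And>i j. i < ?r \<Longrightarrow> [X (e j) i = of_bool (i = j)] (mod ns ! i)"
    by metis
  obtain g where g: "g \<in> carrier G" "\<And>i. i < ?r \<Longrightarrow> [X g i = 1] (mod ns ! i)" using X_surj[of "\<lambda>_. 1"] by blast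
  have oe: "ord (e j) = ns ! j" if j: "j < ?r" for j
  proof -
    have "ord (e j) dvd n \<longleftrightarrow> ns ! j dvd n" for n
    proof -
      have "ns ! i dvd n * X (e j) i \<longleftrightarrow> ns ! i dvd n * of_bool (i = j)" if "i < ?r" for i
        using e(2)[OF that, of j] by (intro cong_dvd_iff cong_mult) auto
      then have "ord (e j) dvd n \<longleftrightarrow> (\<forall>i<?r. ns ! i dvd n * of_bool (i = j))"
        unfolding ord_dvd_iff[OF e(1)] by blast
      also have "\<dots> \<longleftrightarrow> ns ! j dvd n" using j by auto
      finally show ?thesis .
    qed
    then show ?thesis by (meson dvd_antisym dvd_refl)
  qed
  have og: "ord g = group_exp G"
  proof -
    have "ord g dvd n \<longleftrightarrow> group_exp G dvd n" for n
    proof -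
      have "ns ! i dvd n * X g i \<longleftrightarrow> ns ! i dvd n * 1" if "i < ?r" for i
        using g(2)[OF that] by (intro cong_dvd_iff cong_mult) auto
      then show ?thesis unfolding ord_dvd_iff[OF g(1)] exp_dvd_iff by auto
    qed
    then show ?thesis by (meson dvd_antisym dvd_refl)
  qed
  \<comment> \<open>The index \<open>(?r, 0)\<close> stands for \<open>g\<close>, and
    \<open>(j, l)\<close> for the \<open>l\<close>-th copy of \<open>e j\<close>.\<close>
  define I where "I = insert (?r, 0) (SIGMA j:{..<?r}. {..<ns ! j - 1})"
  define u where "u = (\<lambda>(j, l::nat). if j = ?r then g else e j)"
  have finI: "finite I" by (simp add: I_def)
  have uc: "u i \<in> carrier G" for i using e g by (auto simp: u_def split: prod.splits)
  define A where "A = (\<lambda>j (T :: (nat \<times> nat) set). {i \<in> T. fst i = j \<or> i = (?r, 0)})"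
  have AI: "A j I = insert (?r, 0) ({j} \<times> {..<ns ! j - 1})" if "j < ?r" for j
    using that by (auto simp: A_def I_def)
  have cAI: "card (A j I) = ns ! j" if "j < ?r" for j
    using that ns_pos[OF that] by (subst AI[OF that], subst card_insert_disjoint) (auto simp: card_cartesian_product)
  have sumX: "[(\<Sum>i\<in>T. X (u i) j) = card (A j T)] (mod ns ! j)" if T: "T \<subseteq> I" and j: "j < ?r" for T j
  proof -
    have finT: "finite T" using T finI finite_subset by blast
    have "[(\<Sum>i\<in>T. X (u i) j) = (\<Sum>i\<in>T. of_bool (fst i = j \<or> i = (?r, 0)))] (mod ns ! j)"
    proof (rule cong_sum)
      fix i assume "i \<in> T"
      then have "i \<in> I" using T by blast
      then show "[X (u i) j = of_bool (fst i = j \<or> i = (?r, 0))] (mod ns ! j)"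
        using e(2)[OF j, of "fst i"] g(2)[OF j] j by (auto simp: I_def u_def eq_commute)
    qed
    also have "(\<Sum>i\<in>T. of_bool (fst i = j \<or> i = (?r, 0))) = card (A j T)"
    proof -
      have "(\<Sum>i\<in>T. of_bool (fst i = j \<or> i = (?r, 0))) = (\<Sum>i\<in>{i \<in> T. fst i = j \<or> i = (?r, 0)}. 1 :: nat)"
        unfolding of_bool_def by (rule sum.inter_filter[OF finT, symmetric])
      then show ?thesis by (simp only: A_def card_eq_sum)
    qed
    finally show ?thesis .
  qed
  have zero_iff: "finprod G u T = \<one> \<longleftrightarrow> (\<forall>j<?r. ns ! j dvd card (A j T))" if T: "T \<subseteq> I" for T
  proof -
    have "finite T" using T finI finite_subset by blast
    then have "finprod G u T = \<one> \<longleftrightarrow> (\<forall>j<?r. ns ! j dvd (\<Sum>i\<in>T. X (u i) j))"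
      using uc by (intro finprod_eq_one_iff) auto
    then show ?thesis using cong_dvd_iff[OF sumX[OF T]] by blast
  qed
  have min: "T = {} \<or> T = I" if T: "T \<subseteq> I" and z: "finprod G u T = \<one>" for T
  proof -
    have finA: "finite (A j I)" for j using finI by (simp add: A_def)
    \<comment> \<open>The number of indices with \<open>j\<close>-th coordinate 1 is a multiple of
      \<open>ns ! j\<close> and at most \<open>ns ! j\<close>, so all or none occur. As
      \<open>g\<close> belongs to every such set, the alternative is the same for all
      \<open>j\<close>.\<close>
    have dich: "A j T = {} \<or> A j T = A j I" if j: "j < ?r" for j
    proof -
      have sub: "A j T \<subseteq> A j I" using T by (auto simp: A_def)
      have "ns ! j dvd card (A j T)" using z zero_iff[OF T] j by blast
      moreover have "card (A j T) \<le> ns ! j" using card_mono[OF finA sub] cAI[OF j] by simp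
      ultimately have "card (A j T) = 0 \<or> card (A j T) = ns ! j" using dvd_imp_le by fastforce
      then show ?thesis
      proof
        assume "card (A j T) = 0"
        then show ?thesis using finite_subset[OF sub finA] by simp
      next
        assume "card (A j T) = ns ! j"
        then show ?thesis using card_subset_eq[OF finA sub] cAI[OF j] by simp
      qed
    qed
    show ?thesis
    proof (cases "(?r, 0) \<in> T")
      case True
      have "I \<subseteq> T"
      proof
        fix i assume i: "i \<in> I"
        show "i \<in> T"
        proof (cases "i = (?r, 0)")
          case False
          then have j: "fst i < ?r" using i by (auto simp: I_def)
          have "(?r, 0) \<in> A (fst i) T" using True by (simp add: A_def)
          then have "A (fst i) T = A (fst i) I" using dich[OF j] by blast
          moreover have "i \<in> A (fst i) I" using i by (simp add: A_def)
          ultimately show ?thesis by (auto simp: A_def)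
        qed (use True in simp)
      qed
      then show ?thesis using T by blast
    next
      case False
      have "i \<notin> T" for i
      proof
        assume i: "i \<in> T"
        then have j: "fst i < ?r" using T False by (auto simp: I_def)
        have "(?r, 0) \<in> A (fst i) I" by (simp add: A_def I_def)
        moreover have "(?r, 0) \<notin> A (fst i) T" using False by (simp add: A_def)
        ultimately have "A (fst i) T = {}" using dich[OF j] by blast
        moreover have "i \<in> A (fst i) T" using i by (simp add: A_def)
        ultimately show False by simp
      qed
      then show ?thesis by blast
    qed
  qed
  have "finprod G u I = \<one>" using zero_iff[of I] cAI by simp
  then have "minimal_zero_index u I"
    unfolding minimal_zero_index_def using finI uc min by (auto simp: I_def)
  then have "minimal_zero_sum G (image_mset u (mset_set I))" using minimal_zero_sum_iff_index[OF finI] by blast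
  moreover have "cross_number G (image_mset u (mset_set I)) = kst + 1 / real (group_exp G)"
  proof -
    have "cross_number G (image_mset u (mset_set I)) = (\<Sum>i\<in>I. 1 / real (ord (u i)))"
      by (rule cross_number_image_mset_set[OF finI])
    also have "\<dots> = 1 / real (ord (u (?r, 0))) + (\<Sum>i\<in>(SIGMA j:{..<?r}. {..<ns ! j - 1}). 1 / real (ord (u i)))"
      unfolding I_def by (subst sum.insert) auto
    also have "(\<Sum>i\<in>(SIGMA j:{..<?r}. {..<ns ! j - 1}). 1 / real (ord (u i))) = (\<Sum>j<?r. \<Sum>l<ns ! j - 1. 1 / real (ord (u (j, l))))"
      by (subst sum.Sigma) (auto intro!: sum.cong)
    also have "\<dots> = kst" unfolding kst_def
    proof (rule sum.cong[OF refl])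
      fix j assume "j \<in> {..<?r}"
      then have j: "j < ?r" by simp
      have "(\<Sum>l<ns ! j - 1. 1 / real (ord (u (j, l)))) = real (ns ! j - 1) / real (ns ! j)"
        using j oe by (simp add: u_def)
      also have "\<dots> = 1 - 1 / real (ns ! j)" using ns_pos[OF j] by (simp add: of_nat_diff field_simps)
      finally show "(\<Sum>l<ns ! j - 1. 1 / real (ord (u (j, l)))) = 1 - 1 / real (ns ! j)" .
    qed
    finally show ?thesis using og by (simp add: u_def)
  qed
  ultimately show ?thesis by blast
qed

section \<open>Sequences with two mixed terms\<close>

text \<open>The exponent \<open>k = 0\<close> is allowed, so the identity does not count as
  mixed.\<close>

abbreviation mixed :: "'a \<Rightarrow> bool" where
  "mixed x \<equiv> \<not> (\<exists>P k. prime P \<and> ord x = P ^ k)"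

text \<open>A covering without \<open>i\<close> would give a nonempty zero-sum subset of the
  remaining indices. The numbers \<open>y i\<close> are coordinates in a cyclic group of order
  \<open>n\<close> that replaces all coordinates outside the \<open>p\<close>-part.\<close>

lemma minimal_index_no_cover:
  fixes u :: "'i \<Rightarrow> 'a"
  assumes M: "minimal_zero_index u I" and i: "i \<in> I" and p: "prime p"
    and n: "n > 0" "\<not> p dvd n" and d: "\<And>i. i \<in> I \<Longrightarrow> n dvd d i * y i"
    and y: "\<And>T. T \<subseteq> I \<Longrightarrow> n dvd (\<Sum>i\<in>T. y i) \<Longrightarrow>
        \<forall>j<length ns. j \<notin> primary_indices p \<longrightarrow> ns ! j dvd (\<Sum>i\<in>T. X (u i) j)"
    and cov: "\<forall>c. (\<Sum>j\<in>primary_indices p. p ^ exp_exp p - p ^ (exp_exp p - idx_exp p j)) + 1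
      \<le> cover_height (\<lambda>i. p ^ (exp_exp p - multiplicity p (ord (u i)))) d t (I - {i}) c"
  shows False
proof -
  note D = minimal_indexD[OF M]
  let ?J = "primary_indices p"
  have "\<exists>T. T \<subseteq> I - {i} \<and> T \<noteq> {} \<and> (\<forall>j\<in>?J. p ^ idx_exp p j dvd (\<Sum>i\<in>T. X (u i) j)) \<and> n dvd (\<Sum>i\<in>T. y i)"
  proof (rule weighted_cover_zero_subsum[where d = d and t = t and e = "exp_exp p"
        and m = "\<lambda>i. multiplicity p (ord (u i))", OF p finite_primary_indices])
    show "finite (I - {i})" using D by simp
    show "idx_exp p j \<le> exp_exp p" if "j \<in> ?J" for j using that idx_exp_le p by (auto simp: primary_indices_def)
    show "multiplicity p (ord (u i')) \<le> exp_exp p" if "i' \<in> I - {i}" for i' using that ord_exp_le D(3) p by auto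
    show "p ^ idx_exp p j dvd p ^ multiplicity p (ord (u i')) * X (u i') j" if "i' \<in> I - {i}" "j \<in> ?J" for i' j
      using that primary_dvd[OF p] D(3) by auto
    show "(\<Sum>j\<in>?J. p ^ exp_exp p - p ^ (exp_exp p - idx_exp p j))
      < cover_height (\<lambda>i. p ^ (exp_exp p - multiplicity p (ord (u i)))) d t (I - {i}) c" for c
      using cov by (metis Suc_eq_plus1 Suc_le_eq)
  qed (use n d in auto)
  then obtain T where T: "T \<subseteq> I - {i}" "T \<noteq> {}" "\<forall>j\<in>?J. p ^ idx_exp p j dvd (\<Sum>i\<in>T. X (u i) j)" "n dvd (\<Sum>i\<in>T. y i)"
    by blast
  have "ns ! j dvd (\<Sum>i\<in>T. X (u i) j)" if j: "j < length ns" for j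
  proof (cases "j \<in> ?J")
    case True
    show ?thesis by (subst ns_eq_power[OF p True]) (use T True in blast)
  next
    case False
    then show ?thesis using y[of T] T j by blast
  qed
  moreover have "T \<subset> I" using T i by blast
  ultimately show False using D(5) T(2) by blast
qed

text \<open>The covering is used with height \<open>B + 1\<close>, one more than the weight that a
  zero-sum free sequence over the p-part can have, and with \<open>N = p ^ e\<close>, the largest
  possible weight. The area condition is then k(U) >= K^*(G) multiplied by
  \<open>p ^ e * q ^ k\<close>.\<close>

theorem mixed_bound_prime_power:
  fixes u :: "'i \<Rightarrow> 'a"
  assumes M: "minimal_zero_index u I" and pq: "prime p" "prime q" "p \<noteq> q"
    and j0: "j0 < length ns" "ns ! j0 = q ^ k" and J: "\<And>j. j < length ns \<Longrightarrow> j \<noteq> j0 \<Longrightarrow> p dvd ns ! j"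
    and i12: "i1 \<in> I" "i2 \<in> I" "i1 \<noteq> i2" "mixed (u i1)" "mixed (u i2)"
  shows "(\<Sum>i\<in>I. 1 / real (ord (u i))) < kst + 1 / real (group_exp G)"
proof (rule ccontr)
  assume neg: "\<not> ?thesis"
  note D = minimal_indexD[OF M]
  let ?J = "primary_indices p"
  define e where "e = exp_exp p"
  define m where "m = (\<lambda>i. multiplicity p (ord (u i)))"
  define b where "b = (\<lambda>i. multiplicity q (ord (u i)))"
  have k: "k > 0" using primepow_ns[OF j0(1)] j0(2) by (metis gr0I not_primepow_Suc_0_nat One_nat_def power_0)
  have pnq: "\<not> p dvd q ^ k" using pq by (metis prime_dvd_power primes_dvd_imp_eq)
  have J_eq: "?J = {..<length ns} - {j0}" using J j0 pnq by (auto simp: primary_indices_def)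
  have p0: "p > 0" "q > 0" "p \<ge> 2" "q \<ge> 2" using pq prime_gt_0_nat prime_ge_2_nat by auto
  have E: "group_exp G = p ^ e * q ^ k"
  proof (rule dvd_antisym)
    show "group_exp G dvd p ^ e * q ^ k"
      unfolding exp_dvd_iff
    proof (intro allI impI)
      fix j assume j: "j < length ns"
      show "ns ! j dvd p ^ e * q ^ k"
      proof (cases "j = j0")
        case False
        then have jJ: "j \<in> ?J" using j J_eq by simp
        have "p ^ idx_exp p j dvd p ^ e" using idx_exp_le[OF j pq(1)] by (simp add: e_def le_imp_power_dvd)
        then have "ns ! j dvd p ^ e" using ns_eq_power[OF pq(1) jJ] by simp
        then show ?thesis by simp
      qed (use j0 in simp)
    qed
    have "coprime (p ^ e) (q ^ k)" using pq by (simp add: primes_coprime)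
    moreover have "p ^ e dvd group_exp G" by (simp add: e_def multiplicity_dvd)
    moreover have "q ^ k dvd group_exp G" using ns_dvd_exp[OF j0(1)] j0(2) by simp
    ultimately show "p ^ e * q ^ k dvd group_exp G" by (simp add: divides_mult)
  qed
  have ords: "ord (u i) = p ^ m i * q ^ b i" if "i \<in> I" for i
    unfolding m_def b_def
    by (rule eq_prime_powers_of_dvd[OF pq, of _ e k]) (use ord_dvd_exp[OF D(3)[OF that]] E ord_pos[OF D(3)[OF that]] in auto)
  have me: "m i \<le> e" if "i \<in> I" for i unfolding m_def e_def by (rule ord_exp_le[OF D(3)[OF that] pq(1)])
  have bk: "b i \<le> k" if "i \<in> I" for i
  proof -
    have "exp_exp q = k"
      unfolding E using pq p0 by (subst multiplicity_prime_elem_times_other) (auto simp: multiplicity_prime_power dest: primes_dvd_imp_eq prime_dvd_power)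
    then show ?thesis unfolding b_def using ord_exp_le[OF D(3)[OF that] pq(2)] by simp
  qed
  define w where "w = (\<lambda>i. p ^ (e - m i))"
  define B where "B = (\<Sum>j\<in>?J. p ^ e - p ^ (e - idx_exp p j))"
  have Jle: "idx_exp p j \<le> e" if "j \<in> ?J" for j using that idx_exp_le pq by (auto simp: primary_indices_def e_def)
  have Breal: "real B = (\<Sum>j\<in>?J. 1 - 1 / real (ns ! j)) * real p ^ e"
    unfolding B_def of_nat_sum sum_distrib_right
  proof (rule sum.cong[OF refl])
    fix j assume j: "j \<in> ?J"
    have "p ^ (e - idx_exp p j) \<le> p ^ e" using p0 by (intro power_increasing) auto
    moreover have "real (p ^ (e - idx_exp p j)) = real p ^ e / real p ^ idx_exp p j"
      using p0 Jle[OF j] by (subst of_nat_power) (simp add: power_diff)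
    moreover have "real (ns ! j) = real p ^ idx_exp p j" by (subst ns_eq_power[OF pq(1) j]) simp
    ultimately show "real (p ^ e - p ^ (e - idx_exp p j)) = (1 - 1 / real (ns ! j)) * real p ^ e"
      by (simp add: of_nat_diff left_diff_distrib)
  qed
  have kst: "kst = (\<Sum>j\<in>?J. 1 - 1 / real (ns ! j)) + (1 - 1 / real q ^ k)"
    unfolding kst_def J_eq using j0 by (simp add: sum.remove[of "{..<length ns}" j0])
  have area: "(B + 1) * q ^ k + (p ^ e - 1) * (q ^ k - 1) \<le> (\<Sum>i\<in>I. w i * q ^ (k - b i))"
  proof -
    define N where "N = real p ^ e"
    define Q where "Q = real q ^ k"
    have NQ: "N > 0" "Q > 0" using p0 by (auto simp: N_def Q_def)
    have "real (\<Sum>i\<in>I. w i * q ^ (k - b i)) = (\<Sum>i\<in>I. 1 / real (ord (u i))) * (N * Q)"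
      unfolding of_nat_sum sum_distrib_right
    proof (rule sum.cong[OF refl])
      fix i assume i: "i \<in> I"
      have "real (w i) = N / real p ^ m i"
        unfolding w_def N_def using p0 me[OF i] by (subst of_nat_power) (simp add: power_diff)
      moreover have "real (q ^ (k - b i)) = Q / real q ^ b i"
        unfolding Q_def using p0 bk[OF i] by (subst of_nat_power) (simp add: power_diff)
      moreover have "real (ord (u i)) = real p ^ m i * real q ^ b i" using ords[OF i] by simp
      ultimately show "real (w i * q ^ (k - b i)) = 1 / real (ord (u i)) * (N * Q)" by simp
    qed
    moreover have "(kst + 1 / real (group_exp G)) * (N * Q) \<le> (\<Sum>i\<in>I. 1 / real (ord (u i))) * (N * Q)"
      using neg NQ by (intro mult_right_mono) auto
    moreover have "(kst + 1 / real (group_exp G)) * (N * Q) = real B * Q + N * Q - N + 1"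
    proof -
      have "real (group_exp G) = N * Q" unfolding E by (simp add: N_def Q_def)
      moreover have "real B = (\<Sum>j\<in>?J. 1 - 1 / real (ns ! j)) * N" using Breal by (simp add: N_def)
      ultimately show ?thesis unfolding kst using NQ by (simp add: Q_def[symmetric] field_simps)
    qed
    moreover have "real ((B + 1) * q ^ k + (p ^ e - 1) * (q ^ k - 1)) = (real B + 1) * Q + (N - 1) * (Q - 1)"
      using p0 by (simp add: of_nat_diff N_def Q_def Suc_leI distrib_right)
    moreover have "(real B + 1) * Q + (N - 1) * (Q - 1) = real B * Q + N * Q - N + 1" by (simp add: algebra_simps)
    ultimately have "real ((B + 1) * q ^ k + (p ^ e - 1) * (q ^ k - 1)) \<le> real (\<Sum>i\<in>I. w i * q ^ (k - b i))" by linarith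
    then show ?thesis by (simp only: of_nat_le_iff)
  qed
  have mb: "m i \<ge> 1 \<and> b i \<ge> 1" if "i \<in> I" "mixed (u i)" for i
  proof -
    have "m i \<noteq> 0" "b i \<noteq> 0" using that(2) ords[OF that(1)] pq by (metis mult_1 power_0, metis mult_1_right power_0)
    then show ?thesis by simp
  qed
  \<comment> \<open>A mixed term has order divisible by \<open>p\<close>, so its weight is at most
    \<open>p ^ e\<close> divided by \<open>p\<close>.\<close>
  have w2: "2 * w i \<le> p ^ e" if "i \<in> I" "mixed (u i)" for i
  proof -
    have "e = (e - m i) + 1 + (m i - 1)" using mb[OF that] me[OF that(1)] by simp
    then have "p ^ e = p ^ (e - m i) * p * p ^ (m i - 1)" by (metis power_add power_one_right)
    moreover have "p ^ (e - m i) * 2 * 1 \<le> p ^ (e - m i) * p * p ^ (m i - 1)"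
      using p0 by (intro mult_le_mono) auto
    ultimately show ?thesis by (simp add: w_def)
  qed
  have "\<exists>i\<in>I. \<exists>t. \<forall>c. B + 1 \<le> cover_height w (\<lambda>i. q ^ b i) t (I - {i}) c"
  proof (rule prime_power_cover[where N = "p ^ e" and k = k, OF p0(4) D(1) _ bk i12(1-3) _ _ w2 w2 _ _ area])
    show "w i \<le> p ^ e" for i unfolding w_def using p0 by (intro power_increasing) auto
  qed (use mb i12 p0 in auto)
  then obtain i t where it: "i \<in> I" "\<forall>c. B + 1 \<le> cover_height w (\<lambda>i. q ^ b i) t (I - {i}) c" by blast
  show False
  proof (rule minimal_index_no_cover[OF M it(1) pq(1), where n = "q ^ k" and y = "\<lambda>i. X (u i) j0" and d = "\<lambda>i. q ^ b i" and t = t])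
    show "\<forall>c. (\<Sum>j\<in>?J. p ^ exp_exp p - p ^ (exp_exp p - idx_exp p j)) + 1
      \<le> cover_height (\<lambda>i. p ^ (exp_exp p - multiplicity p (ord (u i)))) (\<lambda>i. q ^ b i) t (I - {i}) c"
      using it(2) unfolding B_def w_def m_def e_def .
    have jq: "j0 \<in> primary_indices q" using j0 k by (simp add: primary_indices_def)
    have "idx_exp q j0 = k" using j0(2) pq(2) by (simp add: multiplicity_prime_power)
    then show "q ^ k dvd q ^ b i * X (u i) j0" if "i \<in> I" for i
      using primary_dvd[OF pq(2) D(3)[OF that] jq] by (simp add: b_def)
    show "\<forall>j<length ns. j \<notin> ?J \<longrightarrow> ns ! j dvd (\<Sum>i\<in>T. X (u i) j)" if "q ^ k dvd (\<Sum>i\<in>T. X (u i) j0)" for T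
      using that J_eq j0 by auto
  qed (use p0 pnq in auto)
qed

text \<open>The group algebra handles \<open>p\<close>, and the other two primes form a cyclic
  complement of order \<open>q * r\<close>. The height to reach is \<open>p\<close>, because a group
  of order \<open>p\<close> admits weight at most \<open>p - 1\<close>.\<close>

theorem mixed_bound_three_primes:
  fixes u :: "'i \<Rightarrow> 'a"
  assumes M: "minimal_zero_index u I" and pr: "prime p" "prime q" "prime r" "p \<noteq> q" "p \<noteq> r" "q \<noteq> r"
    and j: "{..<length ns} = {jp, jq, jr}" "ns ! jp = p" "ns ! jq = q" "ns ! jr = r"
    and i12: "i1 \<in> I" "i2 \<in> I" "i1 \<noteq> i2" "mixed (u i1)" "mixed (u i2)"
  shows "(\<Sum>i\<in>I. 1 / real (ord (u i))) < kst + 1 / real (group_exp G)"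
proof (rule ccontr)
  assume neg: "\<not> ?thesis"
  note D = minimal_indexD[OF M]
  have ge2: "p \<ge> 2" "q \<ge> 2" "r \<ge> 2" using pr prime_ge_2_nat by auto
  have jl: "jp < length ns" "jq < length ns" "jr < length ns" using j(1) by auto
  have jd: "jp \<noteq> jq" "jp \<noteq> jr" "jq \<noteq> jr" using j pr by auto
  have all_j: "(\<forall>i<length ns. Q i) \<longleftrightarrow> Q jp \<and> Q jq \<and> Q jr" for Q
  proof -
    have "(\<forall>i<length ns. Q i) \<longleftrightarrow> (\<forall>i\<in>{..<length ns}. Q i)" by auto
    then show ?thesis unfolding j(1) by simp
  qed
  have cop: "coprime p q" "coprime p r" "coprime q r" using pr by (auto simp: primes_coprime)
  have E: "group_exp G = p * q * r"
  proof (rule dvd_antisym)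
    show "group_exp G dvd p * q * r" unfolding exp_dvd_iff all_j using j by auto
    have d: "p dvd group_exp G" "q dvd group_exp G" "r dvd group_exp G" using ns_dvd_exp jl j by metis+
    then have "p * q dvd group_exp G" using cop by (simp add: divides_mult)
    then show "p * q * r dvd group_exp G" using d cop by (intro divides_mult) auto
  qed
  have dist: "\<not> p dvd q" "\<not> p dvd r" "\<not> q dvd p" "\<not> q dvd r" "\<not> r dvd p" "\<not> r dvd q"
    using pr by (auto dest: primes_dvd_imp_eq)
  have prim: "primary_indices p = {jp}" "primary_indices q = {jq}" "primary_indices r = {jr}"
  proof -
    have "primary_indices P = {i \<in> {jp, jq, jr}. P dvd ns ! i}" for P
      unfolding j(1)[symmetric] by (auto simp: primary_indices_def)
    then show "primary_indices p = {jp}" "primary_indices q = {jq}" "primary_indices r = {jr}"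
      using j(2-4) dist jd by auto
  qed
  have idx: "idx_exp p jp = 1" "idx_exp q jq = 1" "idx_exp r jr = 1"
    using j pr by (simp_all add: prime_gt_0_nat multiplicity_self prime_gt_1_nat)
  have ex: "exp_exp p = 1"
  proof -
    have "\<exists>j\<in>primary_indices p. idx_exp p j = exp_exp p" by (rule ex_max_index) (use pr E in auto)
    then show ?thesis using prim idx by simp
  qed
  have exq: "exp_exp q = 1"
  proof -
    have "\<exists>j\<in>primary_indices q. idx_exp q j = exp_exp q" by (rule ex_max_index) (use pr E in auto)
    then show ?thesis using prim idx by simp
  qed
  have exr: "exp_exp r = 1"
  proof -
    have "\<exists>j\<in>primary_indices r. idx_exp r j = exp_exp r" by (rule ex_max_index) (use pr E in auto)
    then show ?thesis using prim idx by simp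
  qed
  define m where "m = (\<lambda>P i. multiplicity P (ord (u i)))"
  define w where "w = (\<lambda>i. p ^ (1 - m p i))"
  define d where "d = (\<lambda>i. q ^ m q i * r ^ m r i)"
  have m1: "m p i \<le> 1" "m q i \<le> 1" "m r i \<le> 1" if "i \<in> I" for i
    using ord_exp_le[OF D(3)[OF that]] pr ex exq exr by (metis m_def)+
  have ords: "ord (u i) = p ^ m p i * d i" if i: "i \<in> I" for i
  proof -
    have "prime_factors (group_exp G) = {p, q, r}"
    proof
      show "{p, q, r} \<subseteq> prime_factors (group_exp G)" using pr exp_pos by (auto simp: in_prime_factors_iff E)
      show "prime_factors (group_exp G) \<subseteq> {p, q, r}"
      proof
        fix P assume "P \<in> prime_factors (group_exp G)"
        then have "prime P" "P dvd p * q * r" by (auto simp: in_prime_factors_iff E)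
        then have "P dvd p \<or> P dvd q \<or> P dvd r" by (simp add: prime_dvd_mult_iff)
        then show "P \<in> {p, q, r}" using primes_dvd_imp_eq \<open>prime P\<close> pr by blast
      qed
    qed
    then have "1 / real (ord (u i)) = (\<Prod>P\<in>{p, q, r}. 1 / real P ^ m P i)"
      using inverse_eq_prod_primes[OF ord_dvd_exp[OF D(3)[OF i]]] by (simp add: m_def)
    also have "\<dots> = 1 / real (p ^ m p i * d i)" using pr by (simp add: d_def)
    finally have "real (ord (u i)) = real (p ^ m p i * d i)" by (metis inverse_eq_divide inverse_inverse_eq)
    then show ?thesis by (simp only: of_nat_eq_iff)
  qed
  have notone: "ord (u i) \<noteq> 1" if i: "i \<in> I" for i
  proof
    assume "ord (u i) = 1"
    then have "u i = \<one>" using ord_eq_1 D(3) i by blast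
    then have "finprod G u {i} = \<one>" using D(3) i by simp
    moreover have "{i} \<subset> I" using i i12 by blast
    ultimately show False using M by (auto simp: minimal_zero_index_def)
  qed
  have dcases: "d i \<in> {1, q, r, q * r}" if "i \<in> I" for i
    using m1(2,3)[OF that] by (auto simp: d_def le_Suc_eq)
  have wcases: "(w i = 1 \<and> m p i = 1) \<or> (w i = p \<and> m p i = 0)" if "i \<in> I" for i
    using m1(1)[OF that] by (auto simp: w_def le_Suc_eq)
  \<comment> \<open>These are the terms of composite order; every mixed term is among them.\<close>
  define Y where "Y = {i \<in> I. d i = q * r \<or> (w i = 1 \<and> d i \<noteq> 1)}"
  have mixY: "i \<in> Y" if i: "i \<in> I" "mixed (u i)" for i
  proof (rule ccontr)
    assume "i \<notin> Y"
    then have nY: "d i \<noteq> q * r" "w i \<noteq> 1 \<or> d i = 1" using i by (auto simp: Y_def)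
    have "\<exists>P k. prime P \<and> ord (u i) = P ^ k"
    proof (cases "d i = 1")
      case True
      then show ?thesis using ords[OF i(1)] pr by auto
    next
      case False
      then have "m p i = 0" using nY wcases[OF i(1)] by auto
      then have "ord (u i) = q ^ 1 \<or> ord (u i) = r ^ 1" using ords[OF i(1)] dcases[OF i(1)] False nY by auto
      then show ?thesis using pr by blast
    qed
    then show False using i by blast
  qed
  have kst: "kst = 3 - 1 / real p - 1 / real q - 1 / real r"
    unfolding kst_def j(1) using jd j by simp
  have area: "3 * p * q * r + 1 \<le> (\<Sum>i\<in>I. w i * (q * r div d i)) + q * r + p * r + p * q"
  proof -
    have pos: "real p > 0" "real q > 0" "real r > 0" using ge2 by auto
    have "real (\<Sum>i\<in>I. w i * (q * r div d i)) = (\<Sum>i\<in>I. 1 / real (ord (u i))) * (real p * real q * real r)"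
      unfolding of_nat_sum sum_distrib_right
    proof (rule sum.cong[OF refl])
      fix i assume i: "i \<in> I"
      have "d i dvd q * r" using dcases[OF i] by auto
      then have "real (q * r div d i) = real q * real r / real (d i)" by (simp add: real_of_nat_div)
      moreover have "real (w i) = real p / real p ^ m p i"
        using wcases[OF i] pos by auto
      ultimately show "real (w i * (q * r div d i)) = 1 / real (ord (u i)) * (real p * real q * real r)"
        using ords[OF i] by simp
    qed
    moreover have "(kst + 1 / real (group_exp G)) * (real p * real q * real r) \<le> (\<Sum>i\<in>I. 1 / real (ord (u i))) * (real p * real q * real r)"
      using neg pos by (intro mult_right_mono) auto
    moreover have "(kst + 1 / real (group_exp G)) * (real p * real q * real r)
        = 3 * real p * real q * real r + 1 - real q * real r - real p * real r - real p * real q"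
      unfolding kst E using pos by (simp add: field_simps)
    ultimately have "real (3 * p * q * r + 1) \<le> real ((\<Sum>i\<in>I. w i * (q * r div d i)) + q * r + p * r + p * q)"
      by simp
    then show ?thesis by (simp only: of_nat_le_iff)
  qed
  have "\<exists>i\<in>I. \<exists>t. \<forall>c. p \<le> cover_height w d t (I - {i}) c"
  proof (rule two_prime_grid_cover[OF ge2 cop(3) D(1) _ i12(1-3) _ _ Y_def area])
    fix i assume i: "i \<in> I"
    have "d i \<noteq> 1" if "w i = p"
    proof
      assume "d i = 1"
      moreover have "m p i = 0" using that wcases[OF i] ge2 by auto
      ultimately show False using ords[OF i] notone[OF i] by simp
    qed
    then show "(w i = 1 \<or> w i = p) \<and> d i \<in> {1, q, r, q * r} \<and> (w i = p \<longrightarrow> d i \<noteq> 1)"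
      using wcases[OF i] dcases[OF i] by blast
  qed (use mixY i12 in auto)
  then obtain i t where it: "i \<in> I" "\<forall>c. p \<le> cover_height w d t (I - {i}) c" by blast
  \<comment> \<open>The Chinese remainder theorem merges the two coordinates into one coordinate
    modulo \<open>q * r\<close>.\<close>
  have "\<forall>i. \<exists>y. [y = X (u i) jq] (mod q) \<and> [y = X (u i) jr] (mod r)"
    using binary_chinese_remainder_nat[OF cop(3)] by blast
  then obtain y where y: "\<And>i. [y i = X (u i) jq] (mod q)" "\<And>i. [y i = X (u i) jr] (mod r)" by metis
  have qr_dvd: "q * r dvd z" if "q dvd z" "r dvd z" for z using that cop by (simp add: divides_mult)
  show False
  proof (rule minimal_index_no_cover[OF M it(1) pr(1), where n = "q * r" and y = y and d = d and t = t])
    show "\<forall>c. (\<Sum>j\<in>primary_indices p. p ^ exp_exp p - p ^ (exp_exp p - idx_exp p j)) + 1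
      \<le> cover_height (\<lambda>i. p ^ (exp_exp p - multiplicity p (ord (u i)))) d t (I - {i}) c"
      using it(2) ge2 unfolding w_def m_def ex prim(1) idx(1) by (simp add: idx)
    show "\<not> p dvd q * r" using dist pr by (simp add: prime_dvd_mult_iff)
    show "0 < q * r" using ge2 by simp
    show "q * r dvd d i * y i" if i: "i \<in> I" for i
    proof (rule qr_dvd)
      have "q ^ idx_exp q jq dvd q ^ m q i * X (u i) jq"
        using primary_dvd[OF pr(2) D(3)[OF i], of jq] prim by (simp add: m_def)
      then have "q dvd q ^ m q i * X (u i) jq * r ^ m r i" using idx by simp
      then have "q dvd d i * X (u i) jq" by (simp add: d_def mult_ac)
      moreover have "[d i * y i = d i * X (u i) jq] (mod q)" using y by (intro cong_mult) auto
      ultimately show "q dvd d i * y i" using cong_dvd_iff by blast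
      have "r ^ idx_exp r jr dvd r ^ m r i * X (u i) jr"
        using primary_dvd[OF pr(3) D(3)[OF i], of jr] prim by (simp add: m_def)
      then have "r dvd r ^ m r i * X (u i) jr * q ^ m q i" using idx by simp
      then have "r dvd d i * X (u i) jr" by (simp add: d_def mult_ac)
      moreover have "[d i * y i = d i * X (u i) jr] (mod r)" using y by (intro cong_mult) auto
      ultimately show "r dvd d i * y i" using cong_dvd_iff by blast
    qed
    show "\<forall>j<length ns. j \<notin> primary_indices p \<longrightarrow> ns ! j dvd (\<Sum>i\<in>T. X (u i) j)" if "q * r dvd (\<Sum>i\<in>T. y i)" for T
    proof -
      have "q dvd (\<Sum>i\<in>T. y i)" "r dvd (\<Sum>i\<in>T. y i)" using that dvd_mult_left dvd_mult_right by blast+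
      moreover have "[(\<Sum>i\<in>T. y i) = (\<Sum>i\<in>T. X (u i) jq)] (mod q)" "[(\<Sum>i\<in>T. y i) = (\<Sum>i\<in>T. X (u i) jr)] (mod r)"
        using y by (auto intro!: cong_sum)
      ultimately have "q dvd (\<Sum>i\<in>T. X (u i) jq)" "r dvd (\<Sum>i\<in>T. X (u i) jr)" using cong_dvd_iff by blast+
      then show ?thesis unfolding all_j prim using j by simp
    qed
  qed
qed

end

section \<open>The cross number\<close>

context coordinate_group
begin

text \<open>Interface between the two shapes of group and the conclusion: the cross number and the
  structure of extremal sequences are derived from this property without looking at the shape
  again.\<close>

definition two_mixed_suboptimal :: bool where
  "two_mixed_suboptimal \<longleftrightarrow> (\<forall>(u :: nat \<Rightarrow> 'a) I i1 i2. minimal_zero_index u I \<and> i1 \<in> I \<and> i2 \<in> I \<and> i1 \<noteq> i2 \<and>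
     mixed (u i1) \<and> mixed (u i2) \<longrightarrow> (\<Sum>i\<in>I. 1 / real (ord (u i))) < kst + 1 / real (group_exp G))"

text \<open>The cyclic factor has to be located in an arbitrary decomposition \<open>ns\<close>. An
  element of order \<open>q ^ k\<close> needs an entry divisible by \<open>q ^ k\<close>, and the
  group order leaves only powers of \<open>p\<close> for the others.\<close>

lemma two_mixed_suboptimal_prime_power:
  assumes pq: "prime p" "prime q" "p \<noteq> q" and ord: "(\<Prod>i<length ns. ns ! i) = p ^ n * q ^ k" and k: "k > 0"
    and x: "x \<in> carrier G" "ord x = q ^ k"
  shows two_mixed_suboptimal
proof -
  have q0: "q > 0" "q > 1" using pq prime_gt_0_nat prime_gt_1_nat by auto
  obtain k' where k': "k = Suc k'" using k by (cases k) auto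
  have "\<not> ord x dvd q ^ k'"
  proof
    assume "ord x dvd q ^ k'"
    then have "q ^ k \<le> q ^ k'" using x q0 by (intro dvd_imp_le) auto
    then show False using q0 k' by simp
  qed
  then obtain j0 where j0: "j0 < length ns" "\<not> ns ! j0 dvd q ^ k' * X x j0" using ord_dvd_iff[OF x(1)] by blast
  have d0: "ns ! j0 dvd q ^ k * X x j0" using ord_dvd_iff[OF x(1), of "q ^ k"] x j0 by simp
  from primepow_ns[OF j0(1)] obtain P c where P: "prime P" "c > 0" "ns ! j0 = P ^ c" by (auto simp: primepow_def)
  have Pq: "P = q"
  proof (rule ccontr)
    assume "P \<noteq> q"
    then have "coprime (P ^ c) (q ^ k)" using P pq by (simp add: primes_coprime)
    then have "P ^ c dvd X x j0" using d0 P by (simp add: coprime_dvd_mult_right_iff)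
    then show False using j0 P by simp
  qed
  have ck: "k \<le> c"
  proof (rule ccontr)
    assume "\<not> k \<le> c"
    then have "P ^ c dvd q ^ k'" using Pq k' by (simp add: le_imp_power_dvd)
    then show False using j0 P by simp
  qed
  have pnq: "\<not> q dvd p" using pq primes_dvd_imp_eq by blast
  have rest: "(\<Prod>i<length ns. ns ! i) = ns ! j0 * (\<Prod>i\<in>{..<length ns} - {j0}. ns ! i)"
    using j0 by (simp add: prod.remove)
  have cop: "coprime (q ^ c) (p ^ n)" using pq by (simp add: primes_coprime)
  have "q ^ c dvd p ^ n * q ^ k" using rest ord P Pq by (metis dvd_triv_left)
  then have "q ^ c dvd q ^ k" using cop by (simp add: coprime_dvd_mult_right_iff)
  then have "q ^ c \<le> q ^ k" using q0 by (intro dvd_imp_le) auto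
  then have "c \<le> k" using q0 power_increasing_iff by blast
  then have nsj0: "ns ! j0 = q ^ k" using P Pq ck by simp
  then have R: "(\<Prod>i\<in>{..<length ns} - {j0}. ns ! i) = p ^ n" using rest ord q0 by (simp add: mult.commute)
  have pd: "p dvd ns ! j" if j: "j < length ns" "j \<noteq> j0" for j
  proof -
    from primepow_ns[OF j(1)] obtain P c where P: "prime P" "c > 0" "ns ! j = P ^ c" by (auto simp: primepow_def)
    have "ns ! j dvd p ^ n" unfolding R[symmetric] using j by (intro dvd_prodI) auto
    moreover have "P dvd ns ! j" using P by simp
    ultimately have "P dvd p ^ n" by (rule dvd_trans[rotated])
    then have "P dvd p" by (rule prime_dvd_power[OF P(1)])
    then have "P = p" using P pq by (simp add: primes_dvd_imp_eq)
    then show ?thesis using P by simp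
  qed
  show ?thesis
    unfolding two_mixed_suboptimal_def
    by (intro allI impI, elim conjE) (rule mixed_bound_prime_power[OF _ pq j0(1) nsj0 pd])
qed

text \<open>The group order is squarefree, so the entries of any decomposition are the three primes,
  once each.\<close>

lemma two_mixed_suboptimal_three_primes:
  assumes pr: "prime p" "prime q" "prime r" "p \<noteq> q" "p \<noteq> r" "q \<noteq> r" and ord: "(\<Prod>i<length ns. ns ! i) = p * q * r"
  shows two_mixed_suboptimal
proof -
  have dist: "\<not> p dvd q * r" "\<not> q dvd p * r" "\<not> r dvd p * q"
    using pr by (auto simp: prime_dvd_mult_iff dest: primes_dvd_imp_eq)
  have pos: "p > 0" "q > 0" "r > 0" using pr prime_gt_0_nat by auto
  have prm: "ns ! j = P" if j: "j < length ns" "P dvd ns ! j" and P: "P \<in> {p, q, r}" for j P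
  proof -
    have Pp: "prime P" using P pr by auto
    have jP: "j \<in> primary_indices P" using j by (simp add: primary_indices_def)
    define c where "c = idx_exp P j"
    have nsj: "ns ! j = P ^ c" using ns_eq_power[OF Pp jP] by (simp add: c_def)
    have "ns ! j dvd p * q * r" unfolding ord[symmetric] using j by (intro dvd_prodI) auto
    moreover have "\<not> P * P dvd p * q * r"
    proof
      assume dd: "P * P dvd p * q * r"
      consider "P = p" | "P = q" | "P = r" using P by blast
      then show False
      proof cases
        case 1
        then have "p * p dvd p * (q * r)" using dd by (simp add: mult.assoc)
        then show False using dist pos by simp
      next
        case 2
        then have "q * q dvd q * (p * r)" using dd by (simp add: mult_ac)
        then show False using dist pos by simp
      next
        case 3
        then have "r * r dvd r * (p * q)" using dd by (simp add: mult_ac)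
        then show False using dist pos by simp
      qed
    qed
    moreover have "P * P dvd P ^ c" if "c \<ge> 2" using that le_imp_power_dvd[of 2 c P] by (simp add: power2_eq_square)
    ultimately have "c < 2" using nsj by (metis dvd_trans not_le)
    moreover have "c \<noteq> 0" using nsj j Pp by (metis not_prime_unit power_0)
    ultimately show ?thesis using nsj by (simp add: less_2_cases_iff)
  qed
  have ex: "\<exists>j<length ns. P dvd ns ! j" if P: "P \<in> {p, q, r}" for P
  proof -
    have "prime P" using P pr by auto
    moreover have "P dvd (\<Prod>i<length ns. ns ! i)" unfolding ord using P by auto
    ultimately show ?thesis by (metis finite_lessThan lessThan_iff prime_dvd_prod_iff)
  qed
  obtain jp where jp: "jp < length ns" "ns ! jp = p" using ex[of p] prm[of _ p] by auto
  obtain jq where jq: "jq < length ns" "ns ! jq = q" using ex[of q] prm[of _ q] by auto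
  obtain jr where jr: "jr < length ns" "ns ! jr = r" using ex[of r] prm[of _ r] by auto
  have jd: "jp \<noteq> jq" "jp \<noteq> jr" "jq \<noteq> jr" using jp jq jr pr by auto
  have "j \<in> {jp, jq, jr}" if j: "j < length ns" for j
  proof (rule ccontr)
    assume n: "j \<notin> {jp, jq, jr}"
    have "(\<Prod>i\<in>{j, jp, jq, jr}. ns ! i) dvd (\<Prod>i<length ns. ns ! i)"
      using j jp jq jr by (intro prod_dvd_prod_subset) auto
    moreover have "(\<Prod>i\<in>{j, jp, jq, jr}. ns ! i) = ns ! j * (p * q * r)" using n jd jp jq jr by (simp add: mult.assoc)
    ultimately have "ns ! j * (p * q * r) dvd 1 * (p * q * r)" using ord by simp
    then have "ns ! j dvd 1" using dvd_times_right_cancel_iff[of "p * q * r" "ns ! j" 1] pos by simp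
    then show False using primepow_ns[OF j] by simp
  qed
  then have "{..<length ns} = {jp, jq, jr}" using jp jq jr by auto
  note three = mixed_bound_three_primes[OF _ pr this jp(2) jq(2) jr(2)]
  show ?thesis
    unfolding two_mixed_suboptimal_def by (intro allI impI, elim conjE) (rule three)
qed

context
  assumes fm: two_mixed_suboptimal
begin

text \<open>Two mixed terms give a strict inequality, so equality leaves at most one, which becomes
  \<open>g\<close>. If no term is mixed, any term can play that part.\<close>

lemma minimal_dichotomy:
  assumes U: "minimal_zero_sum G U"
  shows "cross_number G U \<le> kst + 1 / real (group_exp G)"
    and "cross_number G U = kst + 1 / real (group_exp G) \<Longrightarrow> \<exists>g R. U = add_mset g R \<and> (\<forall>x\<in>#R. \<not> mixed x)"
proof -
  obtain u where u: "U = image_mset u (mset_set {..<size U})" using ex_index_family by blast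
  define I where "I = {..<size U}"
  have M: "minimal_zero_index u I" using U u minimal_zero_sum_iff_index[of I u] by (simp add: I_def)
  note D = minimal_indexD[OF M]
  have cr: "cross_number G U = (\<Sum>i\<in>I. 1 / real (ord (u i)))"
    using cross_number_image_mset_set[of I u] u by (simp add: I_def)
  have cs: "(\<exists>i1\<in>I. \<exists>i2\<in>I. i1 \<noteq> i2 \<and> mixed (u i1) \<and> mixed (u i2))
      \<or> (\<exists>i0\<in>I. \<forall>i\<in>I - {i0}. \<not> mixed (u i))"
  proof (cases "\<exists>i0\<in>I. mixed (u i0)")
    case True
    then obtain i0 where i0: "i0 \<in> I" "mixed (u i0)" ..
    show ?thesis
    proof (cases "\<exists>i\<in>I - {i0}. mixed (u i)")
      case True
      then obtain i where "i \<in> I - {i0}" "mixed (u i)" ..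
      then show ?thesis using i0 by (intro disjI1 bexI[of _ i0] bexI[of _ i] conjI) auto
    next
      case False
      then have "\<forall>i\<in>I - {i0}. \<not> mixed (u i)" by simp
      with i0(1) show ?thesis by (intro disjI2) (rule bexI)
    qed
  next
    case False
    obtain i0 where "i0 \<in> I" using D(2) by auto
    moreover have "\<forall>i\<in>I - {i0}. \<not> mixed (u i)" using False by simp
    ultimately show ?thesis by (intro disjI2) (rule bexI[rotated])
  qed
  have many: "cross_number G U < kst + 1 / real (group_exp G)"
    if "\<exists>i1\<in>I. \<exists>i2\<in>I. i1 \<noteq> i2 \<and> mixed (u i1) \<and> mixed (u i2)"
  proof -
    from that obtain i1 where i1: "i1 \<in> I" "\<exists>i2\<in>I. i1 \<noteq> i2 \<and> mixed (u i1) \<and> mixed (u i2)" ..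
    from i1(2) obtain i2 where i2: "i2 \<in> I" "i1 \<noteq> i2 \<and> mixed (u i1) \<and> mixed (u i2)" ..
    show ?thesis unfolding cr
      by (rule fm[unfolded two_mixed_suboptimal_def, rule_format, of u I i1 i2]) (intro conjI M i1(1) i2(1) conjunct1[OF i2(2)] conjunct1[OF conjunct2[OF i2(2)]] conjunct2[OF conjunct2[OF i2(2)]])
  qed
  show "cross_number G U \<le> kst + 1 / real (group_exp G)"
    using cs
  proof
    assume "\<exists>i0\<in>I. \<forall>i\<in>I - {i0}. \<not> mixed (u i)"
    then obtain i0 where "i0 \<in> I" "\<forall>i\<in>I - {i0}. \<not> mixed (u i)" by blast
    then show ?thesis unfolding cr by (intro at_most_one_mixed_bound[OF M]) auto
  next
    assume "\<exists>i1\<in>I. \<exists>i2\<in>I. i1 \<noteq> i2 \<and> mixed (u i1) \<and> mixed (u i2)"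
    from many[OF this] show ?thesis by simp
  qed
  assume eq: "cross_number G U = kst + 1 / real (group_exp G)"
  have "\<exists>i0\<in>I. \<forall>i\<in>I - {i0}. \<not> mixed (u i)"
    using cs
  proof
    assume "\<exists>i1\<in>I. \<exists>i2\<in>I. i1 \<noteq> i2 \<and> mixed (u i1) \<and> mixed (u i2)"
    from many[OF this] eq show ?thesis by simp
  qed
  then obtain i0 where i0: "i0 \<in> I" "\<forall>i\<in>I - {i0}. \<not> mixed (u i)" by blast
  have "mset_set I = add_mset i0 (mset_set (I - {i0}))" using i0 D(1) by (simp add: mset_set.remove)
  then have "U = add_mset (u i0) (image_mset u (mset_set (I - {i0})))" using u by (simp add: I_def)
  moreover have "\<forall>x\<in>#image_mset u (mset_set (I - {i0})). \<not> mixed x" using i0 D(1) by auto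
  ultimately show "\<exists>g R. U = add_mset g R \<and> (\<forall>x\<in>#R. \<not> mixed x)" by blast
qed

text \<open>For \<open>Max\<close> to be meaningful the set of values must be finite: they are
  bounded multiples of the reciprocal of the exponent.\<close>

lemma group_cross_number_eq: "group_cross_number G = kst + 1 / real (group_exp G)"
proof -
  let ?A = "{cross_number G S | S. minimal_zero_sum G S}" and ?K = "kst + 1 / real (group_exp G)"
  let ?E = "group_exp G"
  have "?A \<subseteq> (\<lambda>t. real t / real ?E) ` {..nat \<lceil>?K * real ?E\<rceil>}"
  proof
    fix c assume "c \<in> ?A"
    then obtain U where U: "minimal_zero_sum G U" "c = cross_number G U" by blast
    have sub: "set_mset U \<subseteq> carrier G" using U by (simp add: minimal_zero_sum_def zero_sum_def)
    define t where "t = (\<Sum>g\<in>set_mset U. count U g * (?E div ord g))"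
    have "real t = (\<Sum>g\<in>set_mset U. real (count U g) / real (ord g) * real ?E)"
      unfolding t_def of_nat_sum
    proof (rule sum.cong[OF refl])
      fix g assume "g \<in># U"
      then have "ord g dvd ?E" using sub ord_dvd_exp by blast
      then show "real (count U g * (?E div ord g)) = real (count U g) / real (ord g) * real ?E"
        by (simp add: real_of_nat_div)
    qed
    also have "\<dots> = c * real ?E" unfolding U(2) cross_number_def by (simp add: sum_distrib_right)
    finally have tc: "real t = c * real ?E" .
    have "c \<le> ?K" using minimal_dichotomy(1)[OF U(1)] U(2) by simp
    then have "real t \<le> ?K * real ?E" unfolding tc by (intro mult_right_mono) auto
    then have "t \<le> nat \<lceil>?K * real ?E\<rceil>" by linarith
    moreover have "c = real t / real ?E" using tc exp_pos by simp
    ultimately show "c \<in> (\<lambda>t. real t / real ?E) ` {..nat \<lceil>?K * real ?E\<rceil>}" by blast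
  qed
  then have "finite ?A" by (rule finite_subset) simp
  moreover have "?K \<in> ?A" using ex_extremal by (metis (mono_tags, lifting) mem_Collect_eq)
  moreover have "c \<le> ?K" if "c \<in> ?A" for c using that minimal_dichotomy(1) by blast
  ultimately show ?thesis unfolding group_cross_number_def by (intro Max_eqI) auto
qed

end

text \<open>A zero-sum free sequence omits the identity, so the order of each non-mixed term has
  exactly one prime divisor, and filtering by that prime partitions the sequence.\<close>

lemma primary_splitting:
  assumes R: "zero_sum_free G R" and pp: "\<forall>x\<in>#R. \<not> mixed x"
  shows "\<exists>V :: nat \<Rightarrow> 'a multiset.
    (\<forall>p\<in>prime_factors (group_exp G). set_mset (V p) \<subseteq> primary_component G p \<and> zero_sum_free G (V p)) \<and>
    R = (\<Sum>p\<in>prime_factors (group_exp G). V p)"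
proof -
  have sub: "set_mset R \<subseteq> carrier G" using R by (simp add: zero_sum_free_def)
  define V where "V = (\<lambda>p. filter_mset (\<lambda>x. p dvd ord x) R)"
  have unit: "ord x \<noteq> 1" if x: "x \<in># R" for x
  proof
    assume "ord x = 1"
    then have "x = \<one>" using ord_eq_1 sub x by blast
    then have "zero_sum G {#x#}" by (simp add: zero_sum_def seq_sum_def)
    moreover have "{#x#} \<subseteq># R" using x by simp
    ultimately show False using R by (auto simp: zero_sum_free_def)
  qed
  have pow: "\<exists>k. ord x = p ^ k" if "x \<in># R" "prime p" "p dvd ord x" for x p
  proof -
    obtain P k where P: "prime P" "ord x = P ^ k" using pp \<open>x \<in># R\<close> by blast
    then have "p dvd P" using that prime_dvd_power by metis
    then show ?thesis using P that primes_dvd_imp_eq by blast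
  qed
  have "set_mset (V p) \<subseteq> primary_component G p \<and> zero_sum_free G (V p)" if "p \<in> prime_factors (group_exp G)" for p
  proof
    have "prime p" using that by (auto simp: in_prime_factors_iff)
    then show "set_mset (V p) \<subseteq> primary_component G p" using pow sub by (auto simp: V_def primary_component_def)
    have "V p \<subseteq># R" by (simp add: V_def)
    then show "zero_sum_free G (V p)" using R unfolding zero_sum_free_def
      by (meson set_mset_mono subset_mset.order_trans subset_trans)
  qed
  moreover have "R = (\<Sum>p\<in>prime_factors (group_exp G). V p)"
  proof (rule multiset_eqI)
    fix x
    show "count R x = count (\<Sum>p\<in>prime_factors (group_exp G). V p) x"
    proof (cases "x \<in># R")
      case True
      then have xc: "x \<in> carrier G" using sub by blast
      obtain P where P: "prime P" "P dvd ord x" using unit[OF True] prime_factor_nat by blast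
      have PE: "P \<in> prime_factors (group_exp G)"
        using P ord_dvd_exp[OF xc] exp_pos by (auto simp: in_prime_factors_iff intro: dvd_trans)
      have uniq: "p = P" if "p \<in> prime_factors (group_exp G)" "p dvd ord x" for p
      proof -
        have "prime p" using that by (auto simp: in_prime_factors_iff)
        from pow[OF True this that(2)] obtain k where "ord x = p ^ k" by blast
        then have "P dvd p" using P prime_dvd_power by metis
        then show ?thesis using P \<open>prime p\<close> primes_dvd_imp_eq by blast
      qed
      have "count (\<Sum>p\<in>prime_factors (group_exp G). V p) x = (\<Sum>p\<in>prime_factors (group_exp G). count (V p) x)"
        by (simp add: count_sum)
      also have "\<dots> = (\<Sum>p\<in>prime_factors (group_exp G). if p = P then count R x else 0)"
      proof (rule sum.cong[OF refl])
        fix p assume p: "p \<in> prime_factors (group_exp G)"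
        show "count (V p) x = (if p = P then count R x else 0)"
        proof (cases "p = P")
          case True
          then show ?thesis using P(2) by (simp add: V_def)
        next
          case False
          then have "\<not> p dvd ord x" using uniq[OF p] by (rule contrapos_nn)
          then show ?thesis using False by (simp add: V_def)
        qed
      qed
      finally show ?thesis using PE by simp
    next
      case False
      then show ?thesis by (simp add: V_def count_sum not_in_iff)
    qed
  qed
  ultimately show ?thesis by blast
qed

end

context comm_group
begin

section \<open>From zero-sum free to minimal zero-sum sequences\<close>

lemma seq_sum_closed: "set_mset S \<subseteq> carrier G \<Longrightarrow> seq_sum G S \<in> carrier G"
  unfolding seq_sum_def by (rule finprod_closed) auto

lemma seq_sum_union:
  assumes "set_mset A \<subseteq> carrier G" "set_mset B \<subseteq> carrier G"
  shows "seq_sum G (A + B) = seq_sum G A \<otimes> seq_sum G B"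
  using assms(1)
proof (induction A)
  case empty
  show ?case using seq_sum_closed[OF assms(2)] by (simp add: seq_sum_def)
next
  case (add x A)
  then have "seq_sum G (add_mset x (A + B)) = x \<otimes> (seq_sum G A \<otimes> seq_sum G B)"
    using assms(2) by (subst seq_sum_add_mset) auto
  also have "\<dots> = seq_sum G (add_mset x A) \<otimes> seq_sum G B"
    using add seq_sum_closed assms(2) by (subst seq_sum_add_mset) (auto simp: m_assoc)
  finally show ?case by simp
qed

text \<open>A proper zero-sum subsequence using the added term would leave a nonempty complement
  inside \<open>S\<close>, again with sum zero.\<close>

lemma zero_sum_free_extend:
  assumes S: "zero_sum_free G S"
  shows "minimal_zero_sum G (add_mset (inv (seq_sum G S)) S)"
proof -
  have c: "set_mset S \<subseteq> carrier G" using S by (simp add: zero_sum_free_def)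
  define s where "s = seq_sum G S"
  have s: "s \<in> carrier G" unfolding s_def by (rule seq_sum_closed[OF c])
  have z: "zero_sum G (add_mset (inv s) S)"
    using c s seq_sum_add_mset[of "inv s" S] by (simp add: zero_sum_def s_def)
  have "\<not> zero_sum G T" if T: "T \<subset># add_mset (inv s) S" "T \<noteq> {#}" for T
  proof
    assume zT: "zero_sum G T"
    show False
    proof (cases "T \<subseteq># S")
      case True
      then show False using S T zT by (auto simp: zero_sum_free_def)
    next
      case False
      have "inv s \<in># T"
      proof (rule ccontr)
        assume n: "inv s \<notin># T"
        have "count T a \<le> count S a" for a
          using mset_subset_eq_count[OF subset_mset.less_imp_le[OF T(1)], of a] n by (cases "a = inv s") (auto simp: not_in_iff)
        with False show False by (meson mset_subset_eqI)
      qed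
      then obtain T' where T': "T = add_mset (inv s) T'" by (metis mset_add)
      then have sub: "T' \<subset># S" using T by simp
      then have eq: "S = T' + (S - T')" by (simp add: subset_mset.less_imp_le)
      have cT: "set_mset T' \<subseteq> carrier G" "set_mset (S - T') \<subseteq> carrier G"
        using c sub by (meson set_mset_mono subset_mset.less_imp_le subset_trans, meson in_diffD subsetD subsetI c)
      have "inv s \<otimes> seq_sum G T' = \<one>"
        using zT seq_sum_add_mset[of "inv s" T'] cT s unfolding T' by (simp add: zero_sum_def)
      then have "seq_sum G T' = s" using s seq_sum_closed[OF cT(1)] by (metis inv_equality inv_inv inv_closed m_comm)
      moreover have "s = seq_sum G T' \<otimes> seq_sum G (S - T')"
        unfolding s_def using seq_sum_union[OF cT] eq by simp
      ultimately have "s \<otimes> seq_sum G (S - T') = s \<otimes> \<one>" using s by simp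
      then have "seq_sum G (S - T') = \<one>" using s seq_sum_closed[OF cT(2)] by simp
      then have "zero_sum G (S - T')" using cT by (simp add: zero_sum_def)
      moreover have "S - T' \<noteq> {#}" using sub by (metis Diff_eq_empty_iff_mset subset_mset.leD)
      ultimately show False using S by (auto simp: zero_sum_free_def)
    qed
  qed
  then show ?thesis using z unfolding minimal_zero_sum_def s_def by auto
qed

end

lemma iso_card: "G \<cong> H \<Longrightarrow> card (carrier G) = card (carrier H)"
  by (auto simp: is_iso_def iso_def bij_betw_same_card)

lemma (in group) ex_ord_second_factor:
  assumes H: "group H" and iso: "G \<cong> H \<times>\<times> integer_mod_group n" and n: "n > 1"
  shows "\<exists>x\<in>carrier G. ord x = n"
proof -
  let ?P = "H \<times>\<times> integer_mod_group n"
  have gP: "group ?P" by (rule DirProd_group[OF H]) simp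
  obtain f where f: "f \<in> hom G ?P" "bij_betw f (carrier G) (carrier ?P)" using iso by (auto simp: is_iso_def iso_def)
  \<comment> \<open>The generator 1 of the cyclic factor; \<open>n > 1\<close> puts it into the
    carrier.\<close>
  have one: "(\<one>\<^bsub>H\<^esub>, 1) \<in> carrier ?P" using n group.is_monoid[OF H] by (simp add: monoid.one_closed)
  then obtain x where x: "x \<in> carrier G" "f x = (\<one>\<^bsub>H\<^esub>, 1)" using f(2) by (metis bij_betw_def imageE)
  have fx: "f (x [^] m) = (\<one>\<^bsub>H\<^esub>, int m mod int n)" for m :: nat
  proof (induction m)
    case 0
    show ?case using hom_one[OF f(1) is_group gP] by simp
  next
    case (Suc m)
    have "f (x [^] Suc m) = f (x [^] m) \<otimes>\<^bsub>?P\<^esub> f x" using hom_mult[OF f(1), of "x [^] m" x] x by simp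
    then show ?case using Suc x group.is_monoid[OF H] by (simp add: monoid.l_one monoid.one_closed mod_simps add.commute)
  qed
  have "x [^] m = \<one> \<longleftrightarrow> n dvd m" for m :: nat
  proof -
    have "x [^] m = \<one> \<longleftrightarrow> f (x [^] m) = f \<one>" using f(2) x by (metis bij_betw_def inj_onD nat_pow_closed one_closed)
    also have "\<dots> \<longleftrightarrow> int m mod int n = 0" using fx[of m] hom_one[OF f(1) is_group gP] by simp
    finally show ?thesis by (simp add: dvd_eq_mod_eq_0 flip: zmod_int)
  qed
  then have "ord x = n" using ord_unique[OF x(1)] by blast
  then show ?thesis using x by blast
qed

theorem theorem8:
  fixes G :: "('a, 'b) monoid_scheme"
  assumes "comm_group G" and "finite (carrier G)"
    and "(\<exists>(p::nat) (q::nat) (k::nat) (H :: 'h monoid).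
            prime p \<and> prime q \<and> p \<noteq> q \<and> k > 0 \<and>
            comm_group H \<and> (\<exists>n. order H = p ^ n) \<and>
            G \<cong> H \<times>\<times> integer_mod_group (q ^ k)) \<or>
         (\<exists>(p::nat) (q::nat) (r::nat).
            prime p \<and> prime q \<and> prime r \<and> p \<noteq> q \<and> p \<noteq> r \<and> q \<noteq> r \<and>
            G \<cong> integer_mod_group p \<times>\<times> integer_mod_group q \<times>\<times> integer_mod_group r)"
  shows "(\<forall>U. minimal_zero_sum G U \<and> cross_number G U = group_cross_number G \<longrightarrow>
            (\<exists>g\<in>carrier G. \<exists>V :: nat \<Rightarrow> 'a multiset.
               (\<forall>p\<in>prime_factors (group_exp G).
                  set_mset (V p) \<subseteq> primary_component G p \<and> zero_sum_free G (V p)) \<and>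
               U = {#g#} + (\<Sum>p\<in>prime_factors (group_exp G). V p))) \<and>
         (group_cross_number G = K_star G \<and>
          K_star G = k_star G + 1 / real (group_exp G) \<and>
          (\<forall>S. zero_sum_free G S \<and> cross_number G S = k_star G \<longrightarrow>
            (\<exists>V :: nat \<Rightarrow> 'a multiset.
               (\<forall>p\<in>prime_factors (group_exp G).
                  set_mset (V p) \<subseteq> primary_component G p \<and> zero_sum_free G (V p)) \<and>
               S = (\<Sum>p\<in>prime_factors (group_exp G). V p))))"
proof -
  interpret comm_group G by fact
  have fin: "finite (carrier G)" by fact
  \<comment> \<open>The very decomposition selected in \<open>k_star\<close>, so that
    \<open>k_star G\<close> equals \<open>kst\<close>.\<close>
  define ns where "ns = (SOME ns. prime_power_decomposition G ns)"
  have dec: "prime_power_decomposition G ns"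
    unfolding ns_def using ex_prime_power_decomposition[OF fin] by (rule someI_ex)
  obtain X where "coordinate_group G ns X" using ex_coordinate_group[OF fin dec] by blast
  then interpret coordinate_group G ns X .
  have kstar: "k_star G = kst"
  proof -
    have "k_star G = (\<Sum>n\<leftarrow>ns. 1 - 1 / real n)" by (simp add: k_star_def ns_def)
    also have "\<dots> = kst" by (simp add: sum_list_sum_nth kst_def atLeast0LessThan)
    finally show ?thesis .
  qed
  have order: "(\<Prod>i<length ns. ns ! i) = card (carrier G)"
    using order_decomposition[OF dec] by (simp add: order_def)
  have cardZ: "card (carrier (integer_mod_group n)) = n" if "n > 0" for n
    using that by (simp add: carrier_integer_mod_group)
  from assms(3) have fm: two_mixed_suboptimal
  proof (elim disjE exE conjE)
    fix p q k n :: nat and H :: "'h monoid"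
    assume a: "prime p" "prime q" "p \<noteq> q" "0 < k" "comm_group H" "order H = p ^ n"
      "G \<cong> H \<times>\<times> integer_mod_group (q ^ k)"
    have q: "q ^ k > 1" using a prime_gt_1_nat by (metis one_less_power)
    have "group H" using a(5) by (simp add: comm_group.axioms(2))
    then obtain x where x: "x \<in> carrier G" "ord x = q ^ k" using ex_ord_second_factor[OF _ a(7) q] by blast
    have "card (carrier (integer_mod_group (q ^ k))) = q ^ k" by (rule cardZ) (use q in linarith)
    then have "card (carrier G) = p ^ n * q ^ k"
      using iso_card[OF a(7)] a(6) by (simp add: order_def card_cartesian_product)
    then have "(\<Prod>i<length ns. ns ! i) = p ^ n * q ^ k" using order by simp
    then show two_mixed_suboptimal by (rule two_mixed_suboptimal_prime_power[OF a(1-3) _ a(4) x])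
  next
    fix p q r :: nat
    assume a: "prime p" "prime q" "prime r" "p \<noteq> q" "p \<noteq> r" "q \<noteq> r"
      "G \<cong> integer_mod_group p \<times>\<times> integer_mod_group q \<times>\<times> integer_mod_group r"
    have "card (carrier G) = p * q * r"
      using iso_card[OF a(7)] a(1-3)[THEN prime_gt_0_nat, THEN cardZ] by (simp add: card_cartesian_product)
    then have "(\<Prod>i<length ns. ns ! i) = p * q * r" using order by simp
    then show two_mixed_suboptimal by (rule two_mixed_suboptimal_three_primes[OF a(1-6)])
  qed
  have K: "group_cross_number G = K_star G"
    using group_cross_number_eq[OF fm] by (simp add: K_star_def kstar)
  have K': "K_star G = kst + 1 / real (group_exp G)" by (simp add: K_star_def kstar)
  have part1: "\<exists>g\<in>carrier G. \<exists>V :: nat \<Rightarrow> 'a multiset.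
       (\<forall>p\<in>prime_factors (group_exp G). set_mset (V p) \<subseteq> primary_component G p \<and> zero_sum_free G (V p)) \<and>
       U = {#g#} + (\<Sum>p\<in>prime_factors (group_exp G). V p)"
    if U: "minimal_zero_sum G U" "cross_number G U = group_cross_number G" for U
  proof -
    obtain g R where gR: "U = add_mset g R" "\<forall>x\<in>#R. \<not> mixed x"
      using minimal_dichotomy(2)[OF fm U(1)] U(2) K K' by auto
    have c: "set_mset U \<subseteq> carrier G" using U by (simp add: minimal_zero_sum_def zero_sum_def)
    have "zero_sum_free G R"
      unfolding zero_sum_free_def
    proof (intro conjI allI impI)
      show "set_mset R \<subseteq> carrier G" using c gR by simp
      fix T assume T: "T \<subseteq># R \<and> T \<noteq> {#}"
      have "R \<subset># U" using gR by simp
      then have "T \<subset># U" using T subset_mset.le_less_trans by blast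
      then show "\<not> zero_sum G T" using U T by (simp add: minimal_zero_sum_def)
    qed
    from primary_splitting[OF this gR(2)] show ?thesis using gR c by (intro bexI[of _ g]) auto
  qed
  have part2: "\<exists>V :: nat \<Rightarrow> 'a multiset.
       (\<forall>p\<in>prime_factors (group_exp G). set_mset (V p) \<subseteq> primary_component G p \<and> zero_sum_free G (V p)) \<and>
       S = (\<Sum>p\<in>prime_factors (group_exp G). V p)"
    if S: "zero_sum_free G S" "cross_number G S = k_star G" for S
  proof (rule primary_splitting[OF S(1)])
    have c: "set_mset S \<subseteq> carrier G" using S by (simp add: zero_sum_free_def)
    define h where "h = inv\<^bsub>G\<^esub> (seq_sum G S)"
    have h: "h \<in> carrier G" using seq_sum_closed[OF c] by (simp add: h_def)
    have U: "minimal_zero_sum G (add_mset h S)" unfolding h_def by (rule zero_sum_free_extend[OF S(1)])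
    have cr: "cross_number G (add_mset h S) = 1 / real (ord h) + kst"
      using S(2) kstar by (simp add: cross_number_add_mset)
    \<comment> \<open>As \<open>S\<close> already has cross number \<open>k_star G\<close>, the
      upper bound leaves at most the reciprocal of the exponent for \<open>h\<close>, which forces
      the order of \<open>h\<close> to be the exponent.\<close>
    then have "1 / real (ord h) \<le> 1 / real (group_exp G)" using minimal_dichotomy(1)[OF fm U] by simp
    then have "group_exp G \<le> ord h" using ord_pos[OF h] exp_pos by (simp add: divide_simps)
    then have oh: "ord h = group_exp G" using ord_dvd_exp[OF h] exp_pos by (simp add: dvd_imp_le le_antisym)
    obtain g R where gR: "add_mset h S = add_mset g R" "\<forall>x\<in>#R. \<not> mixed x"
      using minimal_dichotomy(2)[OF fm U] cr oh by auto
    show "\<forall>x\<in>#S. \<not> mixed x"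
    \<comment> \<open>If the exceptional term is not \<open>h\<close>, then \<open>h\<close> is not
      mixed; its order is the exponent, so the exponent is a prime power and no element at all is
      mixed.\<close>
    proof (cases "h = g")
      case True
      then show ?thesis using gR by simp
    next
      case False
      have "h \<in># add_mset g R" unfolding gR(1)[symmetric] by simp
      then have "h \<in># R" using False by simp
      with gR(2) have "\<not> mixed h" by (rule bspec)
      then obtain P k where P: "prime P" "group_exp G = P ^ k" unfolding oh by blast
      have "\<not> mixed x" if "x \<in># S" for x
      proof -
        have "ord x dvd P ^ k" using ord_dvd_exp[of x] that c P(2) by auto
        then obtain i where "ord x = P ^ i" using divides_primepow_nat[OF P(1)] by blast
        then show ?thesis using P by blast
      qed
      then show ?thesis by blast
    qed
  qed
  show ?thesis using part1 part2 K kstar by (auto simp: K_star_def)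
qed

end
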